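(* Let $2\le n\le d$ be integers and let $a\in\mathbb{R}$ satisfy $a+n>0$. Let $u\in H^{1,a}(B_1)$ be axially symmetric in $y$ and be a weak solution to $-\operatorname{div}(|y|^a\nabla u)=0$ in $B_1$ across $\Sigma_0$, that is, $$\int_{B_1}|y|^a\nabla u\cdot\nabla\phi\,dz=0\qquad\text{for every }\phi\in C_c^\infty(B_1).$$ Then $u\in C^\infty_{\rm loc}(B_1)$, i.e. $u$ coincides almost everywhere with a function which is infinitely differentiable in $B_1$ (including at points of $\Sigma_0$).
   Context: Points of $\mathbb{R}^d$ are written $z=(x,y)\in\mathbb{R}^{d-n}\times\mathbb{R}^n$; $\Sigma_0=\{(x,y)\in\mathbb{R}^d : |y|=0\}$; $B_1$ is the open unit ball of $\mathbb{R}^d$ centered at $0$. For $a+n>0$, $H^{1,a}(B_1)=H^1(B_1,|y|^a dz)$ is the weighted Sobolev space, i.e. the completion of $C^\infty(\overline{B_1})$ with respect to the norm $\big(\int_{B_1}|y|^a(u^2+|\nabla u|^2)\,dz\big)^{1/2}$. A function $u:B_1\to\mathbb{R}$ is axially symmetric in $y$ if there exists $\tilde u:B_1^+\to\mathbb{R}$ such that $u(x,y)=\tilde u(x,|y|)$, where $B_1^+=\{(x,r)\in\mathbb{R}^{d-n}\times\mathbb{R} : |x|^2+r^2<1,\ r>0\}$. "Across $\Sigma_0$" refers to the fact that the test functions are not required to vanish near $\Sigma_0$. *)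

theory Defs
  imports "HOL-Analysis.Analysis"
begin

text \<open>
  Coordinates: a set \<open>Y\<close> of \<open>n\<close> coordinate directions of \<open>\<real>\<^sup>d\<close> singles out \<open>y\<close>, the remaining ones
  form \<open>x\<close> (so \<open>d = CARD('d)\<close>, and \<open>n = d\<close> is allowed: then \<open>Y = UNIV\<close> and \<open>x\<close> is trivial). Both parts
  are kept inside \<open>\<real>\<^sup>d\<close>, padded with zeros, so that \<open>z = x + y\<close> and the norms agree with those
  on \<open>\<real>\<^sup>d\<^sup>-\<^sup>n\<close> and \<open>\<real>\<^sup>n\<close>.
\<close>

definition y_part :: "'d set \<Rightarrow> real^'d \<Rightarrow> real^'d::finite" where
  "y_part Y z = (\<chi> i. if i \<in> Y then z $ i else 0)"

definition x_part :: "'d set \<Rightarrow> real^'d \<Rightarrow> real^'d::finite" where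
  "x_part Y z = (\<chi> i. if i \<in> Y then 0 else z $ i)"

text \<open>The value at \<open>y = 0\<close>, where \<open>powr\<close> gives \<open>0\<close>, is irrelevant: \<open>\<Sigma>\<^sub>0\<close> is a null set.\<close>

definition weight :: "'d set \<Rightarrow> real \<Rightarrow> real^'d \<Rightarrow> real" where
  "weight Y a z = norm (y_part Y z) powr a" for z :: "real^'d::finite"

text \<open>For open \<open>S\<close>; on an open set this is equivalent to all partial derivatives up to order \<open>k\<close>
  existing and being continuous.\<close>

primrec Ck_on :: "nat \<Rightarrow> 'a::real_normed_vector set \<Rightarrow> ('a \<Rightarrow> 'b::real_normed_vector) \<Rightarrow> bool" where
  "Ck_on 0 S f \<longleftrightarrow> continuous_on S f"
| "Ck_on (Suc k) S f \<longleftrightarrow> (\<forall>x\<in>S. f differentiable (at x)) \<and>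
     (\<forall>v. Ck_on k S (\<lambda>x. frechet_derivative f (at x) v))"

definition smooth_on :: "'a::real_normed_vector set \<Rightarrow> ('a \<Rightarrow> 'b::real_normed_vector) \<Rightarrow> bool" where
  "smooth_on S f \<longleftrightarrow> (\<forall>k. Ck_on k S f)"

definition gradient :: "(real^'d \<Rightarrow> real) \<Rightarrow> real^'d \<Rightarrow> real^'d::finite" where
  "gradient f z = (\<chi> i. frechet_derivative f (at z) (axis i 1))"

text \<open>
  The completion of \<open>C\<^sup>\<infinity>\<close> of the closed unit ball (restrictions of smooth functions on \<open>\<real>\<^sup>d\<close>) is realised
  as the closure of the pairs \<open>(\<phi>, \<nabla>\<phi>)\<close> in the weighted \<open>L\<^sup>2\<close>: the function \<open>u\<close> belongs to it with
  gradient \<open>V\<close>. For almost every \<open>z\<close> the value \<open>V z\<close> is determined by \<open>u\<close>, since off the null set \<open>\<Sigma>\<^sub>0\<close>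
  the weight is locally bounded above and below, whence \<open>V\<close> is the weak gradient of \<open>u\<close> there.
  Functions on the ball are total functions whose values outside it play no role.
  The nonnegative extended integral is used, so that convergence to 0 forces it to be finite for all
  large \<open>k\<close>; hence \<open>u\<close> and \<open>V\<close> are in the weighted \<open>L\<^sup>2\<close> whenever the weight is integrable, i.e.
  for \<open>a + n > 0\<close>.
\<close>

definition has_H1_gradient ::
    "'d set \<Rightarrow> real \<Rightarrow> (real^'d \<Rightarrow> real) \<Rightarrow> (real^'d \<Rightarrow> real^'d::finite) \<Rightarrow> bool" where
  "has_H1_gradient Y a u V \<longleftrightarrow>
     u \<in> borel_measurable (lebesgue_on (ball 0 1)) \<and>
     V \<in> borel_measurable (lebesgue_on (ball 0 1)) \<and>
     (\<exists>\<phi> :: nat \<Rightarrow> real^'d \<Rightarrow> real. (\<forall>k. smooth_on UNIV (\<phi> k)) \<and>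
       (\<lambda>k. \<integral>\<^sup>+ z. ennreal (weight Y a z *
              ((u z - \<phi> k z)\<^sup>2 + (norm (V z - gradient (\<phi> k) z))\<^sup>2))
            \<partial>lebesgue_on (ball 0 1)) \<longlonglongrightarrow> 0)"

definition H1_weighted :: "'d set \<Rightarrow> real \<Rightarrow> (real^'d::finite \<Rightarrow> real) set" where
  "H1_weighted Y a = {u. \<exists>V. has_H1_gradient Y a u V}"

definition test_function :: "(real^'d::finite \<Rightarrow> real) \<Rightarrow> bool" where
  "test_function \<phi> \<longleftrightarrow> smooth_on UNIV \<phi> \<and>
     compact (closure {z. \<phi> z \<noteq> 0}) \<and> closure {z. \<phi> z \<noteq> 0} \<subseteq> ball 0 1"

definition weak_solution :: "'d set \<Rightarrow> real \<Rightarrow> (real^'d::finite \<Rightarrow> real) \<Rightarrow> bool" where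
  "weak_solution Y a u \<longleftrightarrow>
     (\<exists>V. has_H1_gradient Y a u V \<and>
       (\<forall>\<phi>. test_function \<phi> \<longrightarrow>
          (\<integral>z. weight Y a z * (V z \<bullet> gradient \<phi> z) \<partial>lebesgue_on (ball 0 1)) = 0))"

text \<open>Elements of the weighted Sobolev space are classes modulo null sets, so the representation
  \<open>u(x,y) = w(x,|y|)\<close> is required almost everywhere (in particular only off \<open>\<Sigma>\<^sub>0\<close>, where \<open>|y| > 0\<close>).\<close>

definition axially_symmetric :: "'d set \<Rightarrow> (real^'d::finite \<Rightarrow> real) \<Rightarrow> bool" where
  "axially_symmetric Y u \<longleftrightarrow>
     (\<exists>w :: real^'d \<Rightarrow> real \<Rightarrow> real.
        AE z in lebesgue_on (ball 0 1). u z = w (x_part Y z) (norm (y_part Y z)))"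

end

theory Submission
  imports Defs
begin

text \<open>
  Put \<open>m = a + n > 0\<close>, \<open>L = \<Delta> + a \<bar>y\<bar>\<^sup>-\<^sup>2 y \<cdot> \<nabla>\<close>, and let \<open>F\<close> be a smooth function on the line that vanishes beyond some
  point. The generalised translation of \<open>F(\<bar>z\<bar>\<^sup>2)\<close> to \<open>\<zeta> = (\<xi>, \<eta>)\<close> is an average of \<open>F\<close> over the squared distances
  \<open>\<bar>x - \<xi>\<bar>\<^sup>2 + \<bar>y\<bar>\<^sup>2 + \<bar>\<eta>\<bar>\<^sup>2 - 2 \<bar>y\<bar> \<bar>\<eta>\<bar> sin t\<close>. This kernel \<open>K(\<zeta>, z)\<close> is smooth in both variables, also across
  \<open>\<Sigma>\<^sub>0\<close>, and the Euler-Poisson-Darboux equation shows that \<open>L\<close> gives the same result whether it acts on \<open>\<zeta>\<close> or on \<open>z\<close>.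
  Hence, for a weak solution \<open>u\<close>, the function \<open>v(\<zeta>) = \<integral> \<bar>y\<bar>\<^sup>a u K(\<zeta>, z) dz\<close> is smooth and satisfies \<open>L v = 0\<close> on a
  slightly smaller ball. Testing the equation with functions of \<open>\<bar>z - \<xi>\<bar>\<close>, for \<open>\<xi> \<in> \<Sigma>\<^sub>0\<close>, shows that all weighted radial
  means of \<open>u\<close> about \<open>\<xi>\<close> are determined by a single one, and likewise for \<open>v\<close>; with \<open>K\<close> normalised, the means of
  \<open>u\<close> and \<open>v\<close> agree. Differentiating these identities in \<open>\<xi>\<close>, and using the rotation invariance in \<open>y\<close>, one finds that
  \<open>\<bar>y\<bar>\<^sup>a (u - v)\<close> times a positive radial function is orthogonal to all polynomials, so that \<open>u = v\<close> almost everywhere.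
\<close>

section \<open>Smooth functions\<close>

text \<open>The weight is not invariant under translations in y, so an ordinary mollifier does not
  commute with \<open>L\<close>; the generalised translation does. Its natural density
  \<open>cos t powr (m - 2)\<close> is integrable only for \<open>m > 1\<close>; multiplied by
  \<open>m - 1\<close> and integrated by parts, the average makes sense for all
  \<open>m > 0\<close>, and this is \<open>kern\<close>. The quotient |y|^-2 y . grad in
  \<open>L\<close> is harmless only if it extends continuously across
  \<open>\<Sigma>\<^sub>0\<close>, so every test function comes with such an extension
  \<open>h\<close>. About a point \<xi> of the axis, \<open>L\<close> acts on P(t), t = |z -
  \<xi>|^2, as 4 (t P'' + D/2 P') with D = d + a. A profile of zero mass for t^(D/2 - 1) dt has this
  form with P vanishing beyond c, whence means are proportional to masses. By construction v(\<xi>)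
  is the normalised mean of u for the profile inside the kernel, and v, being continuous, has the
  mean value property; so this one mean agrees for u and v, and all others follow. Such means vanish
  for every function odd in a coordinate of y. This is why the symmetry of u, shared by v, must
  enter the uniqueness proof.\<close>

lemma Ck_on_Suc_imp: "Ck_on (Suc k) S f \<Longrightarrow> Ck_on k S f"
proof (induction k arbitrary: f)
  case 0
  then show ?case
    by (auto intro!: continuous_at_imp_continuous_on differentiable_imp_continuous_within)
next
  case (Suc k)
  then show ?case by (auto simp del: Ck_on.simps simp add: Ck_on.simps(2)[of "Suc k"] Ck_on.simps(2)[of k])
qed

lemma Ck_on_SucI:
  assumes "\<And>x. (f has_derivative f' x) (at x)" and "\<And>v. Ck_on k UNIV (\<lambda>x. f' x v)"
  shows "Ck_on (Suc k) UNIV f"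
proof -
  have "frechet_derivative f (at x) = f' x" for x
    using frechet_derivative_at[OF assms(1)] by simp
  then show ?thesis using assms by (auto simp: differentiable_def)
qed

lemma Ck_on_SucD:
  assumes "Ck_on (Suc k) UNIV f"
  shows "(f has_derivative frechet_derivative f (at x)) (at x)"
    and "Ck_on k UNIV (\<lambda>x. frechet_derivative f (at x) v)"
  using assms by (auto simp: frechet_derivative_works)

lemma Ck_on_const: "Ck_on k UNIV (\<lambda>x. c)"
proof (induction k arbitrary: c)
  case (Suc k)
  show ?case by (rule Ck_on_SucI[of _ "\<lambda>x v. 0"]) (auto intro: Suc simp del: Ck_on.simps)
qed auto

lemma Ck_on_add:
  assumes "Ck_on k UNIV f" "Ck_on k UNIV g"
  shows "Ck_on k UNIV (\<lambda>x. f x + g x)"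
  using assms
proof (induction k arbitrary: f g)
  case (Suc k)
  show ?case
    by (rule Ck_on_SucI[of _ "\<lambda>x v. frechet_derivative f (at x) v + frechet_derivative g (at x) v"])
      (auto intro!: has_derivative_add Suc.IH Ck_on_SucD(1)[OF Suc.prems(1)] Ck_on_SucD(1)[OF Suc.prems(2)]
        Ck_on_SucD(2)[OF Suc.prems(1)] Ck_on_SucD(2)[OF Suc.prems(2)] simp del: Ck_on.simps)
qed (auto intro: continuous_intros)

lemma Ck_on_sum:
  assumes "\<And>i. i \<in> I \<Longrightarrow> Ck_on k UNIV (f i)"
  shows "Ck_on k UNIV (\<lambda>x. \<Sum>i\<in>I. f i x)"
  using assms by (induction I rule: infinite_finite_induct) (auto intro: Ck_on_const Ck_on_add)

lemma Ck_on_mult: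
  fixes f g :: "'a::real_normed_vector \<Rightarrow> real"
  assumes "Ck_on k UNIV f" "Ck_on k UNIV g"
  shows "Ck_on k UNIV (\<lambda>x. f x * g x)"
  using assms
proof (induction k arbitrary: f g)
  case (Suc k)
  show ?case
    by (rule Ck_on_SucI[of _ "\<lambda>x v. f x * frechet_derivative g (at x) v + frechet_derivative f (at x) v * g x"])
      (auto intro!: has_derivative_mult Ck_on_add Suc.IH Ck_on_SucD(1)[OF Suc.prems(1)]
         Ck_on_SucD(1)[OF Suc.prems(2)]
         Ck_on_SucD(2)[OF Suc.prems(1)] Ck_on_SucD(2)[OF Suc.prems(2)]
         Ck_on_Suc_imp[OF Suc.prems(1)] Ck_on_Suc_imp[OF Suc.prems(2)] simp del: Ck_on.simps)
qed (auto intro: continuous_intros)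

lemma Ck_on_bounded_linear:
  assumes "bounded_linear f"
  shows "Ck_on k UNIV f"
proof (cases k)
  case 0
  then show ?thesis using assms by (simp add: linear_continuous_on)
next
  case (Suc j)
  show ?thesis unfolding Suc
    by (rule Ck_on_SucI[of _ "\<lambda>x. f"]) (auto intro: bounded_linear_imp_has_derivative assms Ck_on_const simp del: Ck_on.simps)
qed

lemma Ck_on_compose:
  fixes f :: "'b::euclidean_space \<Rightarrow> real" and g :: "'a::real_normed_vector \<Rightarrow> 'b"
  assumes "Ck_on k UNIV f" "\<And>b. b \<in> Basis \<Longrightarrow> Ck_on k UNIV (\<lambda>x. g x \<bullet> b)"
  shows "Ck_on k UNIV (\<lambda>x. f (g x))"
  using assms
proof (induction k arbitrary: f)
  case 0
  then have "continuous_on UNIV g" by (subst continuous_on_componentwise) auto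
  with 0 show ?case using continuous_on_compose2[of UNIV f UNIV g] by auto
next
  case (Suc k)
  let ?f' = "\<lambda>x. frechet_derivative f (at x)"
  define g' where "g' x v = (\<Sum>b\<in>Basis. frechet_derivative (\<lambda>x. g x \<bullet> b) (at x) v *\<^sub>R b)" for x v
  have g': "(g has_derivative g' x) (at x)" for x
    by (subst has_derivative_componentwise_within)
      (use Ck_on_SucD(1)[OF Suc.prems(2)] in \<open>auto simp: g'_def inner_sum_left inner_Basis if_distrib cong: if_cong\<close>)
  have fd: "(f has_derivative ?f' x) (at x)" for x using Ck_on_SucD(1)[OF Suc.prems(1)] .
  have lin: "linear (?f' x)" for x
    using fd has_derivative_linear by blast
  have eq: "?f' (g x) (g' x v) = (\<Sum>b\<in>Basis. frechet_derivative (\<lambda>x. g x \<bullet> b) (at x) v * ?f' (g x) b)" for x v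
    unfolding g'_def by (simp add: linear_sum[OF lin] linear_scale[OF lin])
  show ?case
  proof (rule Ck_on_SucI[of _ "\<lambda>x v. ?f' (g x) (g' x v)"])
    show "((\<lambda>x. f (g x)) has_derivative (\<lambda>v. ?f' (g x) (g' x v))) (at x)" for x
      using has_derivative_compose[OF g' fd] .
    show "Ck_on k UNIV (\<lambda>x. ?f' (g x) (g' x v))" for v
      unfolding eq
      using Ck_on_SucD(2)[OF Suc.prems(2)] Suc.IH[OF Ck_on_SucD(2)[OF Suc.prems(1)]]
        Ck_on_Suc_imp[OF Suc.prems(2)]
      by (auto intro!: Ck_on_sum Ck_on_mult simp del: Ck_on.simps)
  qed
qed

text \<open>The calculus above is developed on \<open>UNIV\<close> only. This is the passage to open
  sets: the final function on the ball is glued from functions that are smooth on the whole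
  space.\<close>

lemma Ck_on_local:
  assumes "open S"
    and "\<And>x. x \<in> S \<Longrightarrow> \<exists>T g. open T \<and> x \<in> T \<and> Ck_on k UNIV g \<and> (\<forall>y\<in>T. f y = g y)"
  shows "Ck_on k S f"
  using assms(2)
proof (induction k arbitrary: f)
  case 0
  have "isCont f x" if x: "x \<in> S" for x
  proof -
    obtain T g where T: "open T" "x \<in> T" "Ck_on 0 UNIV g" "\<forall>y\<in>T. f y = g y" using 0[OF x] by blast
    then have "isCont g x" by (simp add: continuous_on_eq_continuous_at)
    moreover have "eventually (\<lambda>y. f y = g y) (nhds x)"
      using T eventually_nhds by blast
    ultimately show ?thesis using isCont_cong by blast
  qed
  then show ?case by (simp add: continuous_at_imp_continuous_on)
next
  case (Suc k)
  have *: "\<exists>T g. open T \<and> x \<in> T \<and> Ck_on (Suc k) UNIV g \<and> (\<forall>y\<in>T. f y = g y) \<and>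
     (\<forall>y\<in>T. (f has_derivative frechet_derivative g (at y)) (at y))" if x: "x \<in> S" for x
  proof -
    obtain T g where T: "open T" "x \<in> T" "Ck_on (Suc k) UNIV g" "\<forall>y\<in>T. f y = g y" using Suc.prems[OF x] by blast
    have "(f has_derivative frechet_derivative g (at y)) (at y)" if "y \<in> T" for y
      by (rule has_derivative_transform_within_open[OF Ck_on_SucD(1)[OF T(3)] T(1) that]) (use T in auto)
    with T show ?thesis by blast
  qed
  show ?case
    unfolding Ck_on.simps
  proof safe
    fix x assume "x \<in> S"
    then show "f differentiable (at x)" using *[of x] unfolding differentiable_def by blast
  next
    fix v
    show "Ck_on k S (\<lambda>x. frechet_derivative f (at x) v)"
    proof (rule Suc.IH)
      fix x assume "x \<in> S"
      from *[OF this] obtain T g where T: "open T" "x \<in> T" "Ck_on (Suc k) UNIV g"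
        "\<forall>y\<in>T. (f has_derivative frechet_derivative g (at y)) (at y)" by blast
      have "\<forall>y\<in>T. frechet_derivative f (at y) v = frechet_derivative g (at y) v"
        using T(4) frechet_derivative_at by metis
      then show "\<exists>T g. open T \<and> x \<in> T \<and> Ck_on k UNIV g \<and> (\<forall>y\<in>T. frechet_derivative f (at y) v = g y)"
        using T Ck_on_SucD(2)[OF T(3)] by blast
    qed
  qed
qed

abbreviation smooth :: "('a::real_normed_vector \<Rightarrow> 'b::real_normed_vector) \<Rightarrow> bool" where
  "smooth \<equiv> smooth_on UNIV"

definition dird :: "'a::real_normed_vector \<Rightarrow> ('a \<Rightarrow> 'b::real_normed_vector) \<Rightarrow> 'a \<Rightarrow> 'b" where
  "dird v f x = frechet_derivative f (at x) v"

lemma smooth_Ck: "smooth f \<Longrightarrow> Ck_on k UNIV f"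
  by (simp add: smooth_on_def)

lemma smooth_has_derivative: "smooth f \<Longrightarrow> (f has_derivative (\<lambda>v. dird v f x)) (at x)"
  unfolding dird_def using Ck_on_SucD(1)[OF smooth_Ck[of f "Suc 0"]] by simp

lemma smooth_dird: "smooth f \<Longrightarrow> smooth (dird v f)"
  unfolding smooth_on_def using Ck_on_SucD(2)[of _ f v] by (simp add: dird_def[abs_def] del: Ck_on.simps)

lemma smooth_continuous_on: "smooth f \<Longrightarrow> continuous_on S f"
  using smooth_Ck[of f 0] continuous_on_subset by auto

lemma smooth_borel: "smooth f \<Longrightarrow> f \<in> borel_measurable borel"
  by (simp add: borel_measurable_continuous_onI smooth_continuous_on)

lemma dird_eqI: "(f has_derivative f') (at x) \<Longrightarrow> dird v f x = f' v"
  unfolding dird_def using frechet_derivative_at by metis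

lemma dird_linear: "smooth f \<Longrightarrow> linear (\<lambda>v. dird v f x)"
  using smooth_has_derivative has_derivative_linear by blast

lemma dird_expand:
  fixes f :: "'a::euclidean_space \<Rightarrow> real"
  assumes "smooth f"
  shows "dird v f x = (\<Sum>b\<in>Basis. (v \<bullet> b) * dird b f x)"
proof -
  have "dird v f x = dird (\<Sum>b\<in>Basis. (v \<bullet> b) *\<^sub>R b) f x" by (simp add: euclidean_representation)
  also have "\<dots> = (\<Sum>b\<in>Basis. (v \<bullet> b) * dird b f x)"
    by (simp add: linear_sum[OF dird_linear[OF assms]] linear_scale[OF dird_linear[OF assms]])
  finally show ?thesis .
qed

text \<open>A coinduction principle: closure of \<open>P\<close> under directional derivatives
  carries the induction on the order. For parameter integrals, \<open>P\<close> is the class of all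
  integrals with some smooth kernel.\<close>

lemma smoothI:
  assumes "P f" and "\<And>f. P f \<Longrightarrow> \<exists>f'. (\<forall>x. (f has_derivative f' x) (at x)) \<and> (\<forall>v. P (\<lambda>x. f' x v))"
  shows "smooth f"
proof -
  have "P f \<Longrightarrow> Ck_on k UNIV f" for k
  proof (induction k arbitrary: f)
    case 0
    then obtain f' where "\<forall>x. (f has_derivative f' x) (at x)" using assms(2) by blast
    then show ?case by (auto intro!: continuous_at_imp_continuous_on has_derivative_continuous)
  next
    case (Suc k)
    then obtain f' where "\<forall>x. (f has_derivative f' x) (at x)" "\<forall>v. P (\<lambda>x. f' x v)" using assms(2) by blast
    then show ?case using Suc.IH by (intro Ck_on_SucI[of f f']) (auto simp del: Ck_on.simps)
  qed
  then show ?thesis using assms(1) by (simp add: smooth_on_def)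
qed

lemma smooth_const [intro, simp]: "smooth (\<lambda>x. c)"
  by (simp add: smooth_on_def Ck_on_const)
lemma smooth_add [intro]: "smooth f \<Longrightarrow> smooth g \<Longrightarrow> smooth (\<lambda>x. f x + g x)"
  by (simp add: smooth_on_def Ck_on_add)
lemma smooth_sum [intro]: "(\<And>i. i \<in> I \<Longrightarrow> smooth (f i)) \<Longrightarrow> smooth (\<lambda>x. \<Sum>i\<in>I. f i x)"
  by (simp add: smooth_on_def Ck_on_sum)
lemma smooth_mult [intro]:
  fixes f g :: "'a::real_normed_vector \<Rightarrow> real"
  shows "smooth f \<Longrightarrow> smooth g \<Longrightarrow> smooth (\<lambda>x. f x * g x)"
  by (simp add: smooth_on_def Ck_on_mult)
lemma smooth_minus [intro]:
  fixes f :: "'a::real_normed_vector \<Rightarrow> real"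
  shows "smooth f \<Longrightarrow> smooth (\<lambda>x. - f x)"
  using smooth_mult[of "\<lambda>_. -1" f] by simp
lemma smooth_diff [intro]:
  fixes f g :: "'a::real_normed_vector \<Rightarrow> real"
  shows "smooth f \<Longrightarrow> smooth g \<Longrightarrow> smooth (\<lambda>x. f x - g x)"
  using smooth_add[of f "\<lambda>x. - g x"] smooth_minus by auto
lemma smooth_power [intro]:
  fixes f :: "'a::real_normed_vector \<Rightarrow> real"
  shows "smooth f \<Longrightarrow> smooth (\<lambda>x. f x ^ n)"
  by (induction n) auto
lemma smooth_bounded_linear: "bounded_linear f \<Longrightarrow> smooth f"
  by (simp add: smooth_on_def Ck_on_bounded_linear)
lemma smooth_compose:
  fixes f :: "'b::euclidean_space \<Rightarrow> real"
  shows "smooth f \<Longrightarrow> (\<And>b. b \<in> Basis \<Longrightarrow> smooth (\<lambda>x. g x \<bullet> b)) \<Longrightarrow> smooth (\<lambda>x. f (g x))"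
  by (simp add: smooth_on_def Ck_on_compose)
lemma smooth_compose_real:
  fixes f :: "real \<Rightarrow> real"
  shows "smooth f \<Longrightarrow> smooth g \<Longrightarrow> smooth (\<lambda>x. f (g x))"
  by (rule smooth_compose) auto
lemma smooth_inner_linear:
  fixes f g :: "'a::real_normed_vector \<Rightarrow> 'b::euclidean_space"
  assumes "bounded_linear f" "bounded_linear g"
  shows "smooth (\<lambda>x. f x \<bullet> g x)"
  unfolding euclidean_inner[of "f _" "g _"]
  by (intro smooth_sum smooth_mult smooth_bounded_linear bounded_linear_compose[OF bounded_linear_inner_left]
      assms[THEN bounded_linear_compose[OF bounded_linear_inner_left]])

lemma smooth_slice1:
  fixes k :: "'a::euclidean_space \<times> 'b::euclidean_space \<Rightarrow> real"
  assumes "smooth k" shows "smooth (\<lambda>x. k (x, z))"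
proof (rule smooth_compose[OF assms])
  fix b :: "'a \<times> 'b" 
  have "smooth (\<lambda>x. x \<bullet> fst b + z \<bullet> snd b)"
    by (intro smooth_add smooth_const smooth_bounded_linear bounded_linear_inner_left)
  then show "smooth (\<lambda>x. (x, z) \<bullet> b)" by (simp add: inner_prod_def)
qed

lemma smooth_slice2:
  fixes k :: "'a::euclidean_space \<times> 'b::euclidean_space \<Rightarrow> real"
  assumes "smooth k" shows "smooth (\<lambda>z. k (x, z))"
proof (rule smooth_compose[OF assms])
  fix b :: "'a \<times> 'b" 
  have "smooth (\<lambda>z. x \<bullet> fst b + z \<bullet> snd b)"
    by (intro smooth_add smooth_const smooth_bounded_linear bounded_linear_inner_left)
  then show "smooth (\<lambda>z. (x, z) \<bullet> b)" by (simp add: inner_prod_def)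
qed

lemma has_derivative_slice1:
  fixes k :: "'a::euclidean_space \<times> 'b::euclidean_space \<Rightarrow> real"
  assumes "smooth k"
  shows "((\<lambda>x. k (x, z)) has_derivative (\<lambda>v. dird (v, 0) k (x, z))) (at x)"
proof -
  have "((\<lambda>x. (x, z)) has_derivative (\<lambda>v. (v, 0))) (at x)"
    by (auto intro!: derivative_eq_intros)
  from has_derivative_compose[OF this smooth_has_derivative[OF assms]] show ?thesis .
qed

lemma dird_slice1:
  fixes k :: "'a::euclidean_space \<times> 'b::euclidean_space \<Rightarrow> real"
  assumes "smooth k"
  shows "dird v (\<lambda>x. k (x, z)) x = dird (v, 0) k (x, z)"
  using dird_eqI[OF has_derivative_slice1[OF assms]] .

section \<open>Integrals depending on a parameter\<close>

lemma integrable_mult_continuous: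
  fixes k :: "'b::euclidean_space \<Rightarrow> real"
  assumes g: "integrable M g" and Z: "Z \<in> borel_measurable M" and S: "compact S"
    and supp: "\<And>w. w \<in> space M \<Longrightarrow> g w \<noteq> 0 \<Longrightarrow> Z w \<in> S" and k: "continuous_on UNIV k"
  shows "integrable M (\<lambda>w. g w * k (Z w))"
proof -
  have "compact (k ` S)" using compact_continuous_image[OF continuous_on_subset[OF k] S] by auto
  then obtain B where B: "\<And>z. z \<in> S \<Longrightarrow> \<bar>k z\<bar> \<le> B"
    using compact_imp_bounded bounded_real by (metis imageI)
  show ?thesis
  proof (rule Bochner_Integration.integrable_bound[of _ "\<lambda>w. B * g w"])
    show "(\<lambda>w. g w * k (Z w)) \<in> borel_measurable M"
      using g Z borel_measurable_continuous_onI[OF k] by measurable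
    show "AE w in M. norm (g w * k (Z w)) \<le> norm (B * g w)"
    proof (rule AE_I2)
      fix w assume w: "w \<in> space M"
      have "\<bar>k (Z w)\<bar> \<le> \<bar>B\<bar>" if "g w \<noteq> 0" using B[OF supp[OF w that]] by linarith
      then show "norm (g w * k (Z w)) \<le> norm (B * g w)"
        by (cases "g w = 0") (auto simp: abs_mult mult.commute intro: mult_right_mono)
    qed
  qed (use g in auto)
qed

text \<open>Smoothness is asked of \<open>k\<close> in its own arguments, while \<open>Z\<close>
  need only be measurable: the uses include the identity on the ball, \<open>sin\<close>, and
  \<open>\<mu> powr p\<close>, which need not be smooth at 0. Compactness of \<open>S\<close> takes
  the place of a dominating function.\<close>

lemma has_derivative_param_integral:
  fixes k :: "'a::euclidean_space \<times> 'b::euclidean_space \<Rightarrow> real"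
  assumes k: "smooth k" and g: "integrable M g" and Z: "Z \<in> borel_measurable M" and S: "compact S"
    and supp: "\<And>w. w \<in> space M \<Longrightarrow> g w \<noteq> 0 \<Longrightarrow> Z w \<in> S"
  shows "((\<lambda>x. \<integral>w. g w * k (x, Z w) \<partial>M) has_derivative (\<lambda>v. \<integral>w. g w * dird (v, 0) k (x, Z w) \<partial>M)) (at x)"
proof -
  have int: "integrable M (\<lambda>w. g w * h (x, Z w))" if "smooth h" for h :: "'a \<times> 'b \<Rightarrow> real" and x
    by (rule integrable_mult_continuous[OF g Z S, of "\<lambda>z. h (x, z)"])
      (use supp smooth_continuous_on[OF smooth_slice2[OF that]] in auto)
  \<comment> \<open>The directional derivative as a function of point, parameter and direction
    jointly: its uniform continuity on a compact set makes the error estimate uniform in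
    \<open>z\<close> and in all unit directions.\<close>
  let ?Q = "\<lambda>(x, z, v). \<Sum>b\<in>Basis. (v \<bullet> b) * dird (b, 0) k (x, z)"
  have Q: "dird (v, 0) k (x, z) = ?Q (x, z, v)" for x z v
    using dird_expand[OF smooth_slice1[OF k, of z], of v x] unfolding dird_slice1[OF k] by simp
  have "continuous_on UNIV ?Q"
    unfolding split_beta
    by (intro continuous_intros continuous_on_compose2[OF smooth_continuous_on[OF smooth_dird[OF k], of UNIV]]) auto
  then have uc: "uniformly_continuous_on (cball x 1 \<times> S \<times> cball 0 1) ?Q" for x
    by (intro compact_uniformly_continuous compact_Times S compact_cball) (auto intro: continuous_on_subset)
  have lin: "linear (\<lambda>v. \<integral>w. g w * dird (v, 0) k (x, Z w) \<partial>M)"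
  proof (rule linearI)
    have l: "linear (\<lambda>v. dird (v, 0) k (x, z))" for z
      using dird_linear[OF smooth_slice1[OF k]] by (simp add: dird_slice1[OF k])
    show "(\<integral>w. g w * dird (a + b, 0) k (x, Z w) \<partial>M) = (\<integral>w. g w * dird (a, 0) k (x, Z w) \<partial>M) + (\<integral>w. g w * dird (b, 0) k (x, Z w) \<partial>M)" for a b
      using linear_add[OF l] by (simp add: ring_distribs Bochner_Integration.integral_add int smooth_dird k)
    show "(\<integral>w. g w * dird (r *\<^sub>R b, 0) k (x, Z w) \<partial>M) = r *\<^sub>R (\<integral>w. g w * dird (b, 0) k (x, Z w) \<partial>M)" for r b
      using linear_scale[OF l, of r b] by (simp add: mult.left_commute)
  qed
  show ?thesis
    unfolding has_derivative_at_alt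
  proof (intro conjI allI impI)
    show "bounded_linear (\<lambda>v. \<integral>w. g w * dird (v, 0) k (x, Z w) \<partial>M)"
      using lin linear_conv_bounded_linear by blast
    fix e :: real assume "e > 0"
    define I where "I = (\<integral>w. \<bar>g w\<bar> \<partial>M)"
    have "I \<ge> 0" by (simp add: I_def)
    define e' where "e' = e / (I + 1)"
    have e': "e' > 0" "e' * I \<le> e" using \<open>e > 0\<close> \<open>I \<ge> 0\<close> by (auto simp: e'_def field_simps)
    have "\<exists>d>0. \<forall>p\<in>cball x 1 \<times> S \<times> cball 0 1. \<forall>q\<in>cball x 1 \<times> S \<times> cball 0 1. dist q p < d \<longrightarrow> dist (?Q q) (?Q p) < e'"
      using uc[of x] e'(1) unfolding uniformly_continuous_on_def by (elim allE impE)
    then obtain d where d: "d > 0" "\<And>p q. p \<in> cball x 1 \<times> S \<times> cball 0 1 \<Longrightarrow> q \<in> cball x 1 \<times> S \<times> cball 0 1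
        \<Longrightarrow> dist q p < d \<Longrightarrow> dist (?Q q) (?Q p) < e'"
      by (elim exE conjE) (rule that, assumption, drule bspec, assumption, drule bspec, assumption, drule mp)
    have est: "\<bar>k (y, z) - k (x, z) - dird (y - x, 0) k (x, z)\<bar> \<le> e' * norm (y - x)"
      if y: "norm (y - x) < min d 1" and z: "z \<in> S" for y z
    proof -
      define \<phi> where "\<phi> t = k (x + t *\<^sub>R (y - x), z) - t * dird (y - x, 0) k (x, z)" for t :: real
      have "(\<phi> has_derivative (\<lambda>s. dird (s *\<^sub>R (y - x), 0) k (x + t *\<^sub>R (y - x), z) - s * dird (y - x, 0) k (x, z))) (at t)" for t
        unfolding \<phi>_def
        by (intro has_derivative_diff has_derivative_mult_left has_derivative_ident
            has_derivative_compose[OF _ has_derivative_slice1[OF k], where f="\<lambda>t. x + t *\<^sub>R (y - x)"])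
          (auto intro!: derivative_eq_intros)
      then obtain t where t: "t \<in> {0<..<1}" "norm (\<phi> 1 - \<phi> 0) \<le>
          norm (dird ((1 - 0) *\<^sub>R (y - x), 0) k (x + t *\<^sub>R (y - x), z) - (1 - 0) * dird (y - x, 0) k (x, z))"
        using mvt_general[of 0 1 \<phi> "\<lambda>t s. dird (s *\<^sub>R (y - x), 0) k (x + t *\<^sub>R (y - x), z) - s * dird (y - x, 0) k (x, z)"]
        by (force intro!: has_derivative_continuous continuous_at_imp_continuous_on)
      define n where "n = norm (y - x)"
      \<comment> \<open>For \<open>n = 0\<close> this is 0, because \<open>inverse 0 = 0\<close>;
        hence only \<open>norm v \<le> 1\<close> below.\<close>
      define v where "v = (y - x) /\<^sub>R n"
      have yx: "y - x = n *\<^sub>R v" "norm v \<le> 1"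
      proof -
        show "y - x = n *\<^sub>R v"
        proof (cases "n = 0")
          case True
          then show ?thesis unfolding n_def by simp
        qed (simp add: v_def)
        have "norm v = inverse n * n" by (simp add: v_def n_def)
        then show "norm v \<le> 1" by (cases "n = 0") auto
      qed
      have sc: "?Q (p, z, y - x) = n * ?Q (p, z, v)" for p
        by (subst yx) (simp add: sum_distrib_left mult.assoc)
      have tn: "t * n < min d 1" "t * n \<ge> 0"
        using t(1) y mult_left_le_one_le[of n t] by (auto simp: n_def)
      have "dist (?Q (x + t *\<^sub>R (y - x), z, v)) (?Q (x, z, v)) < e'"
        using tn t(1) yx(2) z by (intro d) (auto simp: dist_norm n_def norm_Pair)
      then have "\<bar>?Q (x + t *\<^sub>R (y - x), z, y - x) - ?Q (x, z, y - x)\<bar> \<le> n * e'"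
        unfolding sc right_diff_distrib[symmetric] abs_mult dist_real_def
        by (intro mult_mono) (auto simp: n_def)
      moreover have "\<bar>k (y, z) - k (x, z) - dird (y - x, 0) k (x, z)\<bar>
          \<le> \<bar>dird (y - x, 0) k (x + t *\<^sub>R (y - x), z) - dird (y - x, 0) k (x, z)\<bar>"
        using t(2) by (simp add: \<phi>_def)
      ultimately show ?thesis unfolding Q[of "y - x"] n_def mult.commute[of e'] by (rule order_trans[rotated])
    qed
    show "\<exists>d>0. \<forall>y. norm (y - x) < d \<longrightarrow> norm ((\<integral>w. g w * k (y, Z w) \<partial>M) - (\<integral>w. g w * k (x, Z w) \<partial>M) - (\<integral>w. g w * dird (y - x, 0) k (x, Z w) \<partial>M)) \<le> e * norm (y - x)"
    proof (intro exI[of _ "min d 1"] conjI allI impI)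
      fix y assume y: "norm (y - x) < min d 1"
      have "(\<integral>w. g w * k (y, Z w) \<partial>M) - (\<integral>w. g w * k (x, Z w) \<partial>M) - (\<integral>w. g w * dird (y - x, 0) k (x, Z w) \<partial>M)
        = (\<integral>w. g w * k (y, Z w) - g w * k (x, Z w) - g w * dird (y - x, 0) k (x, Z w) \<partial>M)"
        by (simp add: Bochner_Integration.integral_diff int k smooth_dird)
      also have "norm \<dots> \<le> (\<integral>w. \<bar>g w\<bar> * (e' * norm (y - x)) \<partial>M)"
      proof (rule order_trans[OF integral_norm_bound integral_mono])
        show "integrable M (\<lambda>w. norm (g w * k (y, Z w) - g w * k (x, Z w) - g w * dird (y - x, 0) k (x, Z w)))"
          by (intro integrable_norm Bochner_Integration.integrable_diff int k smooth_dird)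
        show "integrable M (\<lambda>w. \<bar>g w\<bar> * (e' * norm (y - x)))" using g by auto
        fix w assume w: "w \<in> space M"
        have "norm (g w * k (y, Z w) - g w * k (x, Z w) - g w * dird (y - x, 0) k (x, Z w)) =
          \<bar>g w\<bar> * \<bar>k (y, Z w) - k (x, Z w) - dird (y - x, 0) k (x, Z w)\<bar>"
          by (simp add: abs_mult[symmetric] algebra_simps)
        also have "\<dots> \<le> \<bar>g w\<bar> * (e' * norm (y - x))"
          using est[OF y supp[OF w]] by (cases "g w = 0") (auto intro: mult_left_mono)
        finally show "norm (g w * k (y, Z w) - g w * k (x, Z w) - g w * dird (y - x, 0) k (x, Z w)) \<le> \<bar>g w\<bar> * (e' * norm (y - x))" .
      qed
      also have "\<dots> = (e' * I) * norm (y - x)" by (simp add: I_def)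
      also have "\<dots> \<le> e * norm (y - x)" using e' by (intro mult_right_mono) auto
      finally show "norm ((\<integral>w. g w * k (y, Z w) \<partial>M) - (\<integral>w. g w * k (x, Z w) \<partial>M) - (\<integral>w. g w * dird (y - x, 0) k (x, Z w) \<partial>M)) \<le> e * norm (y - x)" .
    qed (use d in auto)
  qed
qed

lemma smooth_param_integral:
  fixes k :: "'a::euclidean_space \<times> 'b::euclidean_space \<Rightarrow> real"
  assumes k: "smooth k" and g: "integrable M g" and Z: "Z \<in> borel_measurable M" and S: "compact S"
    and supp: "\<And>w. w \<in> space M \<Longrightarrow> g w \<noteq> 0 \<Longrightarrow> Z w \<in> S"
  shows "smooth (\<lambda>x. \<integral>w. g w * k (x, Z w) \<partial>M)"
proof (rule smoothI[where P="\<lambda>f. \<exists>k. smooth k \<and> f = (\<lambda>x. \<integral>w. g w * k (x, Z w) \<partial>M)"])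
  fix f :: "'a \<Rightarrow> real" assume "\<exists>k. smooth k \<and> f = (\<lambda>x. \<integral>w. g w * k (x, Z w) \<partial>M)"
  then obtain k where k: "smooth k" and f: "f = (\<lambda>x. \<integral>w. g w * k (x, Z w) \<partial>M)" by blast
  show "\<exists>f'. (\<forall>x. (f has_derivative f' x) (at x)) \<and>
     (\<forall>v. \<exists>k. smooth k \<and> (\<lambda>x. f' x v) = (\<lambda>x. \<integral>w. g w * k (x, Z w) \<partial>M))"
    using has_derivative_param_integral[OF k g Z S supp] smooth_dird[OF k]
    by (intro exI[of _ "\<lambda>x v. \<integral>w. g w * dird (v, 0) k (x, Z w) \<partial>M"]) (auto simp: f)
qed (use k in blast)

lemma dird_param_integral:
  fixes k :: "'a::euclidean_space \<times> 'b::euclidean_space \<Rightarrow> real"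
  assumes k: "smooth k" and g: "integrable M g" and Z: "Z \<in> borel_measurable M" and S: "compact S"
    and supp: "\<And>w. w \<in> space M \<Longrightarrow> g w \<noteq> 0 \<Longrightarrow> Z w \<in> S"
  shows "dird v (\<lambda>x. \<integral>w. g w * k (x, Z w) \<partial>M) x = (\<integral>w. g w * dird (v, 0) k (x, Z w) \<partial>M)"
  using dird_eqI[OF has_derivative_param_integral[OF assms]] .

section \<open>Smooth profiles on the real line\<close>

lemma smooth_DERIV:
  fixes F :: "real \<Rightarrow> real"
  assumes "smooth F" shows "(F has_real_derivative deriv F x) (at x)"
  using smooth_has_derivative[OF assms, of x] DERIV_deriv_iff_real_differentiable
  by (auto simp: differentiable_def)

lemma dird_real:
  fixes F :: "real \<Rightarrow> real"
  assumes "smooth F" shows "dird v F x = v * deriv F x"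
  using dird_eqI[OF smooth_DERIV[OF assms, unfolded has_field_derivative_def]] by (simp add: mult.commute)

lemma smooth_deriv:
  fixes F :: "real \<Rightarrow> real"
  assumes "smooth F" shows "smooth (deriv F)"
proof -
  have "deriv F = dird 1 F" using dird_real[OF assms, of 1] by auto
  then show ?thesis using smooth_dird[OF assms] by simp
qed

lemma smooth_realI:
  fixes F :: "real \<Rightarrow> real"
  assumes "\<And>x. (F has_real_derivative G x) (at x)" "smooth G" shows "smooth F"
proof -
  have "Ck_on (Suc k) UNIV F" for k
    using assms smooth_Ck[OF assms(2), of k]
    by (intro Ck_on_SucI[of F "\<lambda>x v. G x * v"])
      (auto simp: has_field_derivative_def simp del: Ck_on.simps intro!: Ck_on_mult Ck_on_const)
  then show ?thesis unfolding smooth_on_def using Ck_on_Suc_imp by blast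
qed

text \<open>Profiles are composed with squared distances, so nothing is asked for large negative
  arguments. Smoothness across \<open>t = 0\<close> makes
  \<open>F ((norm (z - \<xi>))\<^sup>2)\<close> smooth also at \<open>z = \<xi>\<close>.\<close>

definition profile :: "real \<Rightarrow> (real \<Rightarrow> real) \<Rightarrow> bool" where
  "profile c F \<longleftrightarrow> smooth F \<and> (\<forall>t\<ge>c. F t = 0)"

lemma profile_smooth: "profile c F \<Longrightarrow> smooth F" by (simp add: profile_def)
lemma profile_zero: "profile c F \<Longrightarrow> t \<ge> c \<Longrightarrow> F t = 0" by (simp add: profile_def)
lemma profile_mult: "smooth H \<Longrightarrow> profile c F \<Longrightarrow> profile c (\<lambda>t. H t * F t)"
  by (auto simp: profile_def)
lemma profile_diff: "profile c F \<Longrightarrow> profile c G \<Longrightarrow> profile c (\<lambda>t. F t - G t)"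
  by (auto simp: profile_def)
lemma profile_mono: "profile c F \<Longrightarrow> c \<le> c' \<Longrightarrow> profile c' F"
  by (auto simp: profile_def)

lemma profile_deriv:
  assumes "profile c F" shows "profile c (deriv F)"
proof -
  note F = profile_smooth[OF assms]
  have "deriv F t = 0" if "t \<in> {c<..}" for t
  proof -
    have "(F has_real_derivative 0) (at t)"
      by (rule has_field_derivative_transform_within_open[of "\<lambda>_. 0" _ _ "{c<..}"])
        (use that profile_zero[OF assms] in auto)
    then show ?thesis by (rule DERIV_imp_deriv)
  qed
  then have "deriv F t = 0" if "t \<ge> c" for t
    using continuous_constant_on_closure[of "{c<..}" "deriv F" 0 t] that smooth_continuous_on[OF smooth_deriv[OF F]]
    by auto
  then show ?thesis using smooth_deriv[OF F] by (simp add: profile_def)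
qed

lemma profile_antideriv:
  assumes "profile c G" shows "\<exists>F. profile c F \<and> deriv F = G"
proof -
  have "isCont G x" for x
    using smooth_continuous_on[OF profile_smooth[OF assms], of UNIV] by (simp add: continuous_on_eq_continuous_at)
  then obtain F0 where F0: "\<And>x. (F0 has_real_derivative G x) (at x)"
    using einterval_antiderivative[of "-\<infinity>" "\<infinity>" G] by (auto simp: has_real_derivative_iff_has_vector_derivative)
  define F where "F t = F0 t - F0 c" for t
  have F: "(F has_real_derivative G x) (at x)" for x
    unfolding F_def using F0 by (auto intro!: derivative_eq_intros)
  have "F t = 0" if "t \<ge> c" for t
  proof (cases "t = c")
    case False
    then have "c < t" using that by simp
    from MVT2[OF this F] obtain z where "z > c" "F t - F c = (t - c) * G z" by blast
    then show ?thesis using profile_zero[OF assms, of z] by (simp add: F_def)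
  qed (simp add: F_def)
  moreover have "deriv F = G" using F DERIV_imp_deriv by blast
  ultimately show ?thesis using smooth_realI[OF F profile_smooth[OF assms]] by (auto simp: profile_def)
qed

text \<open>The factor \<open>x ^ k\<close> closes the family under differentiation, so the
  smoothness of \<open>exp (- 1 / x)\<close> at 0 follows from one induction over the whole
  family.\<close>

definition flat :: "nat \<Rightarrow> real \<Rightarrow> real" where
  "flat k x = (if x > 0 then exp (- 1 / x) / x ^ k else 0)"

text \<open>A single term of the exponential series at \<open>1 / x\<close> already beats the power.
  The bound serves at 0, where the difference quotient of \<open>flat k\<close> is
  \<open>flat (Suc k)\<close>.\<close>

lemma flat_bound: "\<bar>flat k x\<bar> \<le> fact (Suc k) * \<bar>x\<bar>"
proof (cases "x > 0")
  case True
  have "(1 / x) ^ Suc k / fact (Suc k) \<le> exp (1 / x)"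
    using sum_le_suminf[OF summable_exp_generic[of "1/x"], of "{Suc k}"] True
    by (simp add: exp_def divide_inverse mult.commute)
  then have "(1 / x) ^ Suc k \<le> exp (1 / x) * fact (Suc k)" by (subst (asm) pos_divide_le_eq) auto
  then have "exp (- (1/x)) \<le> fact (Suc k) * x ^ Suc k"
    using True by (simp add: exp_minus field_simps)
  then show ?thesis using True by (simp add: flat_def field_simps)
next
  case False
  then have "flat k x = 0" by (simp add: flat_def)
  then show ?thesis by (metis abs_ge_zero abs_zero fact_ge_zero mult_nonneg_nonneg)
qed

lemma flat_DERIV: "(flat k has_real_derivative flat (k + 2) x - real k * flat (Suc k) x) (at x)"
proof -
  consider "x > 0" | "x < 0" | "x = 0" by linarith
  then show ?thesis
  proof cases
    case 1
    have "((\<lambda>x. exp (- 1 / x) / x ^ k) has_real_derivative flat (k + 2) x - real k * flat (Suc k) x) (at x)"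
      using 1 by (auto intro!: derivative_eq_intros simp: flat_def field_simps power2_eq_square)
        (cases k; simp add: field_simps power2_eq_square)
    then show ?thesis
      by (rule has_field_derivative_transform_within_open[of _ _ _ "{0<..}"]) (use 1 in \<open>auto simp: flat_def\<close>)
  next
    case 2
    have "((\<lambda>x. 0) has_real_derivative flat (k + 2) x - real k * flat (Suc k) x) (at x)"
      using 2 by (simp add: flat_def)
    then show ?thesis
      by (rule has_field_derivative_transform_within_open[of _ _ _ "{..<0}"]) (use 2 in \<open>auto simp: flat_def\<close>)
  next
    case 3
    have "((\<lambda>h. flat (Suc k) h) \<longlongrightarrow> 0) (at 0)"
    proof (rule Lim_null_comparison)
      show "eventually (\<lambda>h. norm (flat (Suc k) h) \<le> fact (Suc (Suc k)) * \<bar>h\<bar>) (at 0)"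
        unfolding real_norm_def by (intro always_eventually allI flat_bound)
      show "((\<lambda>h. fact (Suc (Suc k)) * \<bar>h\<bar> :: real) \<longlongrightarrow> 0) (at 0)"
        by (auto intro!: tendsto_eq_intros)
    qed
    moreover have "(flat k (0 + h) - flat k 0) / h = flat (Suc k) h" for h by (simp add: flat_def)
    ultimately show ?thesis using 3 by (simp add: DERIV_def flat_def)
  qed
qed

lemma smooth_flat: "smooth (flat k)"
proof -
  have "Ck_on j UNIV (flat k)" for j k
  proof (induction j arbitrary: k)
    case 0
    show ?case using DERIV_isCont[OF flat_DERIV] by (auto intro!: continuous_at_imp_continuous_on)
  next
    case (Suc j)
    have eq: "(flat (k + 2) x - real k * flat (Suc k) x) * v = v * flat (k + 2) x + (- real k * v) * flat (Suc k) x" for x v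
      by (simp add: algebra_simps)
    show ?case
      by (rule Ck_on_SucI[OF flat_DERIV[unfolded has_field_derivative_def]])
        (auto simp only: eq intro!: Ck_on_add Ck_on_mult Ck_on_const Suc)
  qed
  then show ?thesis by (simp add: smooth_on_def)
qed

lemma profile_bump: "\<exists>F. profile c F \<and> (\<forall>t. F t \<ge> 0) \<and> (\<forall>t<c. F t > 0)"
proof (intro exI[of _ "\<lambda>t. flat 0 (c - t)"] conjI)
  have "smooth (\<lambda>t::real. c - t)" using smooth_bounded_linear[OF bounded_linear_ident] by auto
  then show "profile c (\<lambda>t. flat 0 (c - t))"
    using smooth_compose_real[OF smooth_flat[of 0], of "\<lambda>t. c - t"] by (simp add: profile_def) (simp add: flat_def)
qed (auto simp: flat_def)

section \<open>The Euler equation for profiles\<close>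

lemma smooth_mult_fst_snd: "smooth (\<lambda>e::real\<times>real. fst e * snd e)"
  by (intro smooth_mult smooth_bounded_linear bounded_linear_fst bounded_linear_snd)

text \<open>The solution is \<open>S t = t powr (- D/2) * \<integral>\<^sub>0\<^sup>t G s * s powr (D/2 - 1) ds\<close>, rescaled to the unit interval
  so that it is visibly smooth at \<open>t = 0\<close>.\<close>

lemma euler_equation_profile:
  assumes D: "D > 0" and c: "c > 0" and G: "profile c G"
    and mean: "(\<integral>\<mu>. indicator {0..1} \<mu> * G (c * \<mu> powr (2/D)) \<partial>lborel) = 0"
  shows "\<exists>S. profile c S \<and> (\<forall>t. t * deriv S t + D / 2 * S t = G t)"
proof -
  \<comment> \<open>The substitution \<open>s = t * \<mu> powr p\<close> turns
    \<open>s powr (D/2 - 1) ds\<close> into \<open>p * t powr (D/2) d\<mu>\<close>, so that the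
    solution is \<open>p * I\<close>.\<close>
  define p where "p = 2 / D"
  have p: "p > 0" using D by (simp add: p_def)
  note Gs = profile_smooth[OF G]
  define I where "I t = (\<integral>\<mu>. indicator {0..1} \<mu> * G (t * \<mu> powr p) \<partial>lborel)" for t
  have k: "smooth (\<lambda>e::real\<times>real. G (fst e * snd e))"
    by (rule smooth_compose_real[OF Gs smooth_mult_fst_snd])
  have g: "integrable lborel (indicator {0..1::real} :: real \<Rightarrow> real)" by simp
  have Z: "(\<lambda>\<mu>::real. \<mu> powr p) \<in> borel_measurable lborel" by measurable
  have Zs: "\<mu> powr p \<in> {0..1}" if "indicator {0..1} \<mu> \<noteq> (0::real)" for \<mu>
    using that p by (auto simp: indicator_def powr_le1 split: if_splits)
  have "smooth I"
    using smooth_param_integral[OF k g Z compact_Icc[of 0 1]] Zs by (simp add: I_def[abs_def])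
  have dk: "dird (1, 0) (\<lambda>e::real\<times>real. G (fst e * snd e)) (t, z) = z * deriv G (t * z)" for t z
  proof -
    have "((\<lambda>e::real\<times>real. fst e * snd e) has_derivative (\<lambda>v. t * snd v + fst v * z)) (at (t, z))"
      by (auto intro!: derivative_eq_intros)
    from dird_eqI[OF has_derivative_compose[OF this smooth_DERIV[OF Gs, unfolded has_field_derivative_def]]]
    show ?thesis by (simp add: mult.commute)
  qed
  have dI: "deriv I t = (\<integral>\<mu>. indicator {0..1} \<mu> * (\<mu> powr p * deriv G (t * \<mu> powr p)) \<partial>lborel)" for t
    using dird_param_integral[OF k g Z compact_Icc[of 0 1], of 1 t] Zs dird_real[OF \<open>smooth I\<close>, of 1 t]
    by (simp add: I_def[abs_def] dk)
  have eq: "p * t * deriv I t + I t = G t" for t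
  proof -
    \<comment> \<open>The derivative of \<open>H\<close> in \<open>\<mu>\<close> is
      \<open>p * t * h2 \<mu> + h1 \<mu>\<close>; integrated over the unit interval it gives the
      differential equation for \<open>I\<close>.\<close>
    define H where "H \<mu> = \<mu> * G (t * \<mu> powr p)" for \<mu>
    define h1 where "h1 \<mu> = G (t * \<mu> powr p)" for \<mu>
    define h2 where "h2 \<mu> = \<mu> powr p * deriv G (t * \<mu> powr p)" for \<mu>
    have cp: "continuous_on {0..1} (\<lambda>\<mu>. \<mu> powr p)" using p by (intro continuous_on_powr' continuous_intros) auto
    have c1: "continuous_on {0..1} h1" unfolding h1_def
      by (intro continuous_on_compose2[OF smooth_continuous_on[OF Gs, of UNIV]] continuous_intros cp) auto
    have c2: "continuous_on {0..1} h2" unfolding h2_def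
      by (intro continuous_on_compose2[OF smooth_continuous_on[OF smooth_deriv[OF Gs], of UNIV]] continuous_intros cp) auto
    have i1: "I t = integral {0..1} h1" "h1 integrable_on {0..1}"
      using set_borel_integral_eq_integral[OF borel_integrable_atLeastAtMost'[OF c1]]
      by (auto simp: I_def set_lebesgue_integral_def h1_def)
    have i2: "deriv I t = integral {0..1} h2" "h2 integrable_on {0..1}"
      using set_borel_integral_eq_integral[OF borel_integrable_atLeastAtMost'[OF c2]]
      by (auto simp: dI set_lebesgue_integral_def h2_def)
    have "((\<lambda>\<mu>. p * t * h2 \<mu> + h1 \<mu>) has_integral (H 1 - H 0)) {0..1}"
    proof (rule fundamental_theorem_of_calculus_interior)
      show "continuous_on {0..1} H" using c1 unfolding H_def h1_def by (intro continuous_intros) auto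
      fix \<mu> :: real assume \<mu>: "\<mu> \<in> {0<..<1}"
      have "((\<lambda>\<mu>. t * \<mu> powr p) has_real_derivative t * (p * \<mu> powr (p - 1))) (at \<mu>)"
        using \<mu> by (auto intro!: derivative_eq_intros)
      from DERIV_chain2[OF smooth_DERIV[OF Gs] this]
      have "(H has_real_derivative \<mu> * (deriv G (t * \<mu> powr p) * (t * (p * \<mu> powr (p - 1)))) + G (t * \<mu> powr p)) (at \<mu>)"
        unfolding H_def by (auto intro!: derivative_eq_intros)
      moreover have "\<mu> * (\<mu> powr (p - 1)) = \<mu> powr p" using \<mu> by (simp add: powr_diff)
      then have "\<mu> * (deriv G (t * \<mu> powr p) * (t * (p * \<mu> powr (p - 1)))) = p * t * h2 \<mu>"
        by (simp add: h2_def algebra_simps)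
      ultimately show "(H has_vector_derivative p * t * h2 \<mu> + h1 \<mu>) (at \<mu>)"
        by (simp add: has_real_derivative_iff_has_vector_derivative h1_def)
    qed auto
    moreover have "((\<lambda>\<mu>. p * t * h2 \<mu> + h1 \<mu>) has_integral (p * t * deriv I t + I t)) {0..1}"
      unfolding i1(1) i2(1) using i1(2) i2(2) by (intro has_integral_add has_integral_mult_right integrable_integral)
    ultimately have "H 1 - H 0 = p * t * deriv I t + I t" by (rule has_integral_unique)
    then show ?thesis by (simp add: H_def)
  qed
  \<comment> \<open>Beyond \<open>c\<close> the right-hand side \<open>G\<close> vanishes, so
    \<open>t powr (1/p) * I t\<close> is constant there; its value at \<open>c\<close> is 0 by the
    hypothesis \<open>mean\<close>.\<close>
  have zero: "I t = 0" if t: "t \<ge> c" for t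
  proof (cases "t = c")
    case True
    then show ?thesis using mean by (simp add: I_def p_def)
  next
    case False
    define f where "f t = t powr (1/p) * I t" for t
    have "(f has_real_derivative (z powr (1/p) * deriv I z + z powr (1/p - 1) / p * I z)) (at z)" if "c \<le> z" for z
      unfolding f_def using that c by (auto intro!: derivative_eq_intros smooth_DERIV[OF \<open>smooth I\<close>])
    moreover have "c < t" using t False by simp
    ultimately obtain z where z: "z > c" "f t - f c = (t - c) * (z powr (1/p) * deriv I z + z powr (1/p - 1) / p * I z)"
      using MVT2[of c t f "\<lambda>z. z powr (1/p) * deriv I z + z powr (1/p - 1) / p * I z"] by blast
    have "z powr (1/p) = z powr (1/p - 1) * z" using z c by (simp add: powr_diff)
    then have "z powr (1/p) * deriv I z + z powr (1/p - 1) / p * I z = z powr (1/p - 1) / p * (p * z * deriv I z + I z)"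
      using p by (simp add: field_simps)
    also have "\<dots> = 0" using eq[of z] profile_zero[OF G, of z] z by simp
    finally have "f t = f c" using z by simp
    also have "f c = 0" using mean by (simp add: f_def I_def p_def)
    finally show ?thesis using c t by (simp add: f_def)
  qed
  show ?thesis
  proof (intro exI[of _ "\<lambda>t. p * I t"] conjI allI)
    show "profile c (\<lambda>t. p * I t)" using \<open>smooth I\<close> zero by (auto simp: profile_def)
    fix t
    have "((\<lambda>t. p * I t) has_real_derivative p * deriv I t) (at t)"
      using smooth_DERIV[OF \<open>smooth I\<close>] by (auto intro!: derivative_eq_intros)
    then have "deriv (\<lambda>t. p * I t) t = p * deriv I t" by (rule DERIV_imp_deriv)
    then show "t * deriv (\<lambda>t. p * I t) t + D / 2 * (p * I t) = G t"
      using eq[of t] D by (simp add: p_def algebra_simps)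
  qed
qed

section \<open>Averages of profiles and the Euler-Poisson-Darboux equation\<close>

text \<open>With \<open>s = sin t\<close> this is the Gegenbauer weight
  \<open>(1 - s\<^sup>2) powr ((m - 1)/2)\<close> on \<open>[-1, 1]\<close>. Indicator and cosine
  are grouped into one factor because the lemmas on parameter integrals ask for an integrable
  density.\<close>

definition cosint :: "real \<Rightarrow> (real \<Rightarrow> real) \<Rightarrow> real" where
  "cosint m H = (\<integral>t. (indicator {- pi / 2..pi / 2} t * cos t powr m) * H t \<partial>lborel)"

lemma cos_half_pi_nonneg: "t \<in> {- pi / 2..pi / 2} \<Longrightarrow> cos t \<ge> 0"
  using cos_ge_zero by auto

lemma continuous_on_cos_powr: "m > 0 \<Longrightarrow> continuous_on {- pi / 2..pi / 2} (\<lambda>t. cos t powr m)"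
  by (intro continuous_on_powr' continuous_intros) (auto intro: cos_half_pi_nonneg)

lemma integrable_cos_powr: "m > 0 \<Longrightarrow> integrable lborel (\<lambda>t. indicator {- pi / 2..pi / 2} t * cos t powr m)"
  using borel_integrable_atLeastAtMost'[OF continuous_on_cos_powr] by (simp add: set_integrable_def)

lemma cosint_integral:
  assumes "m > 0" "continuous_on UNIV H"
  shows "cosint m H = integral {- pi / 2..pi / 2} (\<lambda>t. cos t powr m * H t)"
    and "(\<lambda>t. cos t powr m * H t) integrable_on {- pi / 2..pi / 2}"
proof -
  have "continuous_on {- pi / 2..pi / 2} (\<lambda>t. cos t powr m * H t)"
    by (intro continuous_intros continuous_on_cos_powr assms(1) continuous_on_subset[OF assms(2)]) auto
  from set_borel_integral_eq_integral[OF borel_integrable_atLeastAtMost'[OF this]]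
  show "cosint m H = integral {- pi / 2..pi / 2} (\<lambda>t. cos t powr m * H t)"
    and "(\<lambda>t. cos t powr m * H t) integrable_on {- pi / 2..pi / 2}"
    by (auto simp: cosint_def set_lebesgue_integral_def mult.assoc)
qed

lemma cosint_linear:
  assumes "m > 0" "continuous_on UNIV H" "continuous_on UNIV H'"
  shows "cosint m (\<lambda>t. a * H t + b * H' t) = a * cosint m H + b * cosint m H'"
proof -
  have "continuous_on UNIV (\<lambda>t. a * H t + b * H' t)" by (intro continuous_intros assms)
  moreover have "((\<lambda>t. a * (cos t powr m * H t) + b * (cos t powr m * H' t)) has_integral (a * cosint m H + b * cosint m H')) {- pi / 2..pi / 2}"
    unfolding cosint_integral(1)[OF assms(1,2)] cosint_integral(1)[OF assms(1,3)]
    by (intro has_integral_add has_integral_mult_right integrable_integral cosint_integral(2) assms)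
  ultimately show ?thesis using cosint_integral(1)[OF assms(1)] by (simp add: algebra_simps integral_unique)
qed

lemma cosint_scale:
  "cosint m (\<lambda>t. a * H t) = a * cosint m H"
  unfolding cosint_def by (subst integral_mult_right_zero[symmetric]) (simp add: mult.left_commute)

text \<open>Integration by parts with \<open>cos t powr (m + 1) * H t\<close>, which vanishes at
  both endpoints.\<close>

lemma cosint_sin_by_parts:
  assumes m: "m > 0" and H: "\<And>t. (H has_real_derivative H' t) (at t)" and H': "continuous_on UNIV H'"
  shows "cosint m (\<lambda>t. sin t * H t) = cosint (m + 1) H' / (m + 1)"
proof -
  have cH: "continuous_on UNIV H" using H DERIV_isCont by (blast intro: continuous_at_imp_continuous_on)
  have csH: "continuous_on UNIV (\<lambda>t. sin t * H t)" by (intro continuous_intros cH)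
  have m1: "m + 1 > 0" using m by simp
  let ?I = "{- pi / 2..pi / 2}"
  define f where "f t = cos t powr (m + 1) * H t" for t
  have "((\<lambda>t. - (m + 1) * (cos t powr m * (sin t * H t)) + cos t powr (m + 1) * H' t) has_integral (f (pi / 2) - f (- pi / 2))) ?I"
  proof (rule fundamental_theorem_of_calculus_interior)
    show "continuous_on ?I f" unfolding f_def
      using m by (intro continuous_intros continuous_on_cos_powr continuous_on_subset[OF cH]) auto
    fix t assume "t \<in> {- pi / 2<..<pi / 2}"
    then have "cos t > 0" using cos_gt_zero_pi by auto
    then have "(f has_real_derivative ((m + 1) * cos t powr m * (- sin t)) * H t + cos t powr (m + 1) * H' t) (at t)"
      unfolding f_def by (auto intro!: derivative_eq_intros H)
    then show "(f has_vector_derivative - (m + 1) * (cos t powr m * (sin t * H t)) + cos t powr (m + 1) * H' t) (at t)"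
      by (simp add: has_real_derivative_iff_has_vector_derivative algebra_simps)
  qed auto
  moreover have "f (pi / 2) - f (- pi / 2) = 0" by (simp add: f_def)
  moreover have "((\<lambda>t. - (m + 1) * (cos t powr m * (sin t * H t)) + cos t powr (m + 1) * H' t) has_integral
      (- (m + 1) * cosint m (\<lambda>t. sin t * H t) + cosint (m + 1) H')) ?I"
    using m cosint_integral[OF m csH] cosint_integral[OF m1 H']
    by (auto intro!: has_integral_add has_integral_mult_right integrable_integral simp del: mult_minus_left)
  ultimately have "- (m + 1) * cosint m (\<lambda>t. sin t * H t) + cosint (m + 1) H' = 0"
    by (metis (no_types, lifting) has_integral_unique)
  then show ?thesis using m by (simp add: field_simps)
qed

lemma cosint_split:
  assumes m: "m > 0" and H: "continuous_on UNIV H"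
  shows "cosint m H = cosint (m + 2) H + cosint m (\<lambda>t. sin t * (sin t * H t))"
proof -
  let ?I = "{- pi / 2..pi / 2}"
  have m2: "m + 2 > 0" using m by simp
  have c: "continuous_on UNIV (\<lambda>t. sin t * (sin t * H t))" by (intro continuous_intros H)
  have "cos t powr m * H t = cos t powr (m + 2) * H t + cos t powr m * (sin t * (sin t * H t))" if "t \<in> ?I" for t
  proof -
    have "cos t powr (m + 2) = cos t powr m * (cos t)\<^sup>2"
      using cos_half_pi_nonneg[OF that] by (cases "cos t = 0") (simp_all add: powr_add)
    moreover have "p * c\<^sup>2 * h + p * (s * (s * h)) = p * h * (s\<^sup>2 + c\<^sup>2)" for p c s h :: real
      by (simp add: algebra_simps power2_eq_square)
    ultimately show ?thesis by simp
  qed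
  moreover have "((\<lambda>t. cos t powr (m + 2) * H t + cos t powr m * (sin t * (sin t * H t))) has_integral
      cosint (m + 2) H + cosint m (\<lambda>t. sin t * (sin t * H t))) ?I"
    using cosint_integral[OF m c] cosint_integral[OF m2 H] by (auto intro!: has_integral_add integrable_integral)
  ultimately have "((\<lambda>t. cos t powr m * H t) has_integral cosint (m + 2) H + cosint m (\<lambda>t. sin t * (sin t * H t))) ?I"
    by (subst has_integral_cong) auto
  then show ?thesis using cosint_integral[OF m H] by (simp add: integral_unique)
qed

lemma cosint_1_pos:
  assumes m: "m > 0" shows "cosint m (\<lambda>t. 1) > 0"
proof -
  let ?f = "\<lambda>t. indicator {- pi / 2..pi / 2} t * cos t powr m"
  have "cosint m (\<lambda>t. 1) = (\<integral>t. ?f t \<partial>lborel)" by (simp add: cosint_def)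
  moreover have "(\<integral>t. ?f t \<partial>lborel) \<ge> 0"
    by (intro integral_nonneg_AE) (auto simp: indicator_def)
  moreover have "(\<integral>t. ?f t \<partial>lborel) \<noteq> 0"
  proof
    assume "(\<integral>t. ?f t \<partial>lborel) = 0"
    then have "AE t in lborel. ?f t = 0"
      by (subst (asm) integral_nonneg_eq_0_iff_AE[OF integrable_cos_powr[OF m]]) (auto simp: indicator_def)
    then have "AE t in lborel. t \<notin> {0<..<pi/2}"
    proof eventually_elim
      case (elim t)
      show ?case using elim cos_gt_zero[of t] by (auto simp: indicator_def)
    qed
    then have "emeasure lborel {0<..<pi/2} = 0"
      by (subst (asm) AE_iff_measurable[of "{0<..<pi/2}"]) auto
    then show False by simp
  qed
  ultimately show ?thesis by linarith
qed

definition sinavg :: "real \<Rightarrow> (real \<Rightarrow> real) \<Rightarrow> real \<times> real \<Rightarrow> real" where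
  "sinavg m F e = cosint m (\<lambda>t. F (fst e - 2 * snd e * sin t))"

context
  fixes m :: real and F :: "real \<Rightarrow> real"
  assumes m: "m > 0" and F: "smooth F"
begin

lemma smooth_sinavg_kernel: "smooth (\<lambda>p::(real\<times>real)\<times>real. F (fst (fst p) - 2 * snd (fst p) * snd p))"
  by (intro smooth_compose_real[OF F] smooth_diff smooth_mult smooth_const smooth_bounded_linear
      bounded_linear_fst_comp bounded_linear_snd_comp bounded_linear_fst bounded_linear_snd)

lemma dird_sinavg_kernel:
  "dird (v, 0) (\<lambda>p::(real\<times>real)\<times>real. F (fst (fst p) - 2 * snd (fst p) * snd p)) (e, z)
   = (fst v - 2 * snd v * z) * deriv F (fst e - 2 * snd e * z)"
proof -
  have "((\<lambda>p::(real\<times>real)\<times>real. fst (fst p) - 2 * snd (fst p) * snd p) has_derivative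
      (\<lambda>w. fst (fst w) - (2 * snd (fst w) * z + 2 * snd e * snd w))) (at (e, z))"
    by (auto intro!: derivative_eq_intros simp: algebra_simps)
  from dird_eqI[OF has_derivative_compose[OF this smooth_DERIV[OF F, unfolded has_field_derivative_def]]]
  show ?thesis by (simp add: mult.commute)
qed

lemma smooth_sinavg: "smooth (sinavg m F)"
  using smooth_param_integral[OF smooth_sinavg_kernel integrable_cos_powr[OF m] _ compact_Icc[of "-1" 1], of sin]
  by (simp add: sinavg_def[abs_def] cosint_def)

lemma dird_sinavg:
  "dird v (sinavg m F) e = cosint m (\<lambda>t. (fst v - 2 * snd v * sin t) * deriv F (fst e - 2 * snd e * sin t))"
  using dird_param_integral[OF smooth_sinavg_kernel integrable_cos_powr[OF m] _ compact_Icc[of "-1" 1], of sin v e]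
  by (simp add: sinavg_def[abs_def] cosint_def dird_sinavg_kernel)

lemma sinavg_continuous: "continuous_on UNIV (\<lambda>t. F (A - 2 * s * sin t))"
  by (intro continuous_on_compose2[OF smooth_continuous_on[OF F, of UNIV]] continuous_intros) auto

lemma sinavg_0: "sinavg m F (A, 0) = cosint m (\<lambda>t. 1) * F A"
  using cosint_scale[of m "F A" "\<lambda>_. 1"] by (simp add: sinavg_def mult.commute)

end

lemma cos_powr_Suc:
  "indicator {- pi / 2..pi / 2} t * cos t powr (m + 1) * (x * cos t) = indicator {- pi / 2..pi / 2} t * cos t powr (m + 2) * (x :: real)"
  using cos_half_pi_nonneg[of t] powr_add[of "cos t" "m + 1" 1] by (auto simp: indicator_def add.assoc)

text \<open>The integration by parts raises the exponent by one, and the chain rule supplies another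
  factor \<open>cos t\<close>; hence \<open>m + 2\<close>.\<close>

lemma cosint_sin_deriv:
  assumes m: "m > 0" and F: "smooth F"
  shows "cosint m (\<lambda>t. sin t * F (A - 2 * s * sin t)) = - 2 * s / (m + 1) * sinavg (m + 2) (deriv F) (A, s)"
proof -
  have D: "((\<lambda>t. F (A - 2 * s * sin t)) has_real_derivative deriv F (A - 2 * s * sin t) * (- 2 * s * cos t)) (at t)" for t
    by (rule DERIV_chain2[OF smooth_DERIV[OF F]]) (auto intro!: derivative_eq_intros)
  have c: "continuous_on UNIV (\<lambda>t. deriv F (A - 2 * s * sin t) * (- 2 * s * cos t))"
    by (intro continuous_intros sinavg_continuous[OF m smooth_deriv[OF F]])
  have "cosint m (\<lambda>t. sin t * F (A - 2 * s * sin t)) = cosint (m + 1) (\<lambda>t. deriv F (A - 2 * s * sin t) * (- 2 * s * cos t)) / (m + 1)"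
    by (rule cosint_sin_by_parts[OF m D c])
  also have "cosint (m + 1) (\<lambda>t. deriv F (A - 2 * s * sin t) * (- 2 * s * cos t)) = cosint (m + 2) (\<lambda>t. - 2 * s * deriv F (A - 2 * s * sin t))"
    unfolding cosint_def
  proof (rule Bochner_Integration.integral_cong)
    fix t
    show "indicator {- pi / 2..pi / 2} t * cos t powr (m + 1) * (deriv F (A - 2 * s * sin t) * (- 2 * s * cos t)) =
        indicator {- pi / 2..pi / 2} t * cos t powr (m + 2) * (- 2 * s * deriv F (A - 2 * s * sin t))"
      using cos_powr_Suc[of t m "- 2 * s * deriv F (A - 2 * s * sin t)"] by (simp only: mult_ac)
  qed simp
  also have "\<dots> = - 2 * s * sinavg (m + 2) (deriv F) (A, s)"
    by (simp only: cosint_scale[of "m + 2" "- 2 * s"] sinavg_def fst_conv snd_conv)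
  finally show ?thesis by simp
qed

lemma dird_sinavg_1:
  assumes m: "m > 0" and F: "smooth F"
  shows "dird (1, 0) (sinavg m F) e = sinavg m (deriv F) e"
  by (simp add: dird_sinavg[OF m F]) (simp add: sinavg_def)

text \<open>The factor \<open>2 * s\<close> reflects that the average is even in \<open>s\<close>.
  What remains is the derivative with respect to \<open>s\<^sup>2\<close>, and it is again an
  average, with exponent raised by 2 and \<open>F\<close> differentiated twice.\<close>

lemma dird_sinavg_2:
  assumes m: "m > 0" and F: "smooth F"
  shows "dird (0, 1) (sinavg m F) (A, s) = 2 * s * (2 / (m + 1) * sinavg (m + 2) (deriv (deriv F)) (A, s))"
  using cosint_scale[of m "-2" "\<lambda>t. sin t * deriv F (A - 2 * s * sin t)"] cosint_sin_deriv[OF m smooth_deriv[OF F], of A s]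
  by (simp add: dird_sinavg[OF m F] mult.assoc)

text \<open>Obtained from \<open>cosint_split\<close> by two integrations by parts. With
  \<open>m - 2\<close> in place of \<open>m\<close>, and multiplied by \<open>m - 1\<close>, the
  right-hand side turns into the expression that defines \<open>kern\<close>; this is how the
  excluded exponent \<open>m - 2\<close> is continued to all \<open>m > 0\<close>.\<close>

lemma sinavg_contiguity:
  assumes m: "m > 0" and F: "smooth F"
  shows "sinavg m F (A, s) = (m + 2) / (m + 1) * sinavg (m + 2) F (A, s)
     + 4 * s\<^sup>2 / ((m + 1) * (m + 3)) * sinavg (m + 4) (deriv (deriv F)) (A, s)"
proof -
  let ?H = "\<lambda>t. F (A - 2 * s * sin t)"
  let ?H' = "\<lambda>t. deriv F (A - 2 * s * sin t)"
  note F' = smooth_deriv[OF F]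
  have D: "((\<lambda>t. sin t * ?H t) has_real_derivative cos t * (?H t - 2 * s * (sin t * ?H' t))) (at t)" for t
  proof -
    have "(?H has_real_derivative ?H' t * (- 2 * s * cos t)) (at t)"
      by (rule DERIV_chain2[OF smooth_DERIV[OF F]]) (auto intro!: derivative_eq_intros)
    from DERIV_mult[OF DERIV_sin this] show ?thesis by (simp add: algebra_simps)
  qed
  have c: "continuous_on UNIV (\<lambda>t. cos t * (?H t - 2 * s * (sin t * ?H' t)))"
    by (intro continuous_intros sinavg_continuous[OF m F] sinavg_continuous[OF m F'])
  have "cosint m (\<lambda>t. sin t * (sin t * ?H t)) = cosint (m + 1) (\<lambda>t. cos t * (?H t - 2 * s * (sin t * ?H' t))) / (m + 1)"
    by (rule cosint_sin_by_parts[OF m D c])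
  also have "cosint (m + 1) (\<lambda>t. cos t * (?H t - 2 * s * (sin t * ?H' t))) = cosint (m + 2) (\<lambda>t. 1 * ?H t + (- 2 * s) * (sin t * ?H' t))"
    unfolding cosint_def
  proof (rule Bochner_Integration.integral_cong)
    fix t
    show "indicator {- pi / 2..pi / 2} t * cos t powr (m + 1) * (cos t * (?H t - 2 * s * (sin t * ?H' t))) =
        indicator {- pi / 2..pi / 2} t * cos t powr (m + 2) * (1 * ?H t + (- 2 * s) * (sin t * ?H' t))"
      using cos_powr_Suc[of t m "?H t - 2 * s * (sin t * ?H' t)"] by (simp add: mult.commute[of "cos t"])
  qed simp
  also have "\<dots> = cosint (m + 2) ?H - 2 * s * cosint (m + 2) (\<lambda>t. sin t * ?H' t)"
    using m by (subst cosint_linear) (auto intro!: continuous_intros sinavg_continuous[OF m F] sinavg_continuous[OF m F'])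
  also have "cosint (m + 2) (\<lambda>t. sin t * ?H' t) = - 2 * s / (m + 3) * sinavg (m + 4) (deriv (deriv F)) (A, s)"
    using cosint_sin_deriv[OF _ F', of "m + 2" A s] m by (simp add: add.assoc)
  finally have "sinavg m F (A, s) = sinavg (m + 2) F (A, s)
      + (sinavg (m + 2) F (A, s) - 2 * s * (- 2 * s / (m + 3) * sinavg (m + 4) (deriv (deriv F)) (A, s))) / (m + 1)"
    using cosint_split[OF m sinavg_continuous[OF m F], of A s] by (simp add: sinavg_def)
  moreover have "Y + (Y - 2 * s * (- 2 * s / (m + 3) * Z)) / (m + 1) = (m + 2) / (m + 1) * Y + 4 * s\<^sup>2 / ((m + 1) * (m + 3)) * Z" for Y Z
  proof -
    have "(m + 2) / (m + 1) * Y = Y + Y / (m + 1)" using m by (simp add: field_simps)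
    moreover have "2 * s * (- 2 * s / (m + 3) * Z) / (m + 1) = - (4 * s\<^sup>2 / ((m + 1) * (m + 3)) * Z)"
      by (simp add: power2_eq_square mult_ac)
    ultimately show ?thesis unfolding diff_divide_distrib by linarith
  qed
  ultimately show ?thesis by simp
qed

text \<open>Differentiation in \<open>q = s\<^sup>2\<close> up to the boundary \<open>q = 0\<close>,
  where the chain rule through \<open>sqrt\<close> breaks down. There \<open>f (A, sqrt q)\<close>
  is written as an integral of the continuous function \<open>g (A, sqrt q)\<close>, which gives the
  one-sided derivative. The boundary matters because \<open>yprod\<close> vanishes on
  \<open>\<Sigma>\<^sub>0\<close>.\<close>

lemma has_derivative_even_half_plane:
  fixes f :: "real \<times> real \<Rightarrow> real"
  assumes f: "smooth f" and g: "continuous_on UNIV g" and fg: "\<And>A s. dird (0, 1) f (A, s) = 2 * s * g (A, s)"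
    and q: "q \<ge> 0"
  shows "((\<lambda>(A, q). f (A, sqrt q)) has_derivative (\<lambda>(v1, v2). v1 * dird (1, 0) f (A, sqrt q) + v2 * g (A, sqrt q)))
     (at (A, q) within UNIV \<times> {0..})"
proof -
  have ds: "((\<lambda>s. f (A, s)) has_real_derivative 2 * s * g (A, s)) (at s)" for A s
  proof -
    have "((\<lambda>s. (A, s)) has_derivative (\<lambda>v. v *\<^sub>R (0, 1))) (at s)" by (auto intro!: derivative_eq_intros)
    from has_derivative_compose[OF this smooth_has_derivative[OF f]]
    have "((\<lambda>s. f (A, s)) has_derivative (\<lambda>v. dird (v *\<^sub>R (0, 1)) f (A, s))) (at s)" .
    moreover have "(\<lambda>v. dird (v *\<^sub>R (0, 1)) f (A, s)) = (*) (2 * s * g (A, s))"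
      by (rule ext) (simp add: linear_scale[OF dird_linear[OF f]] fg del: scaleR_Pair)
    ultimately show ?thesis by (simp add: has_field_derivative_def)
  qed
  have dA: "((\<lambda>A. f (A, s)) has_derivative (\<lambda>v. v * dird (1, 0) f (A, s))) (at A)" for A s
  proof -
    have "((\<lambda>A. (A, s)) has_derivative (\<lambda>v. v *\<^sub>R (1, 0))) (at A)" by (auto intro!: derivative_eq_intros)
    from has_derivative_compose[OF this smooth_has_derivative[OF f]]
    show ?thesis by (simp add: linear_scale[OF dird_linear[OF f]] del: scaleR_Pair)
  qed
  have pos: "((\<lambda>q. f (A, sqrt q)) has_real_derivative g (A, sqrt q)) (at q)" if "q > 0" for A q
    using DERIV_chain2[OF ds DERIV_real_sqrt[OF that], of A] that by (simp add: field_simps)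
  have cg: "continuous_on S (\<lambda>q. g (A, sqrt q))" for A S
    by (intro continuous_on_compose2[OF g] continuous_intros) auto
  have cf: "continuous_on S (\<lambda>q. f (A, sqrt q))" for A S
    by (intro continuous_on_compose2[OF smooth_continuous_on[OF f, of UNIV]] continuous_intros) auto
  have zero: "((\<lambda>q. f (A, sqrt q)) has_real_derivative g (A, sqrt 0)) (at 0 within {0..})" for A
  proof -
    have eq: "f (A, 0) + integral {0..x} (\<lambda>q. g (A, sqrt q)) = f (A, sqrt x)" if "x \<in> {0..1}" for x
    proof -
      have "((\<lambda>q. g (A, sqrt q)) has_integral (f (A, sqrt x) - f (A, sqrt 0))) {0..x}"
        by (rule fundamental_theorem_of_calculus_interior)
          (use that pos cf in \<open>auto simp: has_real_derivative_iff_has_vector_derivative[symmetric]\<close>)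
      then show ?thesis by (simp add: integral_unique)
    qed
    have "((\<lambda>x. f (A, 0) + integral {0..x} (\<lambda>q. g (A, sqrt q))) has_real_derivative g (A, sqrt 0)) (at 0 within {0..1})"
      using integral_has_real_derivative[OF cg[of "{0..1}" A], of 0] by (auto intro!: derivative_eq_intros)
    then have "((\<lambda>q. f (A, sqrt q)) has_real_derivative g (A, sqrt 0)) (at 0 within {0..1})"
      by (rule has_field_derivative_transform_within[where d=1]) (use eq in auto)
    moreover have "at 0 within {0..1} = at (0::real) within {0..}"
      by (rule at_within_nhd[of _ "{..<1}"]) auto
    ultimately show ?thesis by simp
  qed
  have dq: "((\<lambda>q. f (A, sqrt q)) has_derivative blinfun_apply (blinfun_scaleR_left (g (A, sqrt q)))) (at q within {0..})"
    if "q \<in> {0..}" for A q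
  proof (cases "q = 0")
    case True
    then show ?thesis using zero[of A] by (simp add: has_field_derivative_def mult.commute[of _ "g (A, 0)"])
  next
    case False
    then have "q > 0" using that by simp
    from has_field_derivative_at_within[OF pos[OF this]] show ?thesis
      by (simp add: has_field_derivative_def mult.commute[of _ "g (A, sqrt q)"])
  qed
  have cb: "continuous_on UNIV (\<lambda>(A, q). blinfun_scaleR_left (g (A, sqrt q)))"
    unfolding split_beta
    by (intro bounded_linear.continuous_on[OF bounded_linear_blinfun_scaleR_left]
        continuous_on_compose2[OF g] continuous_intros) auto
  have "((\<lambda>(A, q). f (A, sqrt q)) has_derivative (\<lambda>(v1, v2). v1 * dird (1, 0) f (A, sqrt q) + blinfun_scaleR_left (g (A, sqrt q)) v2))
     (at (A, q) within UNIV \<times> {0..})"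
  proof (rule has_derivative_partialsI[where f="\<lambda>A q. f (A, sqrt q)" and fy="\<lambda>A q. blinfun_scaleR_left (g (A, sqrt q))"])
    show "continuous (at (A, q) within UNIV \<times> {0..}) (\<lambda>(A, q). blinfun_scaleR_left (g (A, sqrt q)))"
      using cb by (auto simp: continuous_on_eq_continuous_within intro: continuous_within_subset)
  qed (use dq dA q in auto)
  then show ?thesis by simp
qed

section \<open>Generalised translation kernels\<close>

text \<open>With \<open>\<zeta> = (\<xi>, \<eta>)\<close> and \<open>z = (x, y)\<close>, the kernel \<open>transl Y m F (\<zeta>, z)\<close> averages the profile \<open>F\<close> over the squared
  distances \<open>\<bar>x - \<xi>\<bar>\<^sup>2 + \<bar>y\<bar>\<^sup>2 + \<bar>\<eta>\<bar>\<^sup>2 - 2 \<bar>y\<bar> \<bar>\<eta>\<bar> sin t\<close>. With the weight \<open>cos t powr (m - 2)\<close> this would be the generalised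
  translation of the Bessel operator; it is not integrable for \<open>m \<le> 1\<close>, so \<open>kern\<close> is written through
  the weights with exponents \<open>m\<close> and \<open>m + 2\<close>.\<close>

definition dist2 :: "'d set \<Rightarrow> (real^'d) \<times> (real^'d) \<Rightarrow> real" where
  "dist2 Y e = (norm (fst e))\<^sup>2 + (norm (snd e))\<^sup>2 - 2 * (x_part Y (fst e) \<bullet> x_part Y (snd e))"
  for e :: "(real^'d::finite) \<times> (real^'d)"

definition yprod :: "'d set \<Rightarrow> (real^'d) \<times> (real^'d) \<Rightarrow> real" where
  "yprod Y e = (norm (y_part Y (fst e)))\<^sup>2 * (norm (y_part Y (snd e)))\<^sup>2"
  for e :: "(real^'d::finite) \<times> (real^'d)"

definition transl :: "'d set \<Rightarrow> real \<Rightarrow> (real \<Rightarrow> real) \<Rightarrow> (real^'d) \<times> (real^'d) \<Rightarrow> real" where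
  "transl Y m F e = sinavg m F (dist2 Y e, sqrt (yprod Y e))"
  for e :: "(real^'d::finite) \<times> (real^'d)"

definition kern :: "'d set \<Rightarrow> real \<Rightarrow> (real \<Rightarrow> real) \<Rightarrow> (real^'d) \<times> (real^'d) \<Rightarrow> real" where
  "kern Y m F e = m * transl Y m F e + 4 / (m + 1) * (yprod Y e * transl Y (m + 2) (deriv (deriv F)) e)"
  for e :: "(real^'d::finite) \<times> (real^'d)"

section \<open>Coordinate projections and smoothness of the kernel\<close>

lemma bounded_linear_parts [intro]:
  "bounded_linear (y_part Y)" "bounded_linear (x_part Y)"
proof -
  have "linear (y_part Y)" "linear (x_part Y)"
    by (auto intro!: linearI simp: vec_eq_iff y_part_def x_part_def)
  then show "bounded_linear (y_part Y)" "bounded_linear (x_part Y)"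
    by (auto simp: linear_conv_bounded_linear)
qed

lemmas parts_add = linear_add[OF bounded_linear.linear[OF bounded_linear_parts(1)]]
  linear_add[OF bounded_linear.linear[OF bounded_linear_parts(2)]]
lemmas parts_0 = linear_0[OF bounded_linear.linear[OF bounded_linear_parts(1)]]
  linear_0[OF bounded_linear.linear[OF bounded_linear_parts(2)]]

lemma inner_vec_sum: "(u::real^'d::finite) \<bullet> v = (\<Sum>i\<in>UNIV. u $ i * v $ i)"
  by (simp add: inner_vec_def)

lemma x_plus_y: "x_part Y z + y_part Y z = z"
  by (simp add: vec_eq_iff x_part_def y_part_def)
lemma x_inner_y [simp]: "x_part Y z \<bullet> y_part Y w = 0" "y_part Y w \<bullet> x_part Y z = 0"
  by (simp_all add: inner_vec_sum x_part_def y_part_def if_distrib cong: if_cong)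
lemma x_inner_x: "x_part Y z \<bullet> x_part Y w = x_part Y z \<bullet> w" "x_part Y z \<bullet> x_part Y w = z \<bullet> x_part Y w"
  by (auto simp: inner_vec_sum x_part_def intro!: sum.cong)
lemma y_inner_y: "y_part Y z \<bullet> y_part Y w = y_part Y z \<bullet> w" "y_part Y z \<bullet> y_part Y w = z \<bullet> y_part Y w"
  by (auto simp: inner_vec_sum y_part_def intro!: sum.cong)
lemma inner_y_part: "z \<bullet> y_part Y z = (norm (y_part Y z))\<^sup>2" "y_part Y z \<bullet> z = (norm (y_part Y z))\<^sup>2"
  using y_inner_y[of Y z z] by (simp_all add: power2_norm_eq_inner)
lemma norm2_split: "(norm z)\<^sup>2 = (norm (x_part Y z))\<^sup>2 + (norm (y_part Y z))\<^sup>2"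
proof -
  have "(norm z)\<^sup>2 = (x_part Y z + y_part Y z) \<bullet> (x_part Y z + y_part Y z)" by (simp add: x_plus_y power2_norm_eq_inner)
  then show ?thesis by (simp add: inner_add_left inner_add_right power2_norm_eq_inner)
qed

lemma smooth_norm2_linear:
  fixes f :: "'a::real_normed_vector \<Rightarrow> 'b::euclidean_space"
  assumes "bounded_linear f" shows "smooth (\<lambda>x. (norm (f x))\<^sup>2)"
  unfolding power2_norm_eq_inner by (rule smooth_inner_linear[OF assms assms])

lemma smooth_dist2: "smooth (dist2 Y)"
  unfolding dist2_def[abs_def]
  by (intro smooth_diff smooth_add smooth_mult smooth_const smooth_norm2_linear smooth_inner_linear
      bounded_linear_fst bounded_linear_snd bounded_linear_compose[OF bounded_linear_parts(2)])

lemma smooth_yprod: "smooth (yprod Y)"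
  unfolding yprod_def[abs_def]
  by (intro smooth_mult smooth_norm2_linear
      bounded_linear_fst bounded_linear_snd bounded_linear_compose[OF bounded_linear_parts(1)])

lemma yprod_nonneg: "yprod Y e \<ge> 0" by (simp add: yprod_def)
lemma sqrt_yprod: "sqrt (yprod Y e) = norm (y_part Y (fst e)) * norm (y_part Y (snd e))"
  by (simp add: yprod_def real_sqrt_mult)

lemma has_derivative_transl:
  assumes m: "m > 0" and F: "smooth F"
  shows "(transl Y m F has_derivative (\<lambda>v. dird v (dist2 Y) e * transl Y m (deriv F) e
      + dird v (yprod Y) e * (2 / (m + 1) * transl Y (m + 2) (deriv (deriv F)) e))) (at e)"
proof -
  have m2: "m + 2 > 0" using m by simp
  let ?g = "\<lambda>p. 2 / (m + 1) * sinavg (m + 2) (deriv (deriv F)) p"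
  have cg: "continuous_on UNIV ?g"
    by (intro continuous_intros smooth_continuous_on smooth_sinavg m2 smooth_deriv F)
  let ?G = "\<lambda>p v. fst v * sinavg m (deriv F) (fst p, sqrt (snd p)) + snd v * ?g (fst p, sqrt (snd p))"
  have "((\<lambda>p. sinavg m F (fst p, sqrt (snd p))) has_derivative ?G p) (at p within UNIV \<times> {0..})"
    if p: "p \<in> UNIV \<times> {0..}" for p :: "real \<times> real"
  proof -
    obtain A q where Aq: "p = (A, q)" "0 \<le> q" using p by (cases p) auto
    from has_derivative_even_half_plane[OF smooth_sinavg[OF m F] cg dird_sinavg_2[OF m F] Aq(2), of A]
    show ?thesis unfolding Aq case_prod_beta' dird_sinavg_1[OF m F] fst_conv snd_conv .
  qed
  moreover have "range (\<lambda>e. (dist2 Y e, yprod Y e)) \<subseteq> UNIV \<times> {0..}" by (auto simp: yprod_nonneg)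
  ultimately show ?thesis
    using has_derivative_in_compose2[of "UNIV \<times> {0..}" "\<lambda>p. sinavg m F (fst p, sqrt (snd p))" ?G "\<lambda>e. (dist2 Y e, yprod Y e)" UNIV e
        "\<lambda>v. (dird v (dist2 Y) e, dird v (yprod Y) e)"]
      has_derivative_Pair[OF smooth_has_derivative[OF smooth_dist2, of Y e] smooth_has_derivative[OF smooth_yprod, of Y e]]
    by (simp add: transl_def[abs_def])
qed

text \<open>Derivatives of \<open>transl\<close> are combinations of \<open>transl\<close> with
  exponents \<open>m\<close> and \<open>m + 2\<close>, with smooth coefficients; so the induction
  runs over all \<open>m\<close> and \<open>F\<close> at once. The square root of
  \<open>yprod\<close>, itself not smooth, never has to be differentiated.\<close>

lemma smooth_transl:
  assumes m: "m > 0" and F: "smooth F"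
  shows "smooth (transl Y m F)"
proof -
  have "Ck_on k UNIV (transl Y m F)" for k
    using m F
  proof (induction k arbitrary: m F)
    case 0
    show ?case using has_derivative_continuous[OF has_derivative_transl[OF 0]]
      by (auto intro!: continuous_at_imp_continuous_on)
  next
    case (Suc k)
    have m2: "m + 2 > 0" using Suc.prems by simp
    show ?case
      by (rule Ck_on_SucI[OF has_derivative_transl[OF Suc.prems]])
        (intro Ck_on_add Ck_on_mult Ck_on_const smooth_Ck smooth_dird smooth_dist2 smooth_yprod
          Suc.IH Suc.prems(1) m2 smooth_deriv Suc.prems(2))
  qed
  then show ?thesis by (simp add: smooth_on_def)
qed

lemma smooth_kern:
  assumes m: "m > 0" and F: "smooth F"
  shows "smooth (kern Y m F)"
proof -
  have m2: "m + 2 > 0" using m by simp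
  show ?thesis
    unfolding kern_def[abs_def]
    by (intro smooth_add smooth_mult smooth_const smooth_yprod smooth_transl smooth_deriv F m m2)
qed

lemma dird_transl:
  assumes "m > 0" "smooth F"
  shows "dird v (transl Y m F) e = dird v (dist2 Y) e * transl Y m (deriv F) e
      + dird v (yprod Y) e * (2 / (m + 1) * transl Y (m + 2) (deriv (deriv F)) e)"
  by (rule dird_eqI[OF has_derivative_transl[OF assms]])

lemma dird_mult:
  fixes f g :: "'a::real_normed_vector \<Rightarrow> real"
  assumes "smooth f" "smooth g"
  shows "dird v (\<lambda>x. f x * g x) x = f x * dird v g x + dird v f x * g x"
  by (rule dird_eqI[OF has_derivative_mult[OF assms[THEN smooth_has_derivative]]])
lemma dird_const: "dird v (\<lambda>x. c) x = 0"
  by (rule dird_eqI[OF has_derivative_const])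

text \<open>Formally this is \<open>dird_transl\<close> with exponent \<open>m - 2\<close>,
  multiplied by \<open>m - 1\<close>. As that exponent may be inadmissible, the two terms of
  \<open>kern\<close> are differentiated separately and recombined by
  \<open>sinavg_contiguity\<close> for the second derivative of \<open>F\<close>.\<close>

lemma dird_kern:
  assumes m: "m > 0" and F: "smooth F"
  shows "dird v (kern Y m F) e = dird v (dist2 Y) e * kern Y m (deriv F) e
      + dird v (yprod Y) e * (2 * transl Y m (deriv (deriv F)) e)"
proof -
  have m2: "m + 2 > 0" using m by simp
  note F1 = smooth_deriv[OF F] note F2 = smooth_deriv[OF F1] note F3 = smooth_deriv[OF F2] note F4 = smooth_deriv[OF F3]
  have "transl Y m (deriv (deriv F)) e = (m + 2) / (m + 1) * transl Y (m + 2) (deriv (deriv F)) e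
     + 4 * yprod Y e / ((m + 1) * (m + 3)) * transl Y (m + 4) (deriv (deriv (deriv (deriv F)))) e"
    using sinavg_contiguity[OF m F2, of "dist2 Y e" "sqrt (yprod Y e)"] by (simp add: transl_def yprod_nonneg)
  moreover have "dird v (kern Y m F) e = m * (dird v (dist2 Y) e * transl Y m (deriv F) e
      + dird v (yprod Y) e * (2 / (m + 1) * transl Y (m + 2) (deriv (deriv F)) e))
    + 4 / (m + 1) * (yprod Y e * (dird v (dist2 Y) e * transl Y (m + 2) (deriv (deriv (deriv F))) e
      + dird v (yprod Y) e * (2 / (m + 3) * transl Y (m + 4) (deriv (deriv (deriv (deriv F)))) e))
      + dird v (yprod Y) e * transl Y (m + 2) (deriv (deriv F)) e)"
  proof -
    have "((\<lambda>e. m * transl Y m F e + 4 / (m + 1) * (yprod Y e * transl Y (m + 2) (deriv (deriv F)) e)) has_derivative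
      (\<lambda>v. m * dird v (transl Y m F) e + 4 / (m + 1) * (yprod Y e * dird v (transl Y (m + 2) (deriv (deriv F))) e
        + dird v (yprod Y) e * transl Y (m + 2) (deriv (deriv F)) e))) (at e)"
      by (intro has_derivative_add has_derivative_mult_right has_derivative_mult smooth_has_derivative
          smooth_transl smooth_yprod m F m2 F2)
    from dird_eqI[OF this] show ?thesis
      unfolding kern_def[abs_def] dird_transl[OF m F] dird_transl[OF m2 F2] by (simp add: add.assoc)
  qed
  moreover have "m * (p * t1 + q * (2 / (m + 1) * t2)) + 4 / (m + 1) * (r * (p * t3 + q * (2 / (m + 3) * t4)) + q * t2)
    = p * (m * t1 + 4 / (m + 1) * (r * t3)) + q * (2 * ((m + 2) / (m + 1) * t2 + 4 * r / ((m + 1) * (m + 3)) * t4))"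
    for p q r t1 t2 t3 t4 :: real
  proof -
    have a: "4 * r / ((m + 1) * (m + 3)) = 4 * r * inverse (m + 1) * inverse (m + 3)"
      by (simp add: divide_inverse)
    show ?thesis unfolding a by (simp add: divide_inverse algebra_simps)
  qed
  ultimately show ?thesis by (simp add: kern_def)
qed

section \<open>Symmetry of the kernel and the action of \<open>L\<close> on it\<close>

lemma dist2_commute: "dist2 Y (z, w) = dist2 Y (w, z)" by (simp add: dist2_def inner_commute)
lemma yprod_commute: "yprod Y (z, w) = yprod Y (w, z)" by (simp add: yprod_def)
lemma transl_commute: "transl Y m F (z, w) = transl Y m F (w, z)"
  by (simp add: transl_def dist2_commute[of Y z] yprod_commute[of Y z])
lemma kern_commute: "kern Y m F (z, w) = kern Y m F (w, z)"
  by (simp add: kern_def transl_commute[of Y _ _ z] yprod_commute[of Y z])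

lemma has_derivative_slice2:
  fixes k :: "'a::euclidean_space \<times> 'b::euclidean_space \<Rightarrow> real"
  assumes "smooth k"
  shows "((\<lambda>z. k (x, z)) has_derivative (\<lambda>v. dird (0, v) k (x, z))) (at z)"
proof -
  have "((\<lambda>z. (x, z)) has_derivative (\<lambda>v. (0, v))) (at z)"
    by (auto intro!: derivative_eq_intros)
  from has_derivative_compose[OF this smooth_has_derivative[OF assms]] show ?thesis .
qed

lemma dird_slice2:
  fixes k :: "'a::euclidean_space \<times> 'b::euclidean_space \<Rightarrow> real"
  assumes "smooth k"
  shows "dird v (\<lambda>z. k (x, z)) z = dird (0, v) k (x, z)"
  using dird_eqI[OF has_derivative_slice2[OF assms]] .

lemma dird_dist2: "dird (0, v) (dist2 Y) (w, z) = 2 * ((z - x_part Y w) \<bullet> v)"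
proof -
  have "((\<lambda>z. dist2 Y (w, z)) has_derivative (\<lambda>v. 2 * (z \<bullet> v) - 2 * (x_part Y w \<bullet> x_part Y v))) (at z)"
    unfolding dist2_def power2_norm_eq_inner fst_conv snd_conv
    by (auto intro!: derivative_eq_intros bounded_linear_imp_has_derivative bounded_linear_parts simp: inner_commute)
  from dird_eqI[OF this, of v] show ?thesis
    by (simp add: dird_slice2[OF smooth_dist2] inner_diff_left x_inner_x(1))
qed

lemma dird_yprod: "dird (0, v) (yprod Y) (w, z) = 2 * (norm (y_part Y w))\<^sup>2 * (y_part Y z \<bullet> v)"
proof -
  have "((\<lambda>z. yprod Y (w, z)) has_derivative (\<lambda>v. (norm (y_part Y w))\<^sup>2 * (2 * (y_part Y z \<bullet> y_part Y v)))) (at z)"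
    unfolding yprod_def power2_norm_eq_inner fst_conv snd_conv
    by (auto intro!: derivative_eq_intros bounded_linear_imp_has_derivative bounded_linear_parts simp: inner_commute)
  from dird_eqI[OF this, of v] show ?thesis
    by (simp add: dird_slice2[OF smooth_yprod] y_inner_y(1))
qed

definition lap :: "('a::euclidean_space \<Rightarrow> real) \<Rightarrow> 'a \<Rightarrow> real" where
  "lap f z = (\<Sum>b\<in>Basis. dird b (dird b f) z)"

text \<open>The quotient |y|^-2 y . grad of \<open>kern\<close> in the second variable, see
  \<open>kern_radial\<close>. The division has been carried out symbolically, so that no singularity
  is left on \<open>\<Sigma>\<^sub>0\<close>.\<close>

definition kern_h :: "'d set \<Rightarrow> real \<Rightarrow> (real \<Rightarrow> real) \<Rightarrow> (real^'d) \<times> (real^'d) \<Rightarrow> real" where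
  "kern_h Y m F e = 2 * kern Y m (deriv F) e + 4 * (norm (y_part Y (fst e)))\<^sup>2 * transl Y m (deriv (deriv F)) e"
  for e :: "(real^'d::finite) \<times> (real^'d)"

text \<open>The operator \<open>L\<close> applied to \<open>kern\<close> in the second variable, see
  \<open>kern_laplacian\<close>, in a form in which both variables visibly play the same
  role.\<close>

definition kern_L :: "'d set \<Rightarrow> real \<Rightarrow> real \<Rightarrow> (real \<Rightarrow> real) \<Rightarrow> (real^'d) \<times> (real^'d) \<Rightarrow> real" where
  "kern_L Y D m F e = 4 * dist2 Y e * kern Y m (deriv (deriv F)) e + 2 * D * kern Y m (deriv F) e
     + 16 * yprod Y e * transl Y m (deriv (deriv (deriv F))) e"
  for e :: "(real^'d::finite) \<times> (real^'d)"

lemma kern_L_commute: "kern_L Y D m F (z, w) = kern_L Y D m F (w, z)"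
  by (simp add: kern_L_def transl_commute[of Y _ _ z] yprod_commute[of Y z] kern_commute[of Y _ _ z] dist2_commute[of Y z])

lemma smooth_kern_h:
  assumes m: "m > 0" and F: "smooth F"
  shows "smooth (kern_h Y m F)"
  unfolding kern_h_def[abs_def]
  by (intro smooth_add smooth_mult smooth_const smooth_kern smooth_transl smooth_deriv F m smooth_norm2_linear
      bounded_linear_fst bounded_linear_compose[OF bounded_linear_parts(1)])

context
  fixes Y :: "'d::finite set" and m :: real and F :: "real \<Rightarrow> real" and w :: "real^'d"
  assumes m: "m > 0" and F: "smooth F"
begin

lemma dird_kern_slice:
  "dird v (\<lambda>z. kern Y m F (w, z)) z = 2 * ((z - x_part Y w) \<bullet> v) * kern Y m (deriv F) (w, z)
      + 4 * (norm (y_part Y w))\<^sup>2 * (y_part Y z \<bullet> v) * transl Y m (deriv (deriv F)) (w, z)"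
  by (simp add: dird_slice2[OF smooth_kern[OF m F]] dird_kern[OF m F] dird_dist2 dird_yprod)

lemma kern_radial:
  "dird (y_part Y z) (\<lambda>z. kern Y m F (w, z)) z = (norm (y_part Y z))\<^sup>2 * kern_h Y m F (w, z)"
  by (simp add: dird_kern_slice kern_h_def inner_diff_left inner_y_part dot_square_norm algebra_simps)

lemma dird2_kern_slice:
  "dird v (dird v (\<lambda>z. kern Y m F (w, z))) z =
    2 * (v \<bullet> v) * kern Y m (deriv F) (w, z)
    + 2 * ((z - x_part Y w) \<bullet> v) * (2 * ((z - x_part Y w) \<bullet> v) * kern Y m (deriv (deriv F)) (w, z)
      + 4 * (norm (y_part Y w))\<^sup>2 * (y_part Y z \<bullet> v) * transl Y m (deriv (deriv (deriv F))) (w, z))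
    + 4 * (norm (y_part Y w))\<^sup>2 * ((y_part Y v \<bullet> v) * transl Y m (deriv (deriv F)) (w, z)
      + (y_part Y z \<bullet> v) * (2 * ((z - x_part Y w) \<bullet> v) * transl Y m (deriv (deriv (deriv F))) (w, z)
        + 2 * (norm (y_part Y w))\<^sup>2 * (y_part Y z \<bullet> v) * (2 / (m + 1) * transl Y (m + 2) (deriv (deriv (deriv (deriv F)))) (w, z))))"
proof -
  note F1 = smooth_deriv[OF F] note F2 = smooth_deriv[OF F1] note F3 = smooth_deriv[OF F2]
  let ?K = "\<lambda>z. kern Y m (deriv F) (w, z)"
  let ?T = "\<lambda>z. transl Y m (deriv (deriv F)) (w, z)"
  have eq: "dird v (\<lambda>z. kern Y m F (w, z)) = (\<lambda>z. 2 * ((z - x_part Y w) \<bullet> v) * ?K z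
      + 4 * (norm (y_part Y w))\<^sup>2 * (y_part Y z \<bullet> v) * ?T z)"
    by (rule ext) (rule dird_kern_slice)
  have dK: "(?K has_derivative (\<lambda>v. dird (0, v) (kern Y m (deriv F)) (w, z))) (at z)"
    by (rule has_derivative_slice2[OF smooth_kern[OF m F1]])
  have dT: "(?T has_derivative (\<lambda>v. dird (0, v) (transl Y m (deriv (deriv F))) (w, z))) (at z)"
    by (rule has_derivative_slice2[OF smooth_transl[OF m F2]])
  have "((\<lambda>z. 2 * ((z - x_part Y w) \<bullet> v) * ?K z + 4 * (norm (y_part Y w))\<^sup>2 * (y_part Y z \<bullet> v) * ?T z) has_derivative
    (\<lambda>u. 2 * ((z - x_part Y w) \<bullet> v) * dird (0, u) (kern Y m (deriv F)) (w, z) + 2 * (u \<bullet> v) * ?K z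
     + (4 * (norm (y_part Y w))\<^sup>2 * (y_part Y z \<bullet> v) * dird (0, u) (transl Y m (deriv (deriv F))) (w, z)
       + 4 * (norm (y_part Y w))\<^sup>2 * (y_part Y u \<bullet> v) * ?T z))) (at z)"
    by (auto intro!: derivative_eq_intros dK dT bounded_linear_imp_has_derivative bounded_linear_parts)
  note D = dird_eqI[OF this, of v, folded eq, unfolded dird_kern[OF m F1] dird_transl[OF m F2] dird_dist2 dird_yprod]
  show ?thesis unfolding D by (simp only: ring_distribs mult_ac add_ac mult_numeral_1)
qed

text \<open>The Euler-Poisson-Darboux equation in disguise. The trace of the projection to y
  contributes \<open>card Y\<close>, which together with \<open>a\<close> gives exactly the exponent
  \<open>m\<close> of the kernel.\<close>

lemma kern_laplacian:
  assumes card: "real (card Y) + a = m"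
  shows "lap (\<lambda>z. kern Y m F (w, z)) z + a * kern_h Y m F (w, z) = kern_L Y (real CARD('d) + a) m F (w, z)"
proof -
  let ?x = "z - x_part Y w" and ?y = "y_part Y z" and ?n = "(norm (y_part Y w))\<^sup>2"
  have s1: "(\<Sum>b\<in>(Basis :: (real^'d) set). b \<bullet> b) = real CARD('d)"
    by (simp add: inner_same_Basis)
  have s2: "(\<Sum>b\<in>Basis. (p \<bullet> b) * (q \<bullet> b)) = p \<bullet> q" for p q :: "real^'d"
    by (rule euclidean_inner[symmetric])
  have s3: "(\<Sum>b\<in>Basis. y_part Y b \<bullet> b) = real (card Y)"
  proof -
    have B: "(Basis :: (real^'d) set) = (\<lambda>i. axis i 1) ` UNIV" by (auto simp: Basis_vec_def)
    have "y_part Y (axis i 1) \<bullet> axis i 1 = (if i \<in> Y then 1 else 0)" for i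
      by (simp add: inner_axis y_part_def)
    then have "(\<Sum>b\<in>Basis. y_part Y b \<bullet> b) = (\<Sum>i\<in>UNIV. if i \<in> Y then 1 else 0)"
      unfolding B by (subst sum.reindex) (auto simp: inj_on_def axis_eq_axis)
    then show ?thesis by (simp add: sum.If_cases)
  qed
  have xx: "?x \<bullet> ?x = dist2 Y (w, z) - ?n"
  proof -
    have "?x \<bullet> ?x = z \<bullet> z - 2 * (x_part Y w \<bullet> z) + x_part Y w \<bullet> x_part Y w"
      by (simp add: inner_diff_left inner_diff_right inner_commute)
    then show ?thesis
      using norm2_split[of w Y] by (simp add: dist2_def x_inner_x(1)[of Y w z] power2_norm_eq_inner)
  qed
  have xy: "?x \<bullet> ?y = (norm ?y)\<^sup>2" by (simp add: inner_diff_left inner_y_part)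
  have yy: "?y \<bullet> ?y = (norm ?y)\<^sup>2" by (simp add: power2_norm_eq_inner)
  define K1 K2 T2 T3 T4 where "K1 = kern Y m (deriv F) (w, z)" and "K2 = kern Y m (deriv (deriv F)) (w, z)"
    and "T2 = transl Y m (deriv (deriv F)) (w, z)" and "T3 = transl Y m (deriv (deriv (deriv F))) (w, z)"
    and "T4 = transl Y (m + 2) (deriv (deriv (deriv (deriv F)))) (w, z)"
  have "lap (\<lambda>z. kern Y m F (w, z)) z = (\<Sum>b\<in>Basis. 2 * K1 * (b \<bullet> b) + 4 * K2 * ((?x \<bullet> b) * (?x \<bullet> b))
      + 16 * ?n * T3 * ((?x \<bullet> b) * (?y \<bullet> b)) + 4 * ?n * T2 * (y_part Y b \<bullet> b) + 16 * ?n\<^sup>2 / (m + 1) * T4 * ((?y \<bullet> b) * (?y \<bullet> b)))"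
    unfolding lap_def
    by (rule sum.cong[OF refl]) (unfold dird2_kern_slice K1_def[symmetric] K2_def[symmetric] T2_def[symmetric] T3_def[symmetric]
        T4_def[symmetric], simp add: ring_distribs power2_eq_square mult_ac)
  also have "\<dots> = 2 * K1 * real CARD('d) + 4 * K2 * (?x \<bullet> ?x) + 16 * ?n * T3 * (?x \<bullet> ?y) + 4 * ?n * T2 * real (card Y)
      + 16 * ?n\<^sup>2 / (m + 1) * T4 * (?y \<bullet> ?y)"
    by (simp only: sum.distrib sum_distrib_left[symmetric] s1 s2 s3)
  finally have L: "lap (\<lambda>z. kern Y m F (w, z)) z = \<dots>" .
  have K2: "K2 = m * T2 + 4 / (m + 1) * (?n * (norm ?y)\<^sup>2 * T4)"
    by (simp add: K2_def T2_def T4_def kern_def yprod_def)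
  have a: "a = m - real (card Y)" using card by simp
  \<comment> \<open>All terms that would break the symmetry between \<open>w\<close> and
    \<open>z\<close> are collected in the last line; they cancel by the definition of
    \<open>kern\<close> for the second derivative of \<open>F\<close>.\<close>
  have "lap (\<lambda>z. kern Y m F (w, z)) z + a * (2 * K1 + 4 * ?n * T2)
     = 4 * dist2 Y (w, z) * K2 + 2 * (real CARD('d) + a) * K1 + 16 * (?n * (norm ?y)\<^sup>2) * T3
       + 4 * ?n * (m * T2 + 4 / (m + 1) * (?n * (norm ?y)\<^sup>2 * T4) - K2)"
    unfolding L xx xy yy a by (simp add: algebra_simps power2_eq_square)
  also have "m * T2 + 4 / (m + 1) * (?n * (norm ?y)\<^sup>2 * T4) - K2 = 0" using K2 by simp
  finally show ?thesis
    by (simp add: kern_h_def kern_L_def K1_def K2_def T2_def T3_def yprod_def)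
qed

end

text \<open>For \<open>w\<close> on the axis \<open>yprod\<close> vanishes: the second term of
  \<open>kern\<close> drops and the average no longer depends on \<open>t\<close>. What is left of
  \<open>L\<close> is the radial operator of the effective dimension \<open>D\<close>.\<close>

lemma kern_on_axis:
  assumes m: "m > 0" and F: "smooth F" and w: "y_part Y w = 0"
  shows "kern Y m F (w, z) = m * cosint m (\<lambda>t. 1) * F ((norm (z - w))\<^sup>2)"
    and "kern_L Y D m F (w, z) = m * cosint m (\<lambda>t. 1) *
      (4 * (norm (z - w))\<^sup>2 * deriv (deriv F) ((norm (z - w))\<^sup>2) + 2 * D * deriv F ((norm (z - w))\<^sup>2))"
proof -
  have "x_part Y w = w" using x_plus_y[of Y w] w by simp
  then have d: "dist2 Y (w, z) = (norm (z - w))\<^sup>2"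
    using x_inner_x(1)[of Y w z]
    by (simp add: dist2_def power2_norm_eq_inner inner_diff_left inner_diff_right inner_commute)
  have y: "yprod Y (w, z) = 0" using w by (simp add: yprod_def)
  have k: "kern Y m G (w, z) = m * cosint m (\<lambda>t. 1) * G ((norm (z - w))\<^sup>2)" if "smooth G" for G
    using that by (simp add: kern_def transl_def y d sinavg_0[OF m that])
  show "kern Y m F (w, z) = m * cosint m (\<lambda>t. 1) * F ((norm (z - w))\<^sup>2)" by (rule k[OF F])
  show "kern_L Y D m F (w, z) = m * cosint m (\<lambda>t. 1) *
      (4 * (norm (z - w))\<^sup>2 * deriv (deriv F) ((norm (z - w))\<^sup>2) + 2 * D * deriv F ((norm (z - w))\<^sup>2))"
    by (simp add: kern_L_def k smooth_deriv F d y algebra_simps)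
qed

text \<open>Cauchy-Schwarz for the pairs (|x|, |y|). It confines the support of the kernel in
  \<open>z\<close> to the ball of radius \<open>norm w + sqrt c\<close> about the origin, for every
  \<open>w\<close>.\<close>

lemma dist2_lower: "dist2 Y (w, z) - 2 * sqrt (yprod Y (w, z)) * sin t \<ge> (norm z - norm w)\<^sup>2"
proof -
  define a b c d where "a = norm (x_part Y w)" and "b = norm (y_part Y w)" and "c = norm (x_part Y z)" and "d = norm (y_part Y z)"
  have nn: "a \<ge> 0" "b \<ge> 0" "c \<ge> 0" "d \<ge> 0" by (auto simp: a_def b_def c_def d_def)
  have "x_part Y w \<bullet> x_part Y z \<le> a * c" unfolding a_def c_def by (rule norm_cauchy_schwarz)
  moreover have "b * d * sin t \<le> b * d" using nn by (intro mult_left_le) auto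
  moreover have "a * c + b * d \<le> norm w * norm z"
  proof (rule power2_le_imp_le)
    have "(a * c + b * d)\<^sup>2 + (a * d - b * c)\<^sup>2 = (a\<^sup>2 + b\<^sup>2) * (c\<^sup>2 + d\<^sup>2)"
      by (simp add: power2_eq_square algebra_simps)
    then have "(a * c + b * d)\<^sup>2 \<le> (a\<^sup>2 + b\<^sup>2) * (c\<^sup>2 + d\<^sup>2)" using zero_le_power2[of "a * d - b * c"] by linarith
    then show "(a * c + b * d)\<^sup>2 \<le> (norm w * norm z)\<^sup>2"
      by (simp add: power_mult_distrib norm2_split[of w Y] norm2_split[of z Y] a_def b_def c_def d_def)
  qed simp
  ultimately show ?thesis
    unfolding dist2_def sqrt_yprod by (simp add: power2_diff a_def b_def c_def d_def mult_ac)
qed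

lemma transl_zero:
  assumes "\<And>t. t \<ge> c \<Longrightarrow> F t = 0" "(norm z - norm w)\<^sup>2 \<ge> c"
  shows "transl Y m F (w, z) = 0"
proof -
  have "F (dist2 Y (w, z) - 2 * sqrt (yprod Y (w, z)) * sin t) = 0" for t
    using assms dist2_lower[of z w Y t] by (meson order_trans)
  then show ?thesis by (simp add: transl_def sinavg_def cosint_def)
qed

lemma kern_zero:
  assumes F: "profile c F" and c: "(norm z - norm w)\<^sup>2 \<ge> c"
  shows "kern Y m F (w, z) = 0"
  using transl_zero[OF profile_zero[OF F] c] transl_zero[OF profile_zero[OF profile_deriv[OF profile_deriv[OF F]]] c]
  by (simp add: kern_def)

section \<open>Integration by parts against the weight\<close>

lemma dird_zero_outside:
  fixes f :: "'a::euclidean_space \<Rightarrow> real"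
  assumes "smooth f" "\<And>z. norm z > R \<Longrightarrow> f z = 0" "norm z > R"
  shows "dird v f z = 0"
proof -
  have "(f has_derivative (\<lambda>_. 0)) (at z)"
    by (rule has_derivative_transform_within_open[OF has_derivative_const[of 0], where s="- cball 0 R"])
      (use assms(2,3) in \<open>auto simp: open_Compl\<close>)
  from dird_eqI[OF this] show ?thesis by simp
qed

lemma integrable_ball_mult_continuous:
  fixes f :: "'a::euclidean_space \<Rightarrow> real"
  assumes "continuous_on UNIV f" shows "integrable lborel (\<lambda>z. indicator (cball 0 R) z * f z)"
proof -
  have "integrable lborel (indicator (cball (0::'a) R) :: 'a \<Rightarrow> real)"
    by (rule integrable_real_indicator) (auto intro: emeasure_bounded_finite[unfolded infinity_ennreal_def])
  from integrable_mult_continuous[OF this _ compact_cball[of 0 R], of "\<lambda>z. z" f] show ?thesis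
    using assms by (auto simp: indicator_def split: if_splits)
qed

text \<open>By translation invariance the integral of \<open>f (z + t *\<^sub>R v)\<close> does not
  depend on \<open>t\<close>; its derivative at \<open>t = 0\<close> is the integral in question.
  The radius of \<open>B\<close> allows for all shifts with
  \<open>\<bar>t\<bar> < 1\<close>.\<close>

lemma integral_dird_eq_0:
  fixes f :: "'a::euclidean_space \<Rightarrow> real"
  assumes f: "smooth f" and R: "\<And>z. norm z > R \<Longrightarrow> f z = 0"
  shows "(\<integral>z. dird v f z \<partial>lborel) = 0"
proof -
  define B :: "'a set" where "B = cball 0 (R + norm v)"
  let ?k = "\<lambda>p :: real \<times> 'a. f (snd p + fst p *\<^sub>R v)"
  have k: "smooth ?k"
  proof (rule smooth_compose[OF f])
    fix b :: 'a
    have "smooth (\<lambda>p :: real \<times> 'a. snd p \<bullet> b + fst p * (v \<bullet> b))"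
      by (intro smooth_add smooth_mult smooth_const smooth_bounded_linear
        bounded_linear_inner_left_comp bounded_linear_fst bounded_linear_snd)
    then show "smooth (\<lambda>p :: real \<times> 'a. (snd p + fst p *\<^sub>R v) \<bullet> b)" by (simp add: inner_add_left)
  qed
  have g: "integrable lborel (indicator B :: 'a \<Rightarrow> real)"
    unfolding B_def by (rule integrable_real_indicator) (auto intro: emeasure_bounded_finite[unfolded infinity_ennreal_def])
  let ?I = "\<lambda>t. \<integral>z. indicator B z * ?k (t, z) \<partial>lborel"
  have D: "(?I has_derivative (\<lambda>s. \<integral>z. indicator B z * dird (s, 0) ?k (0, z) \<partial>lborel)) (at 0)"
    using has_derivative_param_integral[OF k g, of "\<lambda>z. z" B 0] by (auto simp: B_def indicator_def split: if_splits)
  have const: "?I t = (\<integral>z. f z \<partial>lborel)" if "\<bar>t\<bar> < 1" for t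
  proof -
    have "indicator B z * f (z + t *\<^sub>R v) = f (z + t *\<^sub>R v)" for z
    proof (cases "z \<in> B")
      case False
      have "norm (t *\<^sub>R v) \<le> norm v" using that by (simp add: mult_left_le_one_le)
      then have "norm (z + t *\<^sub>R v) > R" using False norm_triangle_ineq4[of "z + t *\<^sub>R v" "t *\<^sub>R v"] by (simp add: B_def)
      then show ?thesis using R by simp
    qed simp
    then have "?I t = (\<integral>z. f (z + t *\<^sub>R v) \<partial>lborel)" by (simp only: fst_conv snd_conv)
    also have "\<dots> = (\<integral>z. f z \<partial>distr lborel borel ((+) (t *\<^sub>R v)))"
      using smooth_borel[OF f] by (subst integral_distr) (auto simp: add.commute)
    finally show ?thesis by (simp add: lborel_distr_plus)
  qed
  have "(?I has_derivative (\<lambda>_. 0)) (at 0)"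
    by (rule has_derivative_transform_within_open[OF has_derivative_const[of "\<integral>z. f z \<partial>lborel"], where s="{-1<..<1}"])
      (use const in \<open>auto simp: abs_less_iff\<close>)
  from has_derivative_unique[OF D this] have "(\<integral>z. indicator B z * dird (1, 0) ?k (0, z) \<partial>lborel) = 0"
    by meson
  moreover have "indicator B z * dird (1, 0) ?k (0, z) = dird v f z" for z
  proof -
    have "((\<lambda>t. z + t *\<^sub>R v) has_derivative (\<lambda>s. s *\<^sub>R v)) (at 0)" by (auto intro!: derivative_eq_intros)
    from has_derivative_compose[OF this smooth_has_derivative[OF f]]
    have "dird 1 (\<lambda>t. f (z + t *\<^sub>R v)) 0 = dird v f z" using dird_eqI by fastforce
    then have "dird (1, 0) ?k (0, z) = dird v f z" using dird_slice1[OF k, of 1 z 0] by simp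
    moreover have "dird v f z = 0" if "z \<notin> B"
      using that by (intro dird_zero_outside[OF f R]) (auto simp: B_def intro: le_less_trans[of R "R + norm v"])
    ultimately show ?thesis by (auto simp: indicator_def)
  qed
  ultimately show ?thesis by simp
qed

section \<open>Integrability of the weight\<close>

lemma AE_coordinate_nonzero:
  fixes b :: "'a::euclidean_space"
  assumes "b \<in> Basis" shows "AE z in lborel. z \<bullet> b \<noteq> 0"
proof -
  have "{z. z \<bullet> b = 0} \<in> null_sets lebesgue"
    using negligible_standard_hyperplane[OF assms, of 0] by (simp add: negligible_iff_null_sets)
  from AE_not_in[OF this] show ?thesis by (simp add: AE_completion_iff)
qed

lemma AE_y_part_nonzero:
  fixes Y :: "'d::finite set"
  assumes "Y \<noteq> {}" shows "AE z in lborel. y_part Y z \<noteq> 0"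
proof -
  obtain i where i: "i \<in> Y" using assms by blast
  have "AE z::real^'d in lborel. z \<bullet> axis i 1 \<noteq> 0" by (rule AE_coordinate_nonzero) (auto simp: Basis_vec_def)
  then show ?thesis
  proof eventually_elim
    case (elim z)
    then have "y_part Y z $ i \<noteq> 0" using i by (simp add: y_part_def inner_axis)
    then show ?case by auto
  qed
qed

lemma nn_integral_abs_powr:
  assumes "p > -1"
  shows "(\<integral>\<^sup>+x. ennreal (indicator {-1..1} x * \<bar>x\<bar> powr p) \<partial>lborel) = ennreal (2 / (p + 1))"
proof (rule nn_integral_has_integral_lborel)
  have 1: "((\<lambda>x. \<bar>x\<bar> powr p) has_integral 1 / (p + 1)) {0..1}"
    by (rule has_integral_eq[OF _ has_integral_powr_from_0[OF assms, of 1, simplified]]) auto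
  moreover from 1 have "((\<lambda>x. \<bar>-x\<bar> powr p) has_integral 1 / (p + 1)) {-1..-0}"
    by (subst has_integral_reflect_real) simp
  ultimately have "((\<lambda>x. \<bar>x\<bar> powr p) has_integral (1 / (p + 1) + 1 / (p + 1))) {-1..1}"
    by (intro has_integral_combine[of "-1" 0 1]) auto
  then have "((\<lambda>x. if x \<in> {-1..1} then \<bar>x\<bar> powr p else 0) has_integral 2 / (p + 1)) UNIV"
    by (simp only: has_integral_restrict_UNIV) simp
  then show "((\<lambda>x. indicator {-1..1} x * \<bar>x\<bar> powr p) has_integral 2 / (p + 1)) UNIV"
    by (rule has_integral_eq[rotated]) (auto simp: indicator_def)
qed (auto simp: indicator_def)

lemma borel_measurable_parts [measurable]:
  "y_part Y \<in> borel_measurable borel" "x_part Y \<in> borel_measurable borel"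
  by (auto intro!: borel_measurable_continuous_onI linear_continuous_on bounded_linear_parts)

lemma borel_measurable_weight [measurable]: "weight Y a \<in> borel_measurable borel"
  unfolding weight_def[abs_def] by measurable

lemma norm_y_part_le: "norm (y_part Y z) \<le> norm z"
  by (rule power2_le_imp_le) (simp_all add: norm2_split[of z Y])

definition ball_weight :: "'d set \<Rightarrow> real \<Rightarrow> real^'d::finite \<Rightarrow> real" where
  "ball_weight Y a z = indicator (ball 0 1) z * weight Y a z"

lemma ball_weight_nonneg: "ball_weight Y a z \<ge> 0" by (simp add: ball_weight_def weight_def)

lemma borel_measurable_ball_weight [measurable]: "ball_weight Y a \<in> borel_measurable borel"
  unfolding ball_weight_def[abs_def]
  by (intro borel_measurable_times borel_measurable_indicator borel_measurable_weight) auto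

text \<open>For \<open>a < 0\<close>, \<open>\<bar>y\<bar> powr a\<close> is dominated by the product of the \<open>\<bar>y\<^sub>i\<bar> powr (a / n)\<close>, whose exponents exceed \<open>-1\<close>.\<close>

lemma integrable_ball_weight:
  fixes Y :: "'d::finite set"
  assumes Y: "Y \<noteq> {}" and a: "real (card Y) + a > 0"
  shows "integrable lborel (ball_weight Y a)"
proof (cases "a \<ge> 0")
  case True
  show ?thesis
  proof (rule Bochner_Integration.integrable_bound)
    show "integrable lborel (\<lambda>z::real^'d. indicator (cball 0 1) z * (1::real))"
      by (rule integrable_ball_mult_continuous) simp
    show "AE z in lborel. norm (ball_weight Y a z) \<le> norm (indicator (cball 0 1) z * (1::real))"
    proof (rule AE_I2)
      fix z :: "real^'d"
      have "norm (y_part Y z) powr a \<le> 1" if "norm z < 1"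
        using True norm_y_part_le[of Y z] that by (intro powr_le1) auto
      then show "norm (ball_weight Y a z) \<le> norm (indicator (cball 0 1) z * (1::real))"
        by (auto simp: ball_weight_def weight_def indicator_def)
    qed
  qed simp
next
  case False
  define p where "p = a / real (card Y)"
  have cY: "card Y > 0" using Y by (simp add: card_gt_0_iff)
  have p: "p > -1" "p \<le> 0" "p * real (card Y) = a" using False a cY by (auto simp: p_def field_simps)
  define g where "g i x = indicator {-1..1} x * (if i \<in> Y then \<bar>x\<bar> powr p else 1)" for i :: 'd and x :: real
  have g0: "g i x \<ge> 0" for i x by (simp add: g_def)
  define b :: "'d \<Rightarrow> real^'d" where "b i = axis i 1" for i
  have b: "Basis = b ` UNIV" "inj b" by (auto simp: b_def Basis_vec_def inj_on_def axis_eq_axis)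
  define f where "f c x = ennreal (g (inv b c) x)" for c :: "real^'d" and x
  have fb: "f (b i) x = ennreal (g i x)" for i x using b(2) by (simp add: f_def)
  have m [measurable]: "g i \<in> borel_measurable borel" for i unfolding g_def by measurable
  have "(\<integral>\<^sup>+z. (\<Prod>c\<in>Basis. f c (z \<bullet> c)) \<partial>lborel) = (\<Prod>c\<in>Basis. (\<integral>\<^sup>+x. f c x \<partial>lborel))"
    by (rule nn_integral_lborel_prod) (auto simp: f_def)
  also have "\<dots> < top"
  proof -
    have "(\<integral>\<^sup>+x. ennreal (g i x) \<partial>lborel) < top" for i
    proof (cases "i \<in> Y")
      case True
      then show ?thesis using nn_integral_abs_powr[OF p(1)] by (simp add: g_def)
    next
      case False
      then show ?thesis by (simp add: g_def ennreal_indicator)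
    qed
    then have "(\<integral>\<^sup>+x. f (b i) x \<partial>lborel) = ennreal (enn2real (\<integral>\<^sup>+x. f (b i) x \<partial>lborel))" for i
      by (simp add: fb)
    then have "(\<Prod>i\<in>UNIV. \<integral>\<^sup>+x. f (b i) x \<partial>lborel) = (\<Prod>i\<in>UNIV. ennreal (enn2real (\<integral>\<^sup>+x. f (b i) x \<partial>lborel)))"
      by (rule prod.cong[OF refl])
    also have "\<dots> < top" by (subst prod_ennreal) auto
    finally show ?thesis unfolding b(1) by (subst prod.reindex[OF b(2)]) simp
  qed
  finally have fin: "(\<integral>\<^sup>+z. (\<Prod>c\<in>Basis. f c (z \<bullet> c)) \<partial>lborel) < top" .
  have zb: "z \<bullet> b i = z $ i" for z i by (simp add: b_def inner_axis)
  have prod: "(\<Prod>c\<in>Basis. f c (z \<bullet> c)) = ennreal (\<Prod>i\<in>UNIV. g i (z $ i))" for z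
    unfolding b(1) by (subst prod.reindex[OF b(2)]) (simp add: fb zb prod_ennreal g0)
  show ?thesis
  proof (rule integrableI_bounded)
    \<comment> \<open>Coordinate hyperplanes are removed because \<open>powr\<close> gives 0 at 0,
      and the product bound may fail there.\<close>
    have "AE z in lborel. z \<bullet> c \<noteq> 0" if "c \<in> Basis" for c :: "real^'d" by (rule AE_coordinate_nonzero[OF that])
    then have "AE z::real^'d in lborel. \<forall>c\<in>Basis. z \<bullet> c \<noteq> 0" by (intro AE_finite_allI) auto
    then have "AE z in lborel. ennreal (norm (ball_weight Y a z)) \<le> (\<Prod>c\<in>Basis. f c (z \<bullet> c))"
    proof eventually_elim
      case (elim z)
      have nz: "z $ i \<noteq> 0" for i using elim zb[of z i] b(1) by (metis rangeI)
      have "norm (ball_weight Y a z) \<le> (\<Prod>i\<in>UNIV. g i (z $ i))"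
      proof (cases "norm z < 1")
        case True
        have zi: "z $ i \<in> {-1..1}" for i using component_le_norm_cart[of z i] True by auto
        obtain i where "i \<in> Y" using Y by blast
        then have yn: "norm (y_part Y z) > 0"
          using nz[of i] component_le_norm_cart[of "y_part Y z" i] by (auto simp: y_part_def)
        have "norm (y_part Y z) powr a = (norm (y_part Y z) powr p) ^ card Y"
        proof -
          have "(norm (y_part Y z) powr p) ^ card Y = (norm (y_part Y z) powr p) powr real (card Y)"
            using yn by (subst powr_realpow) auto
          then show ?thesis by (simp only: powr_powr p(3))
        qed
        also have "\<dots> = (\<Prod>i\<in>Y. norm (y_part Y z) powr p)" by simp
        also have "\<dots> \<le> (\<Prod>i\<in>Y. \<bar>z $ i\<bar> powr p)"
        proof (rule prod_mono)
          fix i assume i: "i \<in> Y"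
          have "\<bar>z $ i\<bar> \<le> norm (y_part Y z)" using component_le_norm_cart[of "y_part Y z" i] i by (simp add: y_part_def)
          then show "0 \<le> norm (y_part Y z) powr p \<and> norm (y_part Y z) powr p \<le> \<bar>z $ i\<bar> powr p"
            using nz[of i] p(2) by (auto intro: powr_mono2')
        qed
        also have "\<dots> = (\<Prod>i\<in>UNIV. g i (z $ i))"
          using zi by (simp add: g_def prod.If_cases)
        finally show ?thesis using True by (simp add: ball_weight_def weight_def)
      qed (simp add: ball_weight_def prod_nonneg g0)
      then show ?case unfolding prod by (rule ennreal_leI)
    qed
    then show "(\<integral>\<^sup>+z. ennreal (norm (ball_weight Y a z)) \<partial>lborel) < \<infinity>"
      using le_less_trans[OF nn_integral_mono_AE fin] by simp
  qed simp
qed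

lemma integrable_ball_weight_mult:
  fixes Y :: "'d::finite set"
  assumes "Y \<noteq> {}" "real (card Y) + a > 0" "continuous_on UNIV f"
  shows "integrable lborel (\<lambda>z. ball_weight Y a z * f z)"
  by (rule integrable_mult_continuous[OF integrable_ball_weight[OF assms(1,2)] _ compact_cball[of 0 1], of "\<lambda>z. z"])
    (use assms(3) in \<open>auto simp: ball_weight_def indicator_def split: if_splits\<close>)


section \<open>Green's formula with a regularised weight\<close>

lemma has_derivative_powr_smooth:
  assumes "smooth g" "\<And>z. g z > (0::real)"
  shows "((\<lambda>z. g z powr p) has_derivative (\<lambda>v. p * g z powr (p - 1) * dird v g z)) (at z)"
  using has_derivative_compose[OF smooth_has_derivative[OF assms(1)]
      has_real_derivative_powr[OF assms(2), unfolded has_field_derivative_def]] .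

lemma smooth_powr:
  assumes g: "smooth g" and pos: "\<And>z. g z > (0::real)"
  shows "smooth (\<lambda>z. g z powr p)"
proof -
  have "Ck_on k UNIV (\<lambda>z. g z powr p)" for k p
  proof (induction k arbitrary: p)
    case 0
    show ?case using has_derivative_continuous[OF has_derivative_powr_smooth[OF g pos]]
      by (auto intro!: continuous_at_imp_continuous_on)
  next
    case (Suc k)
    show ?case
      by (rule Ck_on_SucI[OF has_derivative_powr_smooth[OF g pos]])
        (intro Ck_on_mult Ck_on_const Suc.IH smooth_Ck smooth_dird g)
  qed
  then show ?thesis by (simp add: smooth_on_def)
qed

lemma dird_norm2_y_part: "dird v (\<lambda>z. (norm (y_part Y z))\<^sup>2 + c) z = 2 * (y_part Y z \<bullet> v)"
proof -
  have "((\<lambda>z. (norm (y_part Y z))\<^sup>2 + c) has_derivative (\<lambda>v. 2 * (y_part Y z \<bullet> y_part Y v))) (at z)"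
    unfolding power2_norm_eq_inner
    by (auto intro!: derivative_eq_intros bounded_linear_imp_has_derivative bounded_linear_parts simp: inner_commute)
  from dird_eqI[OF this, of v] show ?thesis by (simp add: y_inner_y(1))
qed

lemma smooth_lap: "smooth f \<Longrightarrow> smooth (lap f)"
  unfolding lap_def[abs_def] by (intro smooth_sum smooth_dird)

text \<open>The weight is replaced by the smooth \<open>(N z + d) powr (a / 2)\<close>. By
  \<open>rad\<close>, its gradient contributes only the factor \<open>N z / (N z + d)\<close> times
  \<open>h\<close>, which stays bounded as \<open>d\<close> tends to 0, so
  \<open>\<Sigma>\<^sub>0\<close> produces no extra term. Either function may carry the compact
  support: the formula is used with an arbitrary smooth \<open>f\<close>, and also with the roles of
  solution and test function exchanged.\<close>

lemma green:
  fixes Y :: "'d::finite set"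
  assumes Y: "Y \<noteq> {}" and a: "real (card Y) + a > 0" and f: "smooth f" and p: "smooth \<phi>" and R: "R < 1"
    and supp: "(\<forall>z. norm z > R \<longrightarrow> f z = 0) \<or> (\<forall>z. norm z > R \<longrightarrow> \<phi> z = 0)"
    and h: "continuous_on UNIV h" and rad: "\<And>z. dird (y_part Y z) \<phi> z = (norm (y_part Y z))\<^sup>2 * h z"
  shows "(\<integral>z. ball_weight Y a z * (\<Sum>b\<in>Basis. dird b f z * dird b \<phi> z) \<partial>lborel)
     = - (\<integral>z. ball_weight Y a z * (f z * (lap \<phi> z + a * h z)) \<partial>lborel)"
proof -
  define N where "N z = (norm (y_part Y z))\<^sup>2" for z
  define P where "P z = (\<Sum>b\<in>Basis. dird b f z * dird b \<phi> z) + f z * lap \<phi> z" for z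
  define Q where "Q z = a * (f z * h z)" for z
  have cD: "continuous_on UNIV (\<lambda>z. \<Sum>b\<in>Basis. dird b f z * dird b \<phi> z)"
    by (intro smooth_continuous_on smooth_sum smooth_mult smooth_dird f p)
  have cf: "continuous_on UNIV f" "continuous_on UNIV (lap \<phi>)"
    by (intro smooth_continuous_on smooth_lap f p)+
  have cP: "continuous_on UNIV P" unfolding P_def by (intro continuous_intros cD cf)
  have cQ: "continuous_on UNIV Q" unfolding Q_def by (intro continuous_intros cf h)
  have sN: "smooth (\<lambda>z. N z + d)" for d unfolding N_def
    by (intro smooth_add smooth_const smooth_norm2_linear bounded_linear_parts)
  have N0: "N z \<ge> 0" for z by (simp add: N_def)
  define wd where "wd d z = (N z + d) powr (a / 2)" for d z
  have zero: "(\<integral>z. indicator (ball 0 1) z * (wd d z * P z + wd d z * (N z / (N z + d)) * Q z) \<partial>lborel) = 0" if d: "d > 0" for d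
  proof -
    have pos: "N z + d > 0" for z using d N0[of z] by linarith
    have swd: "smooth (wd d)" unfolding wd_def by (rule smooth_powr[OF sN pos])
    have dwd: "dird v (wd d) z = a * (wd d z / (N z + d)) * (y_part Y z \<bullet> v)" for v z
    proof -
      have "dird v (wd d) z = a / 2 * (N z + d) powr (a / 2 - 1) * dird v (\<lambda>z. N z + d) z"
        unfolding wd_def by (rule dird_eqI[OF has_derivative_powr_smooth[OF sN pos]])
      also have "dird v (\<lambda>z. N z + d) z = 2 * (y_part Y z \<bullet> v)"
        unfolding N_def by (rule dird_norm2_y_part)
      also have "(N z + d) powr (a / 2 - 1) = wd d z / (N z + d)"
        using pos[of z] by (simp add: wd_def powr_diff)
      finally have "dird v (wd d) z = a / 2 * (wd d z / (N z + d)) * (2 * (y_part Y z \<bullet> v))" .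
      moreover have "a / 2 * q * (2 * y) = a * q * y" for q y :: real by simp
      ultimately show ?thesis by (simp only:)
    qed
    define X where "X b z = wd d z * (f z * dird b \<phi> z)" for b z
    have sX: "smooth (X b)" for b unfolding X_def by (intro smooth_mult swd f smooth_dird p)
    have X0: "X b z = 0" if "norm z > R" for b z
      using supp that dird_zero_outside[OF p] by (auto simp: X_def)
    have T: "(\<Sum>b\<in>Basis. dird b (X b) z) = wd d z * P z + wd d z * (N z / (N z + d)) * Q z" for z
    proof -
      have "dird b (X b) z = wd d z * (dird b f z * dird b \<phi> z) + wd d z * (f z * dird b (dird b \<phi>) z)
        + a * (wd d z / (N z + d)) * f z * ((y_part Y z \<bullet> b) * dird b \<phi> z)" for b
        unfolding X_def
        by (subst dird_mult[OF swd smooth_mult[OF f smooth_dird[OF p]]], subst dird_mult[OF f smooth_dird[OF p]])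
          (simp add: dwd algebra_simps)
      then have "(\<Sum>b\<in>Basis. dird b (X b) z) = wd d z * (\<Sum>b\<in>Basis. dird b f z * dird b \<phi> z) + wd d z * (f z * lap \<phi> z)
         + a * (wd d z / (N z + d)) * f z * (\<Sum>b\<in>Basis. (y_part Y z \<bullet> b) * dird b \<phi> z)"
        by (simp add: sum.distrib sum_distrib_left lap_def)
      also have "(\<Sum>b\<in>Basis. (y_part Y z \<bullet> b) * dird b \<phi> z) = N z * h z"
        unfolding dird_expand[OF p, symmetric] rad N_def ..
      finally show ?thesis by (simp add: P_def Q_def algebra_simps)
    qed
    have Xo: "dird b (X b) z = 0" if "z \<notin> ball 0 1" for b z
      using that R by (intro dird_zero_outside[OF sX X0]) auto
    have "(\<integral>z. (\<Sum>b\<in>Basis. dird b (X b) z) \<partial>lborel) = (\<Sum>b\<in>Basis. \<integral>z. dird b (X b) z \<partial>lborel)"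
    proof (rule Bochner_Integration.integral_sum)
      fix b :: "real^'d"
      have "(\<lambda>z. indicator (cball 0 1) z * dird b (X b) z) = dird b (X b)"
        using Xo by (force simp: indicator_def)
      then show "integrable lborel (dird b (X b))"
        using integrable_ball_mult_continuous[OF smooth_continuous_on[OF smooth_dird[OF sX[of b], of b]], of 1] by simp
    qed
    also have "\<dots> = 0" using integral_dird_eq_0[OF sX X0] by simp
    finally have "(\<integral>z. (\<Sum>b\<in>Basis. dird b (X b) z) \<partial>lborel) = 0" .
    moreover have "indicator (ball 0 1) z * (wd d z * P z + wd d z * (N z / (N z + d)) * Q z) = (\<Sum>b\<in>Basis. dird b (X b) z)" for z
      unfolding T[symmetric] using Xo by (auto simp: indicator_def)
    ultimately show ?thesis by simp
  qed
  define dn where "dn n = inverse (real (Suc n))" for n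
  have dn: "dn n > 0" "dn n \<le> 1" for n by (auto simp: dn_def field_simps)
  have dn0: "dn \<longlonglongrightarrow> 0" unfolding dn_def by (rule LIMSEQ_inverse_real_of_nat)
  have Npow: "N z powr (a / 2) = weight Y a z" if "y_part Y z \<noteq> 0" for z
  proof -
    have "N z = norm (y_part Y z) powr 2" by (simp add: N_def)
    then have "N z powr (a / 2) = norm (y_part Y z) powr (2 * (a / 2))" by (simp only: powr_powr)
    then show ?thesis by (simp add: weight_def)
  qed
  let ?s = "\<lambda>n z. indicator (ball 0 1) z * (wd (dn n) z * P z + wd (dn n) z * (N z / (N z + dn n)) * Q z)"
  have [measurable]: "ball (0::real^'d) 1 \<in> sets borel" by simp
  have [measurable]: "N \<in> borel_measurable borel"
    using smooth_borel[OF sN[of 0]] by simp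
  have [measurable]: "P \<in> borel_measurable borel" "Q \<in> borel_measurable borel"
    using cP cQ borel_measurable_continuous_onI by auto
  have "(\<lambda>n. \<integral>z. ?s n z \<partial>lborel) \<longlonglongrightarrow> (\<integral>z. ball_weight Y a z * (P z + Q z) \<partial>lborel)"
  proof (rule integral_dominated_convergence)
    \<comment> \<open>For \<open>a < 0\<close> the regularised weight lies below the weight itself;
      for \<open>a \<ge> 0\<close> it is at most \<open>2 powr (a / 2)\<close>, as
      \<open>N z \<le> 1\<close> and \<open>dn n \<le> 1\<close>. The sum covers both cases.\<close>
    let ?w = "\<lambda>z. ball_weight Y a z * (\<bar>P z\<bar> + \<bar>Q z\<bar>) + indicator (cball 0 1) z * (2 powr (a / 2) * (\<bar>P z\<bar> + \<bar>Q z\<bar>))"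
    show "integrable lborel ?w"
      by (intro Bochner_Integration.integrable_add integrable_ball_weight_mult integrable_ball_mult_continuous Y a continuous_intros cP cQ)
    show "(\<lambda>z. ball_weight Y a z * (P z + Q z)) \<in> borel_measurable lborel"
      by measurable
    show "?s n \<in> borel_measurable lborel" for n
      unfolding wd_def by measurable
    show "AE z in lborel. (\<lambda>n. ?s n z) \<longlonglongrightarrow> ball_weight Y a z * (P z + Q z)"
      using AE_y_part_nonzero[OF Y]
    proof eventually_elim
      case (elim z)
      then have Nz: "N z \<noteq> 0" by (simp add: N_def)
      have "(\<lambda>n. ?s n z) \<longlonglongrightarrow> indicator (ball 0 1) z * ((N z + 0) powr (a / 2) * P z + (N z + 0) powr (a / 2) * (N z / (N z + 0)) * Q z)"
        unfolding wd_def by (intro tendsto_intros dn0) (use Nz in auto)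
      then show ?case using Nz by (simp add: ball_weight_def Npow[OF elim] algebra_simps)
    qed
    show "AE z in lborel. norm (?s n z) \<le> ?w z" for n
      using AE_y_part_nonzero[OF Y]
    proof eventually_elim
      case (elim z)
      then have Nz: "N z > 0" by (simp add: N_def)
      have w0: "wd (dn n) z \<ge> 0" by (simp add: wd_def)
      show ?case
      proof (cases "norm z < 1")
        case True
        have N1: "N z \<le> 1" using norm_y_part_le[of Y z] True by (simp add: N_def power_le_one)
        have "wd (dn n) z \<le> weight Y a z + 2 powr (a / 2)"
        proof (cases "a \<ge> 0")
          case True
          have "wd (dn n) z \<le> 2 powr (a / 2)" unfolding wd_def
            using True N1 Nz dn[of n] by (intro powr_mono2) auto
          then show ?thesis by (simp add: weight_def add_increasing)
        next
          case False
          have "wd (dn n) z \<le> N z powr (a / 2)" unfolding wd_def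
            using False Nz dn(1)[of n] by (intro powr_mono2') auto
          then show ?thesis by (simp add: Npow[OF elim] add_increasing2)
        qed
        moreover have "\<bar>P z + (N z / (N z + dn n)) * Q z\<bar> \<le> \<bar>P z\<bar> + \<bar>Q z\<bar>"
        proof -
          have "\<bar>N z / (N z + dn n)\<bar> \<le> 1" using Nz dn(1)[of n] by (simp add: field_simps)
          then have "\<bar>(N z / (N z + dn n)) * Q z\<bar> \<le> \<bar>Q z\<bar>" unfolding abs_mult by (rule mult_left_le_one_le[rotated 2]) auto
          then show ?thesis by linarith
        qed
        ultimately have "wd (dn n) z * \<bar>P z + (N z / (N z + dn n)) * Q z\<bar> \<le> (weight Y a z + 2 powr (a / 2)) * (\<bar>P z\<bar> + \<bar>Q z\<bar>)"
          by (intro mult_mono) (auto simp: weight_def)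
        moreover have "norm (?s n z) = wd (dn n) z * \<bar>P z + (N z / (N z + dn n)) * Q z\<bar>"
        proof -
          have "?s n z = wd (dn n) z * (P z + (N z / (N z + dn n)) * Q z)"
            using True by (simp add: distrib_left)
          then show ?thesis by (simp only: real_norm_def abs_mult abs_of_nonneg[OF w0])
        qed
        ultimately show ?thesis using True by (simp add: ball_weight_def distrib_right mult.assoc)
      qed (simp add: ball_weight_def indicator_def)
    qed
  qed
  then have "(\<lambda>n. 0) \<longlonglongrightarrow> (\<integral>z. ball_weight Y a z * (P z + Q z) \<partial>lborel)"
    by (simp only: zero[OF dn(1)])
  then have "(\<integral>z. ball_weight Y a z * (P z + Q z) \<partial>lborel) = 0"
    using LIMSEQ_unique[OF _ tendsto_const] by blast
  moreover have "ball_weight Y a z * (P z + Q z) = ball_weight Y a z * (\<Sum>b\<in>Basis. dird b f z * dird b \<phi> z)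
     + ball_weight Y a z * (f z * (lap \<phi> z + a * h z))" for z
    by (simp add: P_def Q_def algebra_simps)
  ultimately have "(\<integral>z. ball_weight Y a z * (\<Sum>b\<in>Basis. dird b f z * dird b \<phi> z)
     + ball_weight Y a z * (f z * (lap \<phi> z + a * h z)) \<partial>lborel) = 0" by (simp only:)
  moreover have "integrable lborel (\<lambda>z. ball_weight Y a z * (\<Sum>b\<in>Basis. dird b f z * dird b \<phi> z))"
    "integrable lborel (\<lambda>z. ball_weight Y a z * (f z * (lap \<phi> z + a * h z)))"
    by (intro integrable_ball_weight_mult Y a cD continuous_intros cf h)+
  note Bochner_Integration.integral_add[OF this]
  ultimately show ?thesis by linarith
qed

section \<open>The very weak formulation\<close>

lemma test_functionI:
  fixes \<phi> :: "real^'d::finite \<Rightarrow> real"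
  assumes "smooth \<phi>" "R < 1" "\<And>z. norm z > R \<Longrightarrow> \<phi> z = 0"
  shows "test_function \<phi>"
proof -
  have sub: "closure {z. \<phi> z \<noteq> 0} \<subseteq> cball 0 R"
    by (rule closure_minimal) (use assms(3) in \<open>force simp: not_less[symmetric]\<close>)+
  then have "bounded (closure {z. \<phi> z \<noteq> 0})" using bounded_cball bounded_subset by blast
  then show ?thesis using sub assms(1,2) by (force simp: test_function_def compact_eq_bounded_closed)
qed

lemma inner_gradient:
  fixes f g :: "real^'d::finite \<Rightarrow> real"
  shows "gradient f z \<bullet> gradient g z = (\<Sum>b\<in>Basis. dird b f z * dird b g z)"
proof -
  have B: "(Basis :: (real^'d) set) = (\<lambda>i. axis i 1) ` UNIV" by (auto simp: Basis_vec_def)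
  show ?thesis unfolding B
    by (subst sum.reindex) (auto simp: inj_on_def axis_eq_axis gradient_def dird_def inner_vec_def)
qed

lemma continuous_on_gradient: "smooth f \<Longrightarrow> continuous_on UNIV (gradient f)"
  unfolding gradient_def[abs_def] using smooth_continuous_on[OF smooth_dird, of f]
  by (intro continuous_on_vec_lambda) (simp add: dird_def[abs_def])

lemma borel_measurable_lebesgue_onI:
  "f \<in> borel_measurable borel \<Longrightarrow> f \<in> borel_measurable (lebesgue_on S)"
  by (intro measurable_restrict_space1 measurable_completion) simp

text \<open>The passage to \<open>lborel\<close> is made for Borel functions only. The solution
  \<open>u\<close> is merely Lebesgue measurable, so integrals that contain it stay on
  \<open>lebesgue_on\<close> until a Borel representative is chosen at the end.\<close>

lemma lebesgue_on_weight_iff: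
  fixes f :: "real^'d::finite \<Rightarrow> real"
  assumes [measurable]: "f \<in> borel_measurable borel"
  shows "integrable (lebesgue_on (ball 0 1)) (\<lambda>z. weight Y a z * f z) \<longleftrightarrow> integrable lborel (\<lambda>z. ball_weight Y a z * f z)"
    and "(\<integral>z. weight Y a z * f z \<partial>lebesgue_on (ball 0 1)) = (\<integral>z. ball_weight Y a z * f z \<partial>lborel)"
proof -
  have m: "(\<lambda>z. ball_weight Y a z * f z) \<in> borel_measurable lborel"
    by (simp add: borel_measurable_times borel_measurable_ball_weight)
  have s: "ball 0 1 \<inter> space lebesgue \<in> sets lebesgue" by simp
  have e: "(\<lambda>z. indicator (ball 0 1) z *\<^sub>R (weight Y a z * f z)) = (\<lambda>z. ball_weight Y a z * f z)"
    by (auto simp: ball_weight_def)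
  show "integrable (lebesgue_on (ball 0 1)) (\<lambda>z. weight Y a z * f z) \<longleftrightarrow> integrable lborel (\<lambda>z. ball_weight Y a z * f z)"
    unfolding integrable_restrict_space[OF s] e integrable_completion[OF m] ..
  show "(\<integral>z. weight Y a z * f z \<partial>lebesgue_on (ball 0 1)) = (\<integral>z. ball_weight Y a z * f z \<partial>lborel)"
    unfolding integral_restrict_space[OF s] e integral_completion[OF m] ..
qed

lemma eq_0_if_le_all_multiples:
  fixes x C :: real
  assumes "\<And>e. e > 0 \<Longrightarrow> \<bar>x\<bar> \<le> e * C" "C \<ge> 0"
  shows "x = 0"
proof -
  have "\<bar>x\<bar> \<le> 0"
  proof (rule field_le_epsilon)
    fix e :: real assume e: "e > 0"
    have "\<bar>x\<bar> \<le> e / (C + 1) * C" using e assms(2) by (intro assms(1)) auto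
    also have "\<dots> \<le> e" using e assms(2) by (simp add: field_simps)
    finally show "\<bar>x\<bar> \<le> 0 + e" by simp
  qed
  then show ?thesis by simp
qed

text \<open>Serves in place of Cauchy-Schwarz: for a finite measure of mass \<open>I\<close>, if the
  integral of \<open>t\<^sup>2\<close> is below \<open>e\<^sup>2\<close>, then the integral of
  \<open>t\<close> is at most \<open>e * (I + 1)\<close>.\<close>

lemma le_eps_square: "(t::real) \<le> e + t\<^sup>2 / e" if "e > 0"
proof -
  have "0 \<le> (t - e)\<^sup>2" by simp
  then have "2 * t * e \<le> t\<^sup>2 + e\<^sup>2" by (simp add: power2_diff)
  moreover have "t * e \<le> e\<^sup>2 + t\<^sup>2"
  proof (cases "t * e \<ge> 0")
    case True
    then show ?thesis using \<open>2 * t * e \<le> t\<^sup>2 + e\<^sup>2\<close> by linarith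
  next
    case False
    then show ?thesis using zero_le_power2[of t] zero_le_power2[of e] by linarith
  qed
  ultimately show ?thesis using that by (simp add: field_simps power2_eq_square)
qed

lemma continuous_bounded_cball:
  fixes f :: "'a::euclidean_space \<Rightarrow> 'b::real_normed_vector"
  assumes "continuous_on UNIV f" obtains B where "\<And>z. z \<in> cball c r \<Longrightarrow> norm (f z) \<le> B"
proof -
  have "compact (f ` cball c r)"
    by (rule compact_continuous_image[OF continuous_on_subset[OF assms]]) auto
  then obtain a where "\<forall>x\<in>cball c r. norm (f x) \<le> a" by (auto dest!: compact_imp_bounded simp: bounded_iff)
  then show ?thesis by (intro that) blast
qed

text \<open>\<open>green\<close> holds for the smooth approximants of \<open>u\<close>, and both
  sides pass to the limit in the weighted norm. The result contains \<open>u\<close> but no gradient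
  of it, and it is the only form of the equation used from here on.\<close>

lemma very_weak:
  fixes Y :: "'d::finite set" and u :: "real^'d \<Rightarrow> real"
  assumes Y: "Y \<noteq> {}" and a: "real (card Y) + a > 0" and u: "weak_solution Y a u"
  shows "integrable (lebesgue_on (ball 0 1)) (\<lambda>z. weight Y a z * u z)"
    and "\<And>\<phi> h R. smooth \<phi> \<Longrightarrow> R < 1 \<Longrightarrow> (\<And>z. norm z > R \<Longrightarrow> \<phi> z = 0) \<Longrightarrow> continuous_on UNIV h \<Longrightarrow>
      (\<And>z. dird (y_part Y z) \<phi> z = (norm (y_part Y z))\<^sup>2 * h z) \<Longrightarrow>
      (\<integral>z. weight Y a z * (u z * (lap \<phi> z + a * h z)) \<partial>lebesgue_on (ball 0 1)) = 0"
proof -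
  let ?\<mu> = "lebesgue_on (ball (0::real^'d) 1)"
  let ?W = "weight Y a"
  from u obtain V where V: "has_H1_gradient Y a u V"
    and weak: "\<And>\<phi>. test_function \<phi> \<Longrightarrow> (\<integral>z. ?W z * (V z \<bullet> gradient \<phi> z) \<partial>?\<mu>) = 0"
    unfolding weak_solution_def by blast
  from V obtain \<psi> where [measurable]: "u \<in> borel_measurable ?\<mu>" "V \<in> borel_measurable ?\<mu>"
    and \<psi>: "\<And>k. smooth (\<psi> k)"
    and lim: "(\<lambda>k. \<integral>\<^sup>+ z. ennreal (?W z * ((u z - \<psi> k z)\<^sup>2 + (norm (V z - gradient (\<psi> k) z))\<^sup>2)) \<partial>?\<mu>) \<longlonglongrightarrow> 0"
    unfolding has_H1_gradient_def by blast
  define e where "e k z = (u z - \<psi> k z)\<^sup>2 + (norm (V z - gradient (\<psi> k) z))\<^sup>2" for k z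
  have W0: "?W z \<ge> 0" for z by (simp add: weight_def)
  have [measurable]: "?W \<in> borel_measurable ?\<mu>" by (intro borel_measurable_lebesgue_onI borel_measurable_weight)
  have [measurable]: "\<psi> k \<in> borel_measurable ?\<mu>" for k by (intro borel_measurable_lebesgue_onI smooth_borel \<psi>)
  have [measurable]: "gradient (\<psi> k) \<in> borel_measurable ?\<mu>" for k
    by (intro borel_measurable_lebesgue_onI borel_measurable_continuous_onI continuous_on_gradient \<psi>)
  have [measurable]: "e k \<in> borel_measurable ?\<mu>" for k unfolding e_def by measurable
  have Wc: "integrable ?\<mu> (\<lambda>z. ?W z * f z)" if "continuous_on UNIV f" for f
    using integrable_ball_weight_mult[OF Y a that] lebesgue_on_weight_iff(1)[OF borel_measurable_continuous_onI[OF that]] by simp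
  have IW: "integrable ?\<mu> ?W" using Wc[of "\<lambda>_. 1"] by simp
  define I where "I = (\<integral>z. ?W z \<partial>?\<mu>)"
  have I0: "I \<ge> 0" unfolding I_def by (intro integral_nonneg_AE) (simp add: W0)
  have ev: "\<exists>k. integrable ?\<mu> (\<lambda>z. ?W z * e k z) \<and> (\<integral>z. ?W z * e k z \<partial>?\<mu>) < \<delta>" if "\<delta> > 0" for \<delta> :: real
  proof -
    have "eventually (\<lambda>k. (\<integral>\<^sup>+ z. ennreal (?W z * e k z) \<partial>?\<mu>) < ennreal \<delta>) sequentially"
      using order_tendstoD(2)[OF lim, of "ennreal \<delta>"] that by (simp add: e_def)
    then obtain k where k: "(\<integral>\<^sup>+ z. ennreal (?W z * e k z) \<partial>?\<mu>) < ennreal \<delta>"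
      unfolding eventually_sequentially by blast
    have We: "?W z * e k z \<ge> 0" for z by (simp add: e_def W0)
    have i: "integrable ?\<mu> (\<lambda>z. ?W z * e k z)"
      by (rule integrableI_bounded) (use k We in \<open>auto intro: less_trans\<close>)
    from nn_integral_eq_integral[OF i] k We
    have "ennreal (\<integral>z. ?W z * e k z \<partial>?\<mu>) < ennreal \<delta>" by simp
    moreover have "(\<integral>z. ?W z * e k z \<partial>?\<mu>) \<ge> 0" by (intro integral_nonneg_AE) (simp add: We)
    ultimately have "(\<integral>z. ?W z * e k z \<partial>?\<mu>) < \<delta>" by (simp add: ennreal_less_iff)
    with i show ?thesis by blast
  qed
  have bu: "\<bar>u z - \<psi> k z\<bar> \<le> \<epsilon> + e k z / \<epsilon>" and bV: "norm (V z - gradient (\<psi> k) z) \<le> \<epsilon> + e k z / \<epsilon>" if "\<epsilon> > 0" for z k \<epsilon>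
    using le_eps_square[OF that, of "\<bar>u z - \<psi> k z\<bar>"] le_eps_square[OF that, of "norm (V z - gradient (\<psi> k) z)"]
      divide_right_mono[of "(u z - \<psi> k z)\<^sup>2" "e k z" \<epsilon>] divide_right_mono[of "(norm (V z - gradient (\<psi> k) z))\<^sup>2" "e k z" \<epsilon>] that
    by (auto simp: e_def)
  have iu: "integrable ?\<mu> (\<lambda>z. ?W z * (u z * f z))" if f: "continuous_on UNIV f" for f
  proof -
    have [measurable]: "f \<in> borel_measurable ?\<mu>" by (intro borel_measurable_lebesgue_onI borel_measurable_continuous_onI f)
    obtain B where B: "\<And>z. z \<in> cball 0 1 \<Longrightarrow> \<bar>f z\<bar> \<le> B"
      using continuous_bounded_cball[OF f] by (metis real_norm_def)
    obtain k where k: "integrable ?\<mu> (\<lambda>z. ?W z * e k z)" using ev[of 1] by auto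
    have "integrable ?\<mu> (\<lambda>z. ?W z * ((u z - \<psi> k z) * f z))"
    proof (rule Bochner_Integration.integrable_bound)
      show "integrable ?\<mu> (\<lambda>z. B * (?W z + ?W z * e k z))" using k IW by auto
      show "AE z in ?\<mu>. norm (?W z * ((u z - \<psi> k z) * f z)) \<le> norm (B * (?W z + ?W z * e k z))"
      proof (rule AE_I2)
        fix z assume "z \<in> space ?\<mu>"
        then have fz: "\<bar>f z\<bar> \<le> B" using B by auto
        have "?W z * (\<bar>u z - \<psi> k z\<bar> * \<bar>f z\<bar>) \<le> ?W z * ((1 + e k z) * B)"
          using bu[of 1 z k] fz W0[of z] by (intro mult_left_mono mult_mono) (auto simp: e_def)
        then show "norm (?W z * ((u z - \<psi> k z) * f z)) \<le> norm (B * (?W z + ?W z * e k z))"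
        proof -
          have "norm (?W z * ((u z - \<psi> k z) * f z)) = ?W z * (\<bar>u z - \<psi> k z\<bar> * \<bar>f z\<bar>)"
            using W0[of z] by (simp add: abs_mult)
          also note \<open>\<dots> \<le> ?W z * ((1 + e k z) * B)\<close>
          also have "?W z * ((1 + e k z) * B) = B * (?W z + ?W z * e k z)" by (simp add: algebra_simps)
          finally show ?thesis by simp
        qed
      qed
    qed measurable
    moreover have "integrable ?\<mu> (\<lambda>z. ?W z * (\<psi> k z * f z))"
      by (intro Wc continuous_intros f smooth_continuous_on \<psi>)
    ultimately have "integrable ?\<mu> (\<lambda>z. ?W z * ((u z - \<psi> k z) * f z) + ?W z * (\<psi> k z * f z))" by (rule Bochner_Integration.integrable_add)
    then show ?thesis by (simp add: algebra_simps)
  qed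
  show "integrable ?\<mu> (\<lambda>z. ?W z * u z)" using iu[of "\<lambda>_. 1"] by simp
  fix \<phi> h R
  assume \<phi>: "smooth \<phi>" and R: "R < 1" and supp: "\<And>z. norm z > R \<Longrightarrow> \<phi> z = 0" and h: "continuous_on UNIV h"
    and rad: "\<And>z. dird (y_part Y z) \<phi> z = (norm (y_part Y z))\<^sup>2 * h z"
  define L where "L z = lap \<phi> z + a * h z" for z
  have cL: "continuous_on UNIV L" unfolding L_def by (intro continuous_intros h smooth_continuous_on smooth_lap \<phi>)
  have [measurable]: "L \<in> borel_measurable ?\<mu>" "gradient \<phi> \<in> borel_measurable ?\<mu>"
    by (intro borel_measurable_lebesgue_onI borel_measurable_continuous_onI cL continuous_on_gradient \<phi>)+
  obtain B1 where B1: "\<And>z. z \<in> cball 0 1 \<Longrightarrow> \<bar>L z\<bar> \<le> B1"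
    using continuous_bounded_cball[OF cL] by (metis real_norm_def)
  obtain B2 where B2: "\<And>z. z \<in> cball 0 1 \<Longrightarrow> norm (gradient \<phi> z) \<le> B2"
    using continuous_bounded_cball[OF continuous_on_gradient[OF \<phi>]] by metis
  define B where "B = B1 + B2"
  have B0: "B1 \<ge> 0" "B2 \<ge> 0" using B1[of 0] B2[of 0] by (auto intro: order_trans[OF abs_ge_zero] order_trans[OF norm_ge_zero])
  let ?T = "\<lambda>z. ?W z * (V z \<bullet> gradient \<phi> z + u z * L z)"
  let ?S = "\<lambda>k z. ?W z * (gradient (\<psi> k) z \<bullet> gradient \<phi> z + \<psi> k z * L z)"
  have S: "integrable ?\<mu> (?S k)" "(\<integral>z. ?S k z \<partial>?\<mu>) = 0" for k
  proof -
    have c1: "continuous_on UNIV (\<lambda>z. \<Sum>b\<in>Basis. dird b (\<psi> k) z * dird b \<phi> z)"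
      by (intro smooth_continuous_on smooth_sum smooth_mult smooth_dird \<psi> \<phi>)
    have c2: "continuous_on UNIV (\<lambda>z. \<psi> k z * L z)" by (intro continuous_intros cL smooth_continuous_on \<psi>)
    note i = Wc[OF c1] Wc[OF c2]
    have "(\<integral>z. ?W z * (\<Sum>b\<in>Basis. dird b (\<psi> k) z * dird b \<phi> z) \<partial>?\<mu>) = - (\<integral>z. ?W z * (\<psi> k z * L z) \<partial>?\<mu>)"
      using green[OF Y a \<psi>[of k] \<phi> R _ h rad] supp
      by (simp add: lebesgue_on_weight_iff(2) borel_measurable_continuous_onI c1 c2[unfolded L_def] L_def)
    then show "integrable ?\<mu> (?S k)" "(\<integral>z. ?S k z \<partial>?\<mu>) = 0"
      using i Bochner_Integration.integral_add[OF i] by (simp_all add: distrib_left inner_gradient)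
  qed
  have est: "integrable ?\<mu> ?T \<and> \<bar>\<integral>z. ?T z \<partial>?\<mu>\<bar> \<le> B * (\<epsilon> * (I + 1))" if \<epsilon>: "\<epsilon> > 0" for \<epsilon>
  proof -
    \<comment> \<open>The threshold \<open>\<epsilon>\<^sup>2\<close> makes the integral of
      \<open>?W z * e k z / \<epsilon>\<close> at most \<open>\<epsilon>\<close>.\<close>
    obtain k where k: "integrable ?\<mu> (\<lambda>z. ?W z * e k z)" "(\<integral>z. ?W z * e k z \<partial>?\<mu>) < \<epsilon>\<^sup>2"
      using ev[of "\<epsilon>\<^sup>2"] \<epsilon> by auto
    let ?b = "\<lambda>z. B * (\<epsilon> * ?W z + ?W z * e k z / \<epsilon>)"
    have ib: "integrable ?\<mu> ?b" using k IW by auto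
    have bd: "\<bar>?T z - ?S k z\<bar> \<le> ?b z" if "z \<in> space ?\<mu>" for z
    proof -
      have z: "z \<in> cball 0 1" using that by auto
      have "\<bar>(V z - gradient (\<psi> k) z) \<bullet> gradient \<phi> z\<bar> \<le> (\<epsilon> + e k z / \<epsilon>) * B2"
        using bV[OF \<epsilon>, of z k] B2[OF z] \<epsilon> by (intro order_trans[OF Cauchy_Schwarz_ineq2] mult_mono) (auto simp: e_def)
      moreover have "\<bar>(u z - \<psi> k z) * L z\<bar> \<le> (\<epsilon> + e k z / \<epsilon>) * B1"
        unfolding abs_mult using bu[OF \<epsilon>, of z k] B1[OF z] \<epsilon> by (intro mult_mono) (auto simp: e_def)
      ultimately have "\<bar>(V z - gradient (\<psi> k) z) \<bullet> gradient \<phi> z + (u z - \<psi> k z) * L z\<bar> \<le> (\<epsilon> + e k z / \<epsilon>) * B"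
        by (simp add: B_def distrib_left)
      then have "?W z * \<bar>(V z - gradient (\<psi> k) z) \<bullet> gradient \<phi> z + (u z - \<psi> k z) * L z\<bar> \<le> ?W z * ((\<epsilon> + e k z / \<epsilon>) * B)"
        using W0 by (rule mult_left_mono)
      moreover have "?T z - ?S k z = ?W z * ((V z - gradient (\<psi> k) z) \<bullet> gradient \<phi> z + (u z - \<psi> k z) * L z)"
        by (simp add: inner_diff_left algebra_simps)
      then have "\<bar>?T z - ?S k z\<bar> = ?W z * \<bar>(V z - gradient (\<psi> k) z) \<bullet> gradient \<phi> z + (u z - \<psi> k z) * L z\<bar>"
        using W0[of z] by (simp add: abs_mult)
      moreover have "?W z * ((\<epsilon> + e k z / \<epsilon>) * B) = ?b z" by (simp add: algebra_simps)
      ultimately show ?thesis by linarith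
    qed
    have iTS: "integrable ?\<mu> (\<lambda>z. ?T z - ?S k z)"
      by (rule Bochner_Integration.integrable_bound[OF ib])
        (use bd in \<open>auto intro!: AE_I2 intro: order_trans[OF _ abs_ge_self]\<close>)
    have iT: "integrable ?\<mu> ?T" using Bochner_Integration.integrable_add[OF iTS S(1)[of k]] by simp
    have "(\<integral>z. ?T z \<partial>?\<mu>) = (\<integral>z. ?T z - ?S k z \<partial>?\<mu>)"
      using Bochner_Integration.integral_diff[OF iT S(1)[of k]] S(2)[of k] by simp
    also have "\<bar>\<dots>\<bar> \<le> (\<integral>z. ?b z \<partial>?\<mu>)"
      by (rule order_trans[OF integral_abs_bound integral_mono[OF integrable_abs[OF iTS] ib bd]])
    also have "\<dots> = B * (\<epsilon> * I + (\<integral>z. ?W z * e k z \<partial>?\<mu>) / \<epsilon>)"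
      using k(1) IW by (simp add: I_def)
    also have "\<dots> \<le> B * (\<epsilon> * (I + 1))"
    proof (rule mult_left_mono)
      have "(\<integral>z. ?W z * e k z \<partial>?\<mu>) / \<epsilon> \<le> \<epsilon>"
        using k(2) \<epsilon> by (simp add: field_simps power2_eq_square)
      then show "\<epsilon> * I + (\<integral>z. ?W z * e k z \<partial>?\<mu>) / \<epsilon> \<le> \<epsilon> * (I + 1)" by (simp add: distrib_left)
    qed (use B0 in \<open>simp add: B_def\<close>)
    finally show ?thesis using iT by simp
  qed
  have iT: "integrable ?\<mu> ?T" using est[of 1] by simp
  have T0: "(\<integral>z. ?T z \<partial>?\<mu>) = 0"
  proof (rule eq_0_if_le_all_multiples)
    show "\<bar>\<integral>z. ?T z \<partial>?\<mu>\<bar> \<le> e * (B * (I + 1))" if "e > 0" for e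
      using est[OF that] by (simp add: mult.left_commute)
  qed (use B0 I0 in \<open>simp add: B_def\<close>)
  have iV: "integrable ?\<mu> (\<lambda>z. ?W z * (V z \<bullet> gradient \<phi> z))"
    using Bochner_Integration.integrable_diff[OF iT iu[OF cL]] by (simp add: distrib_left)
  have "(\<integral>z. ?T z \<partial>?\<mu>) = (\<integral>z. ?W z * (V z \<bullet> gradient \<phi> z) \<partial>?\<mu>) + (\<integral>z. ?W z * (u z * L z) \<partial>?\<mu>)"
    unfolding distrib_left by (rule Bochner_Integration.integral_add[OF iV iu[OF cL]])
  then show "(\<integral>z. ?W z * (u z * (lap \<phi> z + a * h z)) \<partial>?\<mu>) = 0"
    using T0 weak[OF test_functionI[OF \<phi> R supp]] by (simp add: L_def)
qed

text \<open>Two applications of \<open>green\<close>, the second with the roles of \<open>v\<close>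
  and \<open>\<phi>\<close> exchanged; \<open>\<phi>\<close> provides the compact support in
  both.\<close>

lemma classical_very_weak:
  fixes Y :: "'d::finite set" and v \<phi> :: "real^'d \<Rightarrow> real"
  assumes Y: "Y \<noteq> {}" and a: "real (card Y) + a > 0" and v: "smooth v" and hv: "continuous_on UNIV hv"
    and radv: "\<And>z. dird (y_part Y z) v z = (norm (y_part Y z))\<^sup>2 * hv z"
    and Lv: "\<And>z. norm z \<le> R \<Longrightarrow> lap v z + a * hv z = 0"
    and \<phi>: "smooth \<phi>" and R: "R < 1" and supp: "\<And>z. norm z > R \<Longrightarrow> \<phi> z = 0" and h: "continuous_on UNIV h"
    and rad: "\<And>z. dird (y_part Y z) \<phi> z = (norm (y_part Y z))\<^sup>2 * h z"
  shows "(\<integral>z. ball_weight Y a z * (v z * (lap \<phi> z + a * h z)) \<partial>lborel) = 0"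
proof -
  have "(\<integral>z. ball_weight Y a z * (v z * (lap \<phi> z + a * h z)) \<partial>lborel)
     = - (\<integral>z. ball_weight Y a z * (\<Sum>b\<in>Basis. dird b v z * dird b \<phi> z) \<partial>lborel)"
    using green[OF Y a v \<phi> R _ h rad] supp by simp
  also have "(\<integral>z. ball_weight Y a z * (\<Sum>b\<in>Basis. dird b v z * dird b \<phi> z) \<partial>lborel)
      = (\<integral>z. ball_weight Y a z * (\<Sum>b\<in>Basis. dird b \<phi> z * dird b v z) \<partial>lborel)"
    by (simp add: mult.commute)
  also have "\<dots> = - (\<integral>z. ball_weight Y a z * (\<phi> z * (lap v z + a * hv z)) \<partial>lborel)"
    using green[OF Y a \<phi> v R _ hv radv] supp by simp
  also have "(\<lambda>z. ball_weight Y a z * (\<phi> z * (lap v z + a * hv z))) = (\<lambda>z. 0)"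
  proof
    fix z show "ball_weight Y a z * (\<phi> z * (lap v z + a * hv z)) = 0"
      using Lv[of z] supp[of z] by (cases "norm z \<le> R") auto
  qed
  finally show ?thesis by simp
qed


definition very_weak_on :: "'d set \<Rightarrow> real \<Rightarrow> real \<Rightarrow> (real^'d::finite \<Rightarrow> real) \<Rightarrow> bool" where
  "very_weak_on Y a \<rho> G \<longleftrightarrow> integrable (lebesgue_on (ball 0 1)) G \<and>
    (\<forall>\<phi> h R. smooth \<phi> \<longrightarrow> R < \<rho> \<longrightarrow> (\<forall>z. norm z > R \<longrightarrow> \<phi> z = 0) \<longrightarrow> continuous_on UNIV h \<longrightarrow>
      (\<forall>z. dird (y_part Y z) \<phi> z = (norm (y_part Y z))\<^sup>2 * h z) \<longrightarrow>
      (\<integral>z. G z * (lap \<phi> z + a * h z) \<partial>lebesgue_on (ball 0 1)) = 0)"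

lemma very_weak_on_weak_solution:
  fixes Y :: "'d::finite set"
  assumes "Y \<noteq> {}" "real (card Y) + a > 0" "weak_solution Y a u"
  shows "very_weak_on Y a 1 (\<lambda>z. weight Y a z * u z)"
  unfolding very_weak_on_def mult.assoc
  using very_weak[OF assms] by blast

lemma very_weak_on_classical:
  fixes Y :: "'d::finite set"
  assumes Y: "Y \<noteq> {}" and a: "real (card Y) + a > 0" and v: "smooth v" and hv: "continuous_on UNIV hv"
    and radv: "\<And>z. dird (y_part Y z) v z = (norm (y_part Y z))\<^sup>2 * hv z"
    and Lv: "\<And>z. norm z < \<rho> \<Longrightarrow> lap v z + a * hv z = 0" and \<rho>: "\<rho> \<le> 1"
  shows "very_weak_on Y a \<rho> (\<lambda>z. weight Y a z * v z)"
  unfolding very_weak_on_def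
proof (intro conjI allI impI)
  show "integrable (lebesgue_on (ball 0 1)) (\<lambda>z. weight Y a z * v z)"
    using integrable_ball_weight_mult[OF Y a smooth_continuous_on[OF v]] lebesgue_on_weight_iff(1)[OF smooth_borel[OF v]] by simp
  fix \<phi> h R
  assume \<phi>: "smooth \<phi>" and R: "R < \<rho>" and supp: "\<forall>z. norm z > R \<longrightarrow> \<phi> z = 0" and h: "continuous_on UNIV h"
    and rad: "\<forall>z. dird (y_part Y z) \<phi> z = (norm (y_part Y z))\<^sup>2 * h z"
  have "continuous_on UNIV (\<lambda>z. v z * (lap \<phi> z + a * h z))"
    by (intro continuous_intros smooth_continuous_on v smooth_lap \<phi> h)
  from borel_measurable_continuous_onI[OF this] R \<rho>
  show "(\<integral>z. weight Y a z * v z * (lap \<phi> z + a * h z) \<partial>lebesgue_on (ball 0 1)) = 0"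
    using classical_very_weak[OF Y a v hv radv _ \<phi> _ _ h, of R] supp rad Lv
    by (simp add: mult.assoc lebesgue_on_weight_iff(2))
qed

section \<open>Spherical means about points of the axis\<close>

text \<open>Up to a factor depending only on \<open>c\<close> and \<open>D\<close> this is \<open>\<integral>\<^sub>0\<^sup>c F t * t powr (D/2 - 1) dt\<close>.\<close>

definition pmass :: "real \<Rightarrow> (real \<Rightarrow> real) \<Rightarrow> real \<Rightarrow> real" where
  "pmass D F c = (\<integral>\<mu>. indicator {0..1} \<mu> * F (c * \<mu> powr (2 / D)) \<partial>lborel)"

lemma pmass_integrable:
  fixes D :: real and F :: "real \<Rightarrow> real"
  assumes "D > 0" "continuous_on UNIV F"
  shows "integrable lborel (\<lambda>\<mu>. indicator {0..1} \<mu> * F (c * \<mu> powr (2 / D)))"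
proof -
  have "continuous_on UNIV (\<lambda>z. F (c * z))"
    by (intro continuous_on_compose2[OF assms(2)] continuous_intros) auto
  moreover have "integrable lborel (indicator {0..1::real} :: real \<Rightarrow> real)" by simp
  ultimately show ?thesis
    by (intro integrable_mult_continuous[where Z="\<lambda>\<mu>. \<mu> powr (2 / D)" and S="{0..1}" and k="\<lambda>z. F (c * z)"])
      (use assms(1) in \<open>auto simp: powr_le1 indicator_eq_0_iff\<close>)
qed

lemma pmass_pos:
  assumes D: "D > 0" and c: "c > 0" and F: "continuous_on UNIV F" "\<And>t. F t \<ge> 0" "\<And>t. t < \<delta> \<Longrightarrow> F t > 0" and \<delta>: "\<delta> > 0"
  shows "pmass D F c > 0"
proof -
  let ?f = "\<lambda>\<mu>. indicator {0..1} \<mu> * F (c * \<mu> powr (2 / D))"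
  have nn: "pmass D F c \<ge> 0" unfolding pmass_def using F(2) by (intro integral_nonneg_AE) auto
  define s where "s = min 1 ((\<delta> / c) powr (D / 2))"
  have s: "s > 0" using c \<delta> by (simp add: s_def)
  have "pmass D F c \<noteq> 0"
  proof
    assume "pmass D F c = 0"
    then have "AE \<mu> in lborel. ?f \<mu> = 0"
      unfolding pmass_def using F(2) by (subst (asm) integral_nonneg_eq_0_iff_AE[OF pmass_integrable[OF D F(1)]]) auto
    then have "AE \<mu> in lborel. \<mu> \<notin> {0<..<s}"
    proof eventually_elim
      case (elim \<mu>)
      show ?case
      proof
        assume \<mu>: "\<mu> \<in> {0<..<s}"
        then have "\<mu> powr (2 / D) < ((\<delta> / c) powr (D / 2)) powr (2 / D)"
          using D by (intro powr_less_mono2) (auto simp: s_def)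
        also have "\<dots> = \<delta> / c" using D c \<delta> by (simp add: powr_powr)
        finally have "c * \<mu> powr (2 / D) < \<delta>" using c by (simp add: field_simps)
        then show False using elim \<mu> F(3)[of "c * \<mu> powr (2 / D)"] by (auto simp: s_def)
      qed
    qed
    then have "emeasure lborel {0<..<s} = 0" by (subst (asm) AE_iff_measurable[of "{0<..<s}"]) auto
    then show False using s by simp
  qed
  with nn show ?thesis by linarith
qed

lemma abs_diff_gt_square:
  fixes p q c :: real
  assumes "p > q + sqrt c" "c \<ge> 0" "q \<ge> 0" shows "(p - q)\<^sup>2 \<ge> c"
proof -
  have "sqrt c \<le> p - q" using assms by simp
  then have "(sqrt c)\<^sup>2 \<le> (p - q)\<^sup>2" by (rule power_mono) (simp add: assms)
  then show ?thesis using assms by simp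
qed

lemma very_weak_onD:
  assumes "very_weak_on Y a \<rho> G" "smooth \<phi>" "R < \<rho>" "\<And>z. norm z > R \<Longrightarrow> \<phi> z = 0" "continuous_on UNIV h"
    "\<And>z. dird (y_part Y z) \<phi> z = (norm (y_part Y z))\<^sup>2 * h z"
  shows "(\<integral>z. G z * (lap \<phi> z + a * h z) \<partial>lebesgue_on (ball 0 1)) = 0"
  using assms unfolding very_weak_on_def by blast

lemma id_lebesgue_on: "(\<lambda>z. z) \<in> borel_measurable (lebesgue_on S)"
  by (rule borel_measurable_lebesgue_onI) simp

lemma integrable_very_weak_radial:
  assumes "very_weak_on Y a \<rho> G" "profile c F"
  shows "integrable (lebesgue_on (ball 0 1)) (\<lambda>z. G z * F ((norm (z - \<xi>))\<^sup>2))"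
proof (rule integrable_mult_continuous[where Z="\<lambda>z. z" and S="cball 0 1"])
  show "integrable (lebesgue_on (ball 0 1)) G" using assms by (simp add: very_weak_on_def)
  show "continuous_on UNIV (\<lambda>z. F ((norm (z - \<xi>))\<^sup>2))"
    by (intro continuous_on_compose2[OF smooth_continuous_on[OF profile_smooth[OF assms(2)], of UNIV]] continuous_intros) auto
qed (auto intro: id_lebesgue_on)

text \<open>The combination \<open>H\<close> of the two profiles has zero mass, which is the
  solvability condition in \<open>euler_equation_profile\<close>. Hence \<open>4 * H\<close> is
  \<open>L\<close> applied to a radial function with profile \<open>P\<close>, where
  \<open>P\<close> is an antiderivative of the solution \<open>S\<close>. The test function is taken
  to be \<open>kern\<close> with \<open>w = \<xi>\<close>, a constant multiple of that radial
  function, so that \<open>kern_laplacian\<close> can be reused.\<close>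

lemma mean_ratio:
  fixes Y :: "'d::finite set"
  assumes Y: "Y \<noteq> {}" and a: "real (card Y) + a > 0" and G: "very_weak_on Y a \<rho> G"
    and \<xi>: "y_part Y \<xi> = 0" and c: "c > 0" and \<rho>: "norm \<xi> + sqrt c < \<rho>"
    and F1: "profile c F1" and F2: "profile c F2" and D: "D = real CARD('d) + a"
  shows "pmass D F1 c * (\<integral>z. G z * F2 ((norm (z - \<xi>))\<^sup>2) \<partial>lebesgue_on (ball 0 1))
     = pmass D F2 c * (\<integral>z. G z * F1 ((norm (z - \<xi>))\<^sup>2) \<partial>lebesgue_on (ball 0 1))"
proof -
  let ?\<mu> = "lebesgue_on (ball (0::real^'d) 1)"
  have "card Y \<le> CARD('d)" by (simp add: card_mono)
  then have D0: "D > 0" using a D by simp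
  define m where "m = real (card Y) + a"
  have m: "m > 0" using a by (simp add: m_def)
  define k1 k2 where "k1 = pmass D F1 c" and "k2 = pmass D F2 c"
  define H where "H t = k1 * F2 t - k2 * F1 t" for t
  have H: "profile c H" unfolding H_def by (intro profile_diff profile_mult F1 F2 smooth_const)
  note i = pmass_integrable[OF D0 smooth_continuous_on[OF profile_smooth[OF F1]], of c]
    pmass_integrable[OF D0 smooth_continuous_on[OF profile_smooth[OF F2]], of c]
  have "(\<integral>\<mu>. indicator {0..1} \<mu> * H (c * \<mu> powr (2/D)) \<partial>lborel)
     = (\<integral>\<mu>. k1 * (indicator {0..1} \<mu> * F2 (c * \<mu> powr (2/D))) - k2 * (indicator {0..1} \<mu> * F1 (c * \<mu> powr (2/D))) \<partial>lborel)"
    by (simp add: H_def algebra_simps)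
  also have "\<dots> = k1 * k2 - k2 * k1" using i by (simp add: k1_def k2_def pmass_def)
  finally have "(\<integral>\<mu>. indicator {0..1} \<mu> * H (c * \<mu> powr (2/D)) \<partial>lborel) = 0" by simp
  from euler_equation_profile[OF D0 c H this] obtain S where S: "profile c S" "\<And>t. t * deriv S t + D / 2 * S t = H t"
    by blast
  from profile_antideriv[OF S(1)] obtain P where P: "profile c P" "deriv P = S" by blast
  note Ps = profile_smooth[OF P(1)]
  let ?J = "m * cosint m (\<lambda>t. 1)"
  have J: "?J > 0" using m cosint_1_pos[OF m] by simp
  have k0: "kern Y m P (\<xi>, z) = 0" if "norm z > norm \<xi> + sqrt c" for z
    by (rule kern_zero[OF P(1)]) (rule abs_diff_gt_square, use that c in auto)
  have "(\<integral>z. G z * (lap (\<lambda>z. kern Y m P (\<xi>, z)) z + a * kern_h Y m P (\<xi>, z)) \<partial>?\<mu>) = 0"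
    by (rule very_weak_onD[OF G smooth_slice2[OF smooth_kern[OF m Ps]] \<rho> k0
          smooth_continuous_on[OF smooth_slice2[OF smooth_kern_h[OF m Ps]]] kern_radial[OF m Ps]])
  moreover have "lap (\<lambda>z. kern Y m P (\<xi>, z)) z + a * kern_h Y m P (\<xi>, z) = ?J * 4 * H ((norm (z - \<xi>))\<^sup>2)" for z
    using kern_laplacian[OF m Ps m_def[symmetric]] kern_on_axis(2)[OF m Ps \<xi>, of D z] S(2)[of "(norm (z - \<xi>))\<^sup>2", symmetric] P(2)
    by (simp add: D algebra_simps)
  ultimately have "(\<integral>z. ?J * 4 * (G z * H ((norm (z - \<xi>))\<^sup>2)) \<partial>?\<mu>) = 0" by (simp add: mult_ac)
  then have 0: "(\<integral>z. G z * H ((norm (z - \<xi>))\<^sup>2) \<partial>?\<mu>) = 0" using J by auto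
  note iG = integrable_very_weak_radial[OF G, of _ _ \<xi>]
  have "(\<integral>z. G z * H ((norm (z - \<xi>))\<^sup>2) \<partial>?\<mu>)
     = (\<integral>z. k1 * (G z * F2 ((norm (z - \<xi>))\<^sup>2)) - k2 * (G z * F1 ((norm (z - \<xi>))\<^sup>2)) \<partial>?\<mu>)"
    by (simp add: H_def algebra_simps)
  also have "\<dots> = k1 * (\<integral>z. G z * F2 ((norm (z - \<xi>))\<^sup>2) \<partial>?\<mu>) - k2 * (\<integral>z. G z * F1 ((norm (z - \<xi>))\<^sup>2) \<partial>?\<mu>)"
    using iG[OF F1] iG[OF F2] by simp
  finally show ?thesis using 0 by (simp add: k1_def k2_def)
qed

section \<open>Potentials of the kernel\<close>

lemma smooth_swap:
  fixes k :: "'a::euclidean_space \<times> 'b::euclidean_space \<Rightarrow> real"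
  assumes "smooth k" shows "smooth (\<lambda>e. k (snd e, fst e))"
proof (rule smooth_compose[OF assms])
  fix b :: "'a \<times> 'b"
  have "smooth (\<lambda>e::'b \<times> 'a. snd e \<bullet> fst b + fst e \<bullet> snd b)"
    by (intro smooth_add smooth_bounded_linear bounded_linear_inner_left_comp bounded_linear_fst bounded_linear_snd)
  then show "smooth (\<lambda>e. (snd e, fst e) \<bullet> b)" by (simp add: inner_prod_def)
qed

text \<open>Integrating the kernel against a very weak solution gives a classical one, because \<open>kern_L\<close> is symmetric:
  the operator acting on \<open>\<zeta>\<close> may be moved to \<open>z\<close>.\<close>

lemma kern_potential:
  fixes Y :: "'d::finite set"
  assumes Y: "Y \<noteq> {}" and a: "real (card Y) + a > 0" and G: "very_weak_on Y a 1 G"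
    and m_def: "m = real (card Y) + a" and F: "profile c F" and c: "c > 0" and \<rho>: "\<rho> + sqrt c < 1"
  defines "V \<equiv> \<lambda>w. \<integral>z. G z * kern Y m F (w, z) \<partial>lebesgue_on (ball 0 1)"
  shows "smooth V" and "very_weak_on Y a \<rho> (\<lambda>z. weight Y a z * (\<lambda>z. C * V z) z)"
proof -
  let ?\<mu> = "lebesgue_on (ball (0::real^'d) 1)"
  have m: "m > 0" using a m_def by simp
  note Fs = profile_smooth[OF F]
  note K = smooth_kern[OF m Fs, of Y]
  \<comment> \<open>The slots are exchanged: the derivative formulas for \<open>kern\<close> concern
    the second one, while parameter integrals are differentiated in the first.\<close>
  define k where "k e = kern Y m F (snd e, fst e)" for e :: "(real^'d) \<times> (real^'d)"
  have kk: "k (w, z) = kern Y m F (w, z)" for w z by (simp add: k_def kern_commute[of Y m F z])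
  have k: "smooth k" unfolding k_def by (rule smooth_swap[OF K])
  have iG: "integrable ?\<mu> G" using G by (simp add: very_weak_on_def)
  note par = iG id_lebesgue_on compact_cball[of 0 1]
  have supp: "w \<in> space ?\<mu> \<Longrightarrow> G w \<noteq> 0 \<Longrightarrow> w \<in> cball 0 1" for w by auto
  have V: "V = (\<lambda>w. \<integral>z. G z * k (w, z) \<partial>?\<mu>)" by (simp add: V_def kk)
  show sV: "smooth V" unfolding V by (rule smooth_param_integral[OF k par supp])
  have dV: "dird v V = (\<lambda>w. \<integral>z. G z * dird (v, 0) k (w, z) \<partial>?\<mu>)" for v
    unfolding V by (rule ext) (rule dird_param_integral[OF k par supp])
  have ddV: "dird v (dird v V) w = (\<integral>z. G z * dird (v, 0) (dird (v, 0) k) (w, z) \<partial>?\<mu>)" for v w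
    unfolding dV by (rule dird_param_integral[OF smooth_dird[OF k] par supp])
  have int: "integrable ?\<mu> (\<lambda>z. G z * f (w, z))" if "smooth f" for f :: "(real^'d) \<times> (real^'d) \<Rightarrow> real" and w
    by (rule integrable_mult_continuous[OF par supp smooth_continuous_on[OF smooth_slice2[OF that]]])
  define kh where "kh e = kern_h Y m F (snd e, fst e)" for e :: "(real^'d) \<times> (real^'d)"
  have kh: "smooth kh" unfolding kh_def by (rule smooth_swap[OF smooth_kern_h[OF m Fs]])
  define hV where "hV w = (\<integral>z. G z * kh (w, z) \<partial>?\<mu>)" for w
  have shV: "smooth hV" unfolding hV_def by (rule smooth_param_integral[OF kh par supp])
  have sl: "(\<lambda>w. k (w, z)) = (\<lambda>w. kern Y m F (z, w))" for z by (simp add: k_def)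
  have radV: "dird (y_part Y w) V w = (norm (y_part Y w))\<^sup>2 * hV w" for w
  proof -
    have "dird (y_part Y w, 0) k (w, z) = (norm (y_part Y w))\<^sup>2 * kh (w, z)" for z
      using dird_slice1[OF k, of "y_part Y w" z w] kern_radial[OF m Fs, of Y w z] by (simp add: sl kh_def)
    then have "dird (y_part Y w) V w = (\<integral>z. (norm (y_part Y w))\<^sup>2 * (G z * kh (w, z)) \<partial>?\<mu>)"
      by (simp add: dV mult.left_commute)
    then show ?thesis by (simp add: hV_def)
  qed
  have L: "lap V w + a * hV w = (\<integral>z. G z * kern_L Y (real CARD('d) + a) m F (w, z) \<partial>?\<mu>)" for w
  proof -
    have dd: "dird (v, 0) (dird (v, 0) k) (w, z) = dird v (dird v (\<lambda>w. kern Y m F (z, w))) w" for v z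
    proof -
      have "dird v (\<lambda>w. kern Y m F (z, w)) = (\<lambda>w. dird (v, 0) k (w, z))"
        unfolding sl[symmetric] by (rule ext) (rule dird_slice1[OF k])
      then show ?thesis by (simp add: dird_slice1[OF smooth_dird[OF k]])
    qed
    have "lap V w = (\<integral>z. (\<Sum>b\<in>Basis. G z * dird (b, 0) (dird (b, 0) k) (w, z)) \<partial>?\<mu>)"
      unfolding lap_def ddV
      by (rule Bochner_Integration.integral_sum[symmetric]) (intro int smooth_dird k)
    also have "\<dots> = (\<integral>z. G z * lap (\<lambda>w. kern Y m F (z, w)) w \<partial>?\<mu>)"
      by (simp add: lap_def dd sum_distrib_left)
    finally have 1: "lap V w = \<dots>" .
    have i1: "integrable ?\<mu> (\<lambda>z. G z * lap (\<lambda>w. kern Y m F (z, w)) w)"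
      using int[OF smooth_sum[of Basis "\<lambda>b. dird (b, 0) (dird (b, 0) k)"], of w] smooth_dird[OF smooth_dird[OF k]]
      by (simp add: lap_def dd)
    have "lap V w + a * hV w = (\<integral>z. G z * lap (\<lambda>w. kern Y m F (z, w)) w + a * (G z * kh (w, z)) \<partial>?\<mu>)"
      unfolding 1 hV_def using i1 int[OF kh, of w] by simp
    also have "\<dots> = (\<integral>z. G z * kern_L Y (real CARD('d) + a) m F (w, z) \<partial>?\<mu>)"
    proof (rule Bochner_Integration.integral_cong[OF refl])
      fix z
      have "lap (\<lambda>w. kern Y m F (z, w)) w + a * kh (w, z) = kern_L Y (real CARD('d) + a) m F (w, z)"
        using kern_laplacian[OF m Fs m_def[symmetric], of z w]
        by (simp add: kh_def kern_L_commute[of Y _ m F z])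
      then show "G z * lap (\<lambda>w. kern Y m F (z, w)) w + a * (G z * kh (w, z)) = G z * kern_L Y (real CARD('d) + a) m F (w, z)"
      proof -
        have "G z * lap (\<lambda>w. kern Y m F (z, w)) w + a * (G z * kh (w, z)) = G z * (lap (\<lambda>w. kern Y m F (z, w)) w + a * kh (w, z))"
          by (simp add: algebra_simps)
        then show ?thesis by (simp only: \<open>lap (\<lambda>w. kern Y m F (z, w)) w + a * kh (w, z) = _\<close>)
      qed
    qed
    finally show ?thesis .
  qed
  \<comment> \<open>Here \<open>z\<close> ranges over a support inside the ball of radius
    \<open>norm w + sqrt c < 1\<close>, so the kernel is an admissible test function in
    \<open>z\<close>; by \<open>L\<close>, the operator in \<open>w\<close> has already become the
    operator in \<open>z\<close>.\<close>
  have L0: "lap V w + a * hV w = 0" if w: "norm w < \<rho>" for w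
  proof -
    have k0: "kern Y m F (w, z) = 0" if "norm z > norm w + sqrt c" for z
      by (rule kern_zero[OF F]) (rule abs_diff_gt_square, use that c in auto)
    have w1: "norm w + sqrt c < 1" using w \<rho> by simp
    have "(\<integral>z. G z * (lap (\<lambda>z. kern Y m F (w, z)) z + a * kern_h Y m F (w, z)) \<partial>?\<mu>) = 0"
      by (rule very_weak_onD[OF G smooth_slice2[OF K] w1 k0
            smooth_continuous_on[OF smooth_slice2[OF smooth_kern_h[OF m Fs]]] kern_radial[OF m Fs]])
    then show ?thesis by (simp add: L kern_laplacian[OF m Fs m_def[symmetric]])
  qed
  have dC: "dird v (\<lambda>z. C * V z) = (\<lambda>z. C * dird v V z)" for v
    by (rule ext) (simp add: dird_mult[OF smooth_const sV] dird_const)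
  have dCC: "dird v (dird v (\<lambda>z. C * V z)) z = C * dird v (dird v V) z" for v z
    unfolding dC by (simp add: dird_mult[OF smooth_const smooth_dird[OF sV]] dird_const)
  show "very_weak_on Y a \<rho> (\<lambda>z. weight Y a z * (\<lambda>z. C * V z) z)"
  proof (rule very_weak_on_classical[OF Y a])
    show "smooth (\<lambda>z. C * V z)" by (intro smooth_mult smooth_const sV)
    show "continuous_on UNIV (\<lambda>z. C * hV z)" by (intro continuous_intros smooth_continuous_on shV)
    show "dird (y_part Y z) (\<lambda>z. C * V z) z = (norm (y_part Y z))\<^sup>2 * (C * hV z)" for z
      by (simp add: dC radV)
    show "lap (\<lambda>z. C * V z) z + a * (C * hV z) = 0" if "norm z < \<rho>" for z
    proof -
      have "lap (\<lambda>z. C * V z) z = C * lap V z" by (simp add: lap_def dCC sum_distrib_left)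
      then have "lap (\<lambda>z. C * V z) z + a * (C * hV z) = C * (lap V z + a * hV z)" by (simp add: algebra_simps)
      then show ?thesis using L0[OF that] by simp
    qed
    show "\<rho> \<le> 1" using \<rho> real_sqrt_ge_zero[of c] c by linarith
  qed
qed

section \<open>Normalisation and the mean value property\<close>

lemma kern_axially_symmetric:
  assumes "x_part Y w = x_part Y w'" "norm (y_part Y w) = norm (y_part Y w')"
  shows "kern Y m F (w, z) = kern Y m F (w', z)"
proof -
  have "dist2 Y (w, z) = dist2 Y (w', z)" "yprod Y (w, z) = yprod Y (w', z)"
    using assms by (simp_all add: dist2_def yprod_def norm2_split[of w Y] norm2_split[of w' Y])
  then show ?thesis by (simp add: kern_def transl_def)
qed

lemma weight_translate:
  assumes "y_part Y \<xi> = 0" shows "weight Y a (\<xi> + z) = weight Y a z"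
  using assms by (simp add: weight_def parts_add)

text \<open>Translations along the axis preserve the weight. The right-hand side does not contain
  \<open>\<xi>\<close>, so a single constant normalises the kernel for all centres.\<close>

lemma weight_mean_translate:
  fixes Y :: "'d::finite set"
  assumes \<xi>: "y_part Y \<xi> = 0" and F: "profile c F" and c: "c > 0" and \<rho>: "norm \<xi> + sqrt c < 1"
  shows "(\<integral>z. weight Y a z * F ((norm (z - \<xi>))\<^sup>2) \<partial>lebesgue_on (ball 0 1))
    = (\<integral>z. weight Y a z * F ((norm z)\<^sup>2) \<partial>lborel)"
proof -
  have cF: "continuous_on UNIV (\<lambda>z. F ((norm (z - w))\<^sup>2))" for w :: "real^'d"
    by (intro continuous_on_compose2[OF smooth_continuous_on[OF profile_smooth[OF F], of UNIV]] continuous_intros) auto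
  note mF = borel_measurable_continuous_onI[OF cF]
  have "(\<integral>z. weight Y a z * F ((norm (z - \<xi>))\<^sup>2) \<partial>lebesgue_on (ball 0 1))
     = (\<integral>z. ball_weight Y a z * F ((norm (z - \<xi>))\<^sup>2) \<partial>lborel)"
    by (rule lebesgue_on_weight_iff(2)[OF mF])
  also have "(\<lambda>z. ball_weight Y a z * F ((norm (z - \<xi>))\<^sup>2)) = (\<lambda>z. weight Y a z * F ((norm (z - \<xi>))\<^sup>2))"
  proof
    fix z :: "real^'d"
    have "F ((norm (z - \<xi>))\<^sup>2) = 0" if "norm z \<ge> 1"
    proof (rule profile_zero[OF F])
      have "sqrt c \<le> norm (z - \<xi>)" using norm_triangle_sub[of z \<xi>] that \<rho> by linarith
      then have "(sqrt c)\<^sup>2 \<le> (norm (z - \<xi>))\<^sup>2" by (rule power_mono) (use c in simp)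
      then show "c \<le> (norm (z - \<xi>))\<^sup>2" using c by simp
    qed
    then show "ball_weight Y a z * F ((norm (z - \<xi>))\<^sup>2) = weight Y a z * F ((norm (z - \<xi>))\<^sup>2)"
      by (cases "norm z < 1") (auto simp: ball_weight_def)
  qed
  also have "(\<integral>z. weight Y a z * F ((norm (z - \<xi>))\<^sup>2) \<partial>lborel)
     = (\<integral>z. weight Y a z * F ((norm (z - \<xi>))\<^sup>2) \<partial>distr lborel borel ((+) \<xi>))"
    by (simp add: lborel_distr_plus)
  also have "\<dots> = (\<integral>z. weight Y a (\<xi> + z) * F ((norm (\<xi> + z - \<xi>))\<^sup>2) \<partial>lborel)"
    by (rule integral_distr) (use mF[of \<xi>] in \<open>auto intro!: borel_measurable_times borel_measurable_weight\<close>)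
  finally show ?thesis by (simp add: weight_translate[OF \<xi>])
qed

lemma weight_mean_pos:
  fixes Y :: "'d::finite set"
  assumes Y: "Y \<noteq> {}" and a: "real (card Y) + a > 0" and F: "profile c F" "\<And>t. F t \<ge> 0" "\<And>t. t < c \<Longrightarrow> F t > 0"
    and c: "c > 0" "c < 1"
  shows "(\<integral>z. weight Y a z * F ((norm z)\<^sup>2) \<partial>lebesgue_on (ball 0 1)) > 0"
proof -
  have cF: "continuous_on UNIV (\<lambda>z::real^'d. F ((norm z)\<^sup>2))"
    by (intro continuous_on_compose2[OF smooth_continuous_on[OF profile_smooth[OF F(1)], of UNIV]] continuous_intros) auto
  have int: "integrable lborel (\<lambda>z. ball_weight Y a z * F ((norm z)\<^sup>2))" by (rule integrable_ball_weight_mult[OF Y a cF])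
  have nn: "(\<integral>z. ball_weight Y a z * F ((norm z)\<^sup>2) \<partial>lborel) \<ge> 0"
    by (intro integral_nonneg_AE) (auto simp: ball_weight_nonneg F(2))
  have "(\<integral>z. ball_weight Y a z * F ((norm z)\<^sup>2) \<partial>lborel) \<noteq> 0"
  proof
    assume "(\<integral>z. ball_weight Y a z * F ((norm z)\<^sup>2) \<partial>lborel) = 0"
    then have "AE z in lborel. ball_weight Y a z * F ((norm z)\<^sup>2) = 0"
      by (subst (asm) integral_nonneg_eq_0_iff_AE[OF int]) (auto simp: ball_weight_nonneg F(2))
    then have "AE z::real^'d in lborel. z \<notin> ball 0 (sqrt c)"
      using AE_y_part_nonzero[OF Y]
    proof eventually_elim
      case (elim z)
      show ?case
      proof
        assume z: "z \<in> ball 0 (sqrt c)"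
        have "(norm z)\<^sup>2 < (sqrt c)\<^sup>2" using z by (intro power_strict_mono) auto
        then have "F ((norm z)\<^sup>2) > 0" using F(3) c by simp
        have "sqrt c < 1" using c by simp
        moreover have "norm z < sqrt c" using z by simp
        ultimately have "norm z < 1" by linarith
        then have "ball_weight Y a z > 0" using elim(2) by (simp add: ball_weight_def weight_def)
        then show False using elim(1) F(3)[of "(norm z)\<^sup>2"] \<open>F ((norm z)\<^sup>2) > 0\<close> by simp
      qed
    qed
    then have "ball 0 (sqrt c) \<in> null_sets (lborel :: (real^'d) measure)"
      by (subst (asm) AE_iff_null_sets[symmetric]) auto
    then have "negligible (ball (0::real^'d) (sqrt c))"
      by (simp add: negligible_iff_null_sets null_sets_completionI)
    then show False using open_not_negligible[of "ball (0::real^'d) (sqrt c)"] c by simp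
  qed
  then show ?thesis using nn lebesgue_on_weight_iff(2)[OF borel_measurable_continuous_onI[OF cF], of Y a] by simp
qed


lemma very_weak_on_weight:
  fixes Y :: "'d::finite set"
  assumes "Y \<noteq> {}" "real (card Y) + a > 0"
  shows "very_weak_on Y a 1 (weight Y a)"
  using very_weak_on_classical[OF assms, of "\<lambda>_. 1" "\<lambda>_. 0" 1] by (simp add: dird_const[abs_def] lap_def)

text \<open>By \<open>mean_ratio\<close>, applied to \<open>v\<close> and to the constant 1, the
  quotient of the two means is the same for all profiles. For profiles concentrated near 0
  continuity forces it to be close to \<open>v \<xi>\<close>.\<close>

lemma mean_value:
  fixes Y :: "'d::finite set"
  assumes Y: "Y \<noteq> {}" and a: "real (card Y) + a > 0" and G: "very_weak_on Y a \<rho> (\<lambda>z. weight Y a z * v z)"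
    and v: "continuous_on UNIV v" and \<xi>: "y_part Y \<xi> = 0" and c: "c > 0" and \<rho>: "norm \<xi> + sqrt c < \<rho>" "\<rho> \<le> 1"
    and F: "profile c F" "\<And>t. F t \<ge> 0" "\<And>t. t < c \<Longrightarrow> F t > 0"
  shows "(\<integral>z. weight Y a z * v z * F ((norm (z - \<xi>))\<^sup>2) \<partial>lebesgue_on (ball 0 1))
     = v \<xi> * (\<integral>z. weight Y a z * F ((norm (z - \<xi>))\<^sup>2) \<partial>lebesgue_on (ball 0 1))"
proof -
  let ?\<mu> = "lebesgue_on (ball (0::real^'d) 1)"
  note G1 = very_weak_on_weight[OF Y a]
  define D where "D = real CARD('d) + a"
  have "card Y \<le> CARD('d)" by (simp add: card_mono)
  then have D0: "D > 0" using a D_def by simp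
  define A where "A F = (\<integral>z. weight Y a z * v z * F ((norm (z - \<xi>))\<^sup>2) \<partial>?\<mu>)" for F
  define Q where "Q F = (\<integral>z. weight Y a z * F ((norm (z - \<xi>))\<^sup>2) \<partial>?\<mu>)" for F
  have W0: "weight Y a z \<ge> 0" for z by (simp add: weight_def)
  have Q0: "Q F \<ge> 0" unfolding Q_def by (intro integral_nonneg_AE) (simp add: W0 F(2))
  have k1: "pmass D F c > 0"
    by (rule pmass_pos[OF D0 c smooth_continuous_on[OF profile_smooth[OF F(1)]] F(2,3) c])
  have est: "\<bar>A F - v \<xi> * Q F\<bar> \<le> \<epsilon> * Q F" if \<epsilon>: "\<epsilon> > 0" for \<epsilon>
  proof -
    have "isCont v \<xi>" using v by (simp add: continuous_on_eq_continuous_at)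
    then obtain \<delta> where \<delta>: "\<delta> > 0" "\<And>z. dist z \<xi> < \<delta> \<Longrightarrow> dist (v z) (v \<xi>) < \<epsilon>"
      using \<epsilon> unfolding continuous_at_eps_delta by (metis dist_commute)
    \<comment> \<open>A profile vanishing beyond \<open>c'\<close> sees only points with
      \<open>dist z \<xi> < \<delta>\<close>; the bound by \<open>c\<close> keeps it comparable with
      \<open>F\<close> in \<open>mean_ratio\<close>, which needs a common radius.\<close>
    define c' where "c' = min c (\<delta>\<^sup>2)"
    have c': "c' > 0" "c' \<le> c" using c \<delta>(1) by (auto simp: c'_def)
    obtain F' where F': "profile c' F'" "\<And>t. F' t \<ge> 0" "\<And>t. t < c' \<Longrightarrow> F' t > 0" using profile_bump[of c'] by blast
    note F'c = profile_mono[OF F'(1) c'(2)]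
    have k2: "pmass D F' c > 0"
      by (rule pmass_pos[OF D0 c smooth_continuous_on[OF profile_smooth[OF F'(1)]] F'(2,3) c'(1)])
    have iA: "integrable ?\<mu> (\<lambda>z. weight Y a z * v z * F' ((norm (z - \<xi>))\<^sup>2))"
      by (rule integrable_very_weak_radial[OF G F'(1)])
    have iQ: "integrable ?\<mu> (\<lambda>z. weight Y a z * F' ((norm (z - \<xi>))\<^sup>2))"
      by (rule integrable_very_weak_radial[OF G1 F'(1)])
    have "A F' - v \<xi> * Q F' = (\<integral>z. weight Y a z * v z * F' ((norm (z - \<xi>))\<^sup>2) - v \<xi> * (weight Y a z * F' ((norm (z - \<xi>))\<^sup>2)) \<partial>?\<mu>)"
      unfolding A_def Q_def using iA iQ by simp
    also have "\<bar>\<dots>\<bar> \<le> (\<integral>z. \<epsilon> * (weight Y a z * F' ((norm (z - \<xi>))\<^sup>2)) \<partial>?\<mu>)"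
    proof (rule order_trans[OF integral_abs_bound integral_mono])
      show "integrable ?\<mu> (\<lambda>z. \<bar>weight Y a z * v z * F' ((norm (z - \<xi>))\<^sup>2) - v \<xi> * (weight Y a z * F' ((norm (z - \<xi>))\<^sup>2))\<bar>)"
        using iA iQ by (intro integrable_abs Bochner_Integration.integrable_diff) auto
      show "integrable ?\<mu> (\<lambda>z. \<epsilon> * (weight Y a z * F' ((norm (z - \<xi>))\<^sup>2)))" using iQ by simp
      fix z
      let ?w = "weight Y a z * F' ((norm (z - \<xi>))\<^sup>2)"
      have w: "?w \<ge> 0" using W0 F'(2) by simp
      have "\<bar>weight Y a z * v z * F' ((norm (z - \<xi>))\<^sup>2) - v \<xi> * ?w\<bar> = \<bar>v z - v \<xi>\<bar> * ?w"
      proof -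
        have "weight Y a z * v z * F' ((norm (z - \<xi>))\<^sup>2) - v \<xi> * ?w = (v z - v \<xi>) * ?w" by (simp add: algebra_simps)
        then show ?thesis using abs_mult[of "v z - v \<xi>" ?w] abs_of_nonneg[OF w] by (simp only:)
      qed
      also have "\<dots> \<le> \<epsilon> * ?w"
      proof (cases "dist z \<xi> < \<delta>")
        case True
        from \<delta>(2)[OF this] show ?thesis using w by (intro mult_right_mono) (auto simp: dist_real_def)
      next
        case False
        then have "\<delta>\<^sup>2 \<le> (norm (z - \<xi>))\<^sup>2" using \<delta>(1) by (intro power_mono) (auto simp: dist_norm)
        then have "F' ((norm (z - \<xi>))\<^sup>2) = 0" by (intro profile_zero[OF F'(1)]) (simp add: c'_def)
        then show ?thesis by simp
      qed
      finally show "\<bar>weight Y a z * v z * F' ((norm (z - \<xi>))\<^sup>2) - v \<xi> * ?w\<bar> \<le> \<epsilon> * ?w" .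
    qed
    also have "\<dots> = \<epsilon> * Q F'" by (simp add: Q_def)
    finally have e: "\<bar>A F' - v \<xi> * Q F'\<bar> \<le> \<epsilon> * Q F'" .
    have rA: "pmass D F c * A F' = pmass D F' c * A F"
      unfolding A_def by (rule mean_ratio[OF Y a G \<xi> c \<rho>(1) F(1) F'c D_def])
    have \<rho>1: "norm \<xi> + sqrt c < 1" using \<rho> by linarith
    have rQ: "pmass D F c * Q F' = pmass D F' c * Q F"
      unfolding Q_def by (rule mean_ratio[OF Y a G1 \<xi> c \<rho>1 F(1) F'c D_def])
    have "pmass D F' c * (A F - v \<xi> * Q F) = pmass D F c * (A F' - v \<xi> * Q F')"
    proof -
      have "pmass D F' c * (A F - v \<xi> * Q F) = pmass D F' c * A F - v \<xi> * (pmass D F' c * Q F)" by (simp add: algebra_simps)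
      also have "\<dots> = pmass D F c * (A F' - v \<xi> * Q F')" unfolding rA[symmetric] rQ[symmetric] by (simp add: algebra_simps)
      finally show ?thesis .
    qed
    then have "pmass D F' c * \<bar>A F - v \<xi> * Q F\<bar> = pmass D F c * \<bar>A F' - v \<xi> * Q F'\<bar>"
      using k1 k2 by (metis abs_mult abs_of_pos)
    also have "\<dots> \<le> pmass D F c * (\<epsilon> * Q F')" using e k1 by (intro mult_left_mono) auto
    also have "\<dots> = pmass D F' c * (\<epsilon> * Q F)" using rQ by (metis mult.left_commute)
    finally show ?thesis using k2 by simp
  qed
  have "A F - v \<xi> * Q F = 0" using est Q0 by (rule eq_0_if_le_all_multiples)
  then show ?thesis by (simp add: A_def Q_def)
qed

text \<open>At axis points the kernel is \<open>J\<close> times its profile \<open>F1\<close>, so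
  \<open>v \<xi> * Q\<close> is the mean of \<open>u\<close> for \<open>F1\<close>; by
  \<open>mean_value\<close> it is also the mean of \<open>v\<close> for \<open>F1\<close>. Since
  \<open>F1\<close> has positive mass, \<open>mean_ratio\<close> carries the equality over to every
  profile.\<close>

lemma smooth_matching_means:
  fixes Y :: "'d::finite set" and u :: "real^'d \<Rightarrow> real"
  assumes Y: "Y \<noteq> {}" and a: "real (card Y) + a > 0" and u: "very_weak_on Y a 1 (\<lambda>z. weight Y a z * u z)"
    and R: "0 < R" "R < 1"
  shows "\<exists>v \<epsilon>. smooth v \<and> \<epsilon> > 0 \<and>
    (\<forall>w w'. x_part Y w = x_part Y w' \<longrightarrow> norm (y_part Y w) = norm (y_part Y w') \<longrightarrow> v w = v w') \<and>
    integrable (lebesgue_on (ball 0 1)) (\<lambda>z. weight Y a z * (u z - v z)) \<and>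
    (\<forall>\<xi> F. y_part Y \<xi> = 0 \<longrightarrow> norm \<xi> < \<epsilon> \<longrightarrow> profile (R\<^sup>2) F \<longrightarrow>
      (\<integral>z. weight Y a z * (u z - v z) * F ((norm (z - \<xi>))\<^sup>2) \<partial>lebesgue_on (ball 0 1)) = 0)"
proof -
  let ?\<mu> = "lebesgue_on (ball (0::real^'d) 1)"
  define m where "m = real (card Y) + a"
  have m: "m > 0" using a by (simp add: m_def)
  define D where "D = real CARD('d) + a"
  have "card Y \<le> CARD('d)" by (simp add: card_mono)
  then have D0: "D > 0" using a D_def by simp
  \<comment> \<open>The kernel has radius \<open>s\<close>, and \<open>\<rho> + s < 1\<close> makes
    \<open>v\<close> a solution in the ball of radius \<open>\<rho>\<close>. The radius
    \<open>C\<close> admits both \<open>F\<close> and \<open>F1\<close> as profiles, and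
    \<open>C + s < \<rho>\<close> leaves room for all centres with \<open>norm \<xi> < s\<close>;
    thus \<open>\<epsilon> = s\<close> in the end.\<close>
  define s where "s = (1 - R) / 4"
  define \<rho> where "\<rho> = (1 + R) / 2"
  define C where "C = max R s"
  have s: "s > 0" "s < 1" using R by (auto simp: s_def)
  have C: "C > 0" "R \<le> C" "s \<le> C" "C + s < \<rho>" "\<rho> \<le> 1" "\<rho> + s < 1"
    using R by (auto simp: C_def s_def \<rho>_def max_def field_simps)
  have s2: "s\<^sup>2 > 0" "s\<^sup>2 < 1" "sqrt (s\<^sup>2) = s" using s by (auto simp: power_less_one_iff)
  have C2: "C\<^sup>2 > 0" "sqrt (C\<^sup>2) = C" "R\<^sup>2 \<le> C\<^sup>2" "s\<^sup>2 \<le> C\<^sup>2" using C R s by (auto intro: power_mono)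
  obtain F1 where F1: "profile (s\<^sup>2) F1" "\<And>t. F1 t \<ge> 0" "\<And>t. t < s\<^sup>2 \<Longrightarrow> F1 t > 0" using profile_bump[of "s\<^sup>2"] by blast
  note F1s = profile_smooth[OF F1(1)]
  define J where "J = m * cosint m (\<lambda>t. 1)"
  have J: "J > 0" using m cosint_1_pos[OF m] by (simp add: J_def)
  define Q where "Q = (\<integral>z. weight Y a z * F1 ((norm z)\<^sup>2) \<partial>?\<mu>)"
  have Q: "Q > 0" unfolding Q_def by (rule weight_mean_pos[OF Y a F1 s2(1,2)])
  have Q\<xi>: "(\<integral>z. weight Y a z * F1 ((norm (z - \<xi>))\<^sup>2) \<partial>?\<mu>) = Q" if "y_part Y \<xi> = 0" "norm \<xi> < s" for \<xi>
  proof -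
    have "norm \<xi> + sqrt (s\<^sup>2) < 1" "norm (0::real^'d) + sqrt (s\<^sup>2) < 1"
      using that C s unfolding s2(3) by (auto simp: s_def)
    then show ?thesis
      using weight_mean_translate[OF that(1) F1(1) s2(1), where a=a] weight_mean_translate[OF parts_0(1)[of Y] F1(1) s2(1), where a=a]
      by (simp add: Q_def)
  qed
  define v where "v w = 1 / (J * Q) * (\<integral>z. weight Y a z * u z * kern Y m F1 (w, z) \<partial>?\<mu>)" for w
  have \<rho>s: "\<rho> + sqrt (s\<^sup>2) < 1" using C s2 by simp
  note pot = kern_potential[OF Y a u m_def F1(1) s2(1) \<rho>s]
  have sv: "smooth v" unfolding v_def by (rule smooth_mult[OF smooth_const pot(1)])
  have vv: "very_weak_on Y a \<rho> (\<lambda>z. weight Y a z * v z)" unfolding v_def by (rule pot(2))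
  have sym: "v w = v w'" if "x_part Y w = x_part Y w'" "norm (y_part Y w) = norm (y_part Y w')" for w w'
    by (simp add: v_def kern_axially_symmetric[OF that])
  have int: "integrable ?\<mu> (\<lambda>z. weight Y a z * (u z - v z))"
    using u vv by (simp add: very_weak_on_def right_diff_distrib)
  have main: "(\<integral>z. weight Y a z * (u z - v z) * F ((norm (z - \<xi>))\<^sup>2) \<partial>?\<mu>) = 0"
    if \<xi>: "y_part Y \<xi> = 0" "norm \<xi> < s" and F: "profile (R\<^sup>2) F" for \<xi> F
  proof -
    define U where "U F = (\<integral>z. weight Y a z * u z * F ((norm (z - \<xi>))\<^sup>2) \<partial>?\<mu>)" for F
    define A where "A F = (\<integral>z. weight Y a z * v z * F ((norm (z - \<xi>))\<^sup>2) \<partial>?\<mu>)" for F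
    note Fc = profile_mono[OF F C2(3)] and F1c = profile_mono[OF F1(1) C2(4)]
    have r: "norm \<xi> + sqrt (C\<^sup>2) < \<rho>" "norm \<xi> + sqrt (C\<^sup>2) < 1" "norm \<xi> + sqrt (s\<^sup>2) < \<rho>"
      using \<xi>(2) C unfolding C2(2) s2(3) by linarith+
    have "v \<xi> = 1 / (J * Q) * (J * U F1)"
    proof -
      have "(\<integral>z. weight Y a z * u z * kern Y m F1 (\<xi>, z) \<partial>?\<mu>) = (\<integral>z. J * (weight Y a z * u z * F1 ((norm (z - \<xi>))\<^sup>2)) \<partial>?\<mu>)"
        by (simp add: kern_on_axis(1)[OF m F1s \<xi>(1)] J_def mult_ac)
      then show ?thesis by (simp add: v_def U_def)
    qed
    then have "v \<xi> * Q = U F1" using J Q by simp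
    moreover have "A F1 = v \<xi> * Q"
      using mean_value[OF Y a vv smooth_continuous_on[OF sv] \<xi>(1) s2(1) r(3) C(5) F1] Q\<xi>[OF \<xi>]
      unfolding A_def by (simp only:)
    ultimately have e: "A F1 = U F1" by simp
    have k: "pmass D F1 (C\<^sup>2) > 0"
      by (rule pmass_pos[OF D0 C2(1) smooth_continuous_on[OF F1s] F1(2,3) s2(1)])
    have "pmass D F1 (C\<^sup>2) * U F = pmass D F (C\<^sup>2) * U F1"
      unfolding U_def by (rule mean_ratio[OF Y a u \<xi>(1) C2(1) r(2) F1c Fc D_def])
    moreover have "pmass D F1 (C\<^sup>2) * A F = pmass D F (C\<^sup>2) * A F1"
      unfolding A_def by (rule mean_ratio[OF Y a vv \<xi>(1) C2(1) r(1) F1c Fc D_def])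
    ultimately have "U F = A F" using k e by (metis less_irrefl mult_cancel_left)
    moreover have "(\<integral>z. weight Y a z * (u z - v z) * F ((norm (z - \<xi>))\<^sup>2) \<partial>?\<mu>) = U F - A F"
      unfolding U_def A_def
      using integrable_very_weak_radial[OF u F, of \<xi>] integrable_very_weak_radial[OF vv F, of \<xi>]
      by (simp add: right_diff_distrib left_diff_distrib)
    ultimately show ?thesis by simp
  qed
  show ?thesis using sv s(1) sym int main by blast
qed

section \<open>Rotations in two coordinates\<close>

definition shear :: "'d \<Rightarrow> 'd \<Rightarrow> real \<Rightarrow> real^'d::finite \<Rightarrow> real^'d" where
  "shear i j t z = z + (t * z $ j) *\<^sub>R axis i 1"

lemma borel_measurable_shear [measurable]: "shear i j t \<in> borel_measurable borel"
  unfolding shear_def[abs_def]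
  by (intro borel_measurable_continuous_onI continuous_intros)

text \<open>Fubini with the coordinate \<open>i\<close> innermost: there the shear is a translation
  by \<open>t * z $ j\<close>, which is constant in the inner integral.\<close>

lemma distr_shear:
  assumes "i \<noteq> j" shows "distr lborel borel (shear i j t) = (lborel :: (real^'d::finite) measure)"
proof (rule measure_eqI)
  interpret product_sigma_finite "\<lambda>_::real^'d. lborel :: real measure" by standard
  let ?b = "axis i 1 :: real^'d" and ?c = "axis j 1 :: real^'d"
  let ?B = "Basis - {?b}"
  let ?S = "\<lambda>f. \<Sum>b\<in>Basis. f b *\<^sub>R b"
  have bB: "Basis = insert ?b ?B" by (auto simp: Basis_vec_def)
  have ne: "?c \<noteq> ?b" using assms by (simp add: axis_eq_axis)
  have m: "?S \<in> borel_measurable (\<Pi>\<^sub>M b\<in>Basis. lborel)"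
    by (intro borel_measurable_sum borel_measurable_scaleR) measurable
  have upd: "?S (x(?b := y)) = y *\<^sub>R ?b + (\<Sum>b\<in>?B. x b *\<^sub>R b)" for x y
    by (subst bB, subst sum.insert) (auto intro!: sum.cong)
  fix A assume "A \<in> sets (distr lborel borel (shear i j t))"
  then have A [measurable]: "A \<in> sets borel" by simp
  have key: "(\<integral>\<^sup>+z. F z \<partial>lborel) = (\<integral>\<^sup>+x. \<integral>\<^sup>+y. F (y *\<^sub>R ?b + (\<Sum>b\<in>?B. x b *\<^sub>R b)) \<partial>lborel \<partial>(\<Pi>\<^sub>M b\<in>?B. lborel))"
    if F [measurable]: "F \<in> borel_measurable borel" for F :: "real^'d \<Rightarrow> ennreal"
  proof -
    have mF: "(\<lambda>x. F (?S x)) \<in> borel_measurable (\<Pi>\<^sub>M b\<in>insert ?b ?B. lborel)"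
      using measurable_compose[OF m F] bB by simp
    have "(\<integral>\<^sup>+z. F z \<partial>lborel) = (\<integral>\<^sup>+x. F (?S x) \<partial>(\<Pi>\<^sub>M b\<in>Basis. lborel))"
      by (subst lborel_eq, subst nn_integral_distr[OF m]) auto
    also have "\<dots> = (\<integral>\<^sup>+x. F (?S x) \<partial>(\<Pi>\<^sub>M b\<in>insert ?b ?B. lborel))" using bB by simp
    also have "\<dots> = (\<integral>\<^sup>+x. \<integral>\<^sup>+y. F (?S (x(?b := y))) \<partial>lborel \<partial>(\<Pi>\<^sub>M b\<in>?B. lborel))"
      by (rule product_nn_integral_insert[OF _ _ mF]) auto
    finally show ?thesis by (simp only: upd)
  qed
  have sh: "shear i j t (y *\<^sub>R ?b + (\<Sum>b\<in>?B. x b *\<^sub>R b)) = (t * x ?c + 1 * y) *\<^sub>R ?b + (\<Sum>b\<in>?B. x b *\<^sub>R b)" for x y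
  proof -
    have "(y *\<^sub>R ?b + (\<Sum>b\<in>?B. x b *\<^sub>R b)) $ j = ?S (x(?b := y)) \<bullet> ?c"
      by (simp only: upd[symmetric]) (simp add: inner_axis)
    also have "\<dots> = (x(?b := y)) ?c" by (rule inner_sum_left_Basis) (auto simp: Basis_vec_def)
    finally have "(y *\<^sub>R ?b + (\<Sum>b\<in>?B. x b *\<^sub>R b)) $ j = x ?c" using ne by simp
    then show ?thesis unfolding shear_def by (simp add: algebra_simps)
  qed
  have "emeasure (distr lborel borel (shear i j t)) A = (\<integral>\<^sup>+z. indicator A (shear i j t z) \<partial>lborel)"
    by (subst nn_integral_indicator[symmetric], simp, subst nn_integral_distr) auto
  also have "\<dots> = (\<integral>\<^sup>+x. \<integral>\<^sup>+y. indicator A (shear i j t (y *\<^sub>R ?b + (\<Sum>b\<in>?B. x b *\<^sub>R b))) \<partial>lborel \<partial>(\<Pi>\<^sub>M b\<in>?B. lborel))"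
    by (rule key) measurable
  also have "\<dots> = (\<integral>\<^sup>+x. \<integral>\<^sup>+y. indicator A (y *\<^sub>R ?b + (\<Sum>b\<in>?B. x b *\<^sub>R b)) \<partial>lborel \<partial>(\<Pi>\<^sub>M b\<in>?B. lborel))"
  proof (rule nn_integral_cong)
    fix x
    have "(\<lambda>y. indicator A (y *\<^sub>R ?b + (\<Sum>b\<in>?B. x b *\<^sub>R b)) :: ennreal) \<in> borel_measurable borel" by measurable
    from nn_integral_real_affine[OF this, of 1 "t * x ?c"]
    show "(\<integral>\<^sup>+y. indicator A (shear i j t (y *\<^sub>R ?b + (\<Sum>b\<in>?B. x b *\<^sub>R b))) \<partial>lborel) =
        (\<integral>\<^sup>+y. indicator A (y *\<^sub>R ?b + (\<Sum>b\<in>?B. x b *\<^sub>R b)) \<partial>lborel)"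
      unfolding sh by simp
  qed
  also have "\<dots> = (\<integral>\<^sup>+z. indicator A z \<partial>lborel)" by (rule key[symmetric]) measurable
  finally show "emeasure (distr lborel borel (shear i j t)) A = emeasure lborel A" by simp
qed simp

text \<open>The rotation by \<open>\<theta>\<close> with \<open>tan (\<theta>/2) = \<tau>\<close>, written so that it visibly preserves Lebesgue measure.\<close>

definition rot :: "'d \<Rightarrow> 'd \<Rightarrow> real \<Rightarrow> real^'d::finite \<Rightarrow> real^'d" where
  "rot i j \<tau> z = shear i j (- \<tau>) (shear j i (2 * \<tau> / (1 + \<tau>\<^sup>2)) (shear i j (- \<tau>) z))"

lemma borel_measurable_rot [measurable]: "rot i j \<tau> \<in> borel_measurable borel"
  unfolding rot_def[abs_def] by measurable

lemma distr_rot: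
  assumes "i \<noteq> j" shows "distr lborel borel (rot i j \<tau>) = (lborel :: (real^'d::finite) measure)"
proof -
  have "distr lborel borel (rot i j \<tau>) = distr (distr (distr lborel borel (shear i j (- \<tau>))) borel
     (shear j i (2 * \<tau> / (1 + \<tau>\<^sup>2)))) borel (shear i j (- \<tau>))"
    by (simp add: distr_distr rot_def[abs_def] comp_def)
  then show ?thesis using assms by (simp add: distr_shear)
qed

text \<open>With \<open>q = (1 + \<tau>\<^sup>2) powr -1\<close> the rotation has cosine
  \<open>1 - 2 * \<tau>\<^sup>2 * q\<close> and sine \<open>2 * \<tau> * q\<close>. The inverse is
  written with \<open>powr\<close> so that \<open>smooth_powr\<close> applies.\<close>

lemma rot_eq:
  fixes z :: "real^'d::finite"
  assumes "i \<noteq> j"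
  shows "rot i j \<tau> z = z + (- 2 * \<tau> * (1 + \<tau>\<^sup>2) powr -1 * z $ j - 2 * \<tau>\<^sup>2 * (1 + \<tau>\<^sup>2) powr -1 * z $ i) *\<^sub>R axis i 1
     + (2 * \<tau> * (1 + \<tau>\<^sup>2) powr -1 * z $ i - 2 * \<tau>\<^sup>2 * (1 + \<tau>\<^sup>2) powr -1 * z $ j) *\<^sub>R axis j 1"
proof -
  have pos: "1 + \<tau>\<^sup>2 > 0" by (simp add: add_pos_nonneg)
  define q where "q = (1 + \<tau>\<^sup>2) powr -1"
  have q: "q = 1 / (1 + \<tau>\<^sup>2)" using pos by (simp add: q_def powr_minus_divide)
  have q1: "q * (1 + \<tau>\<^sup>2) = 1" using pos by (simp add: q)
  then have q2: "q * \<tau>\<^sup>2 = 1 - q" by (simp add: algebra_simps)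
  have c1: "(shear i j (- \<tau>) z) $ i = z $ i - \<tau> * z $ j" "(shear i j (- \<tau>) z) $ j = z $ j"
    using assms by (auto simp: shear_def axis_def)
  have "rot i j \<tau> z = z + (- \<tau> * z $ j - \<tau> * (z $ j + 2 * \<tau> * q * (z $ i - \<tau> * z $ j))) *\<^sub>R axis i 1
     + (2 * \<tau> * q * (z $ i - \<tau> * z $ j)) *\<^sub>R axis j 1"
  proof -
    have "2 * \<tau> / (1 + \<tau>\<^sup>2) = 2 * \<tau> * q" by (simp add: q)
    then show ?thesis using assms unfolding rot_def by (simp add: vec_eq_iff shear_def axis_def algebra_simps)
  qed
  moreover have "- \<tau> * z $ j - \<tau> * (z $ j + 2 * \<tau> * q * (z $ i - \<tau> * z $ j)) = - 2 * \<tau> * q * z $ j - 2 * \<tau>\<^sup>2 * q * z $ i"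
  proof -
    have "- \<tau> * z $ j - \<tau> * (z $ j + 2 * \<tau> * q * (z $ i - \<tau> * z $ j))
      = - 2 * \<tau> * z $ j - 2 * \<tau>\<^sup>2 * q * z $ i + 2 * \<tau> * z $ j * (q * \<tau>\<^sup>2)" by (simp add: algebra_simps power2_eq_square)
    then show ?thesis unfolding q2 by (simp add: algebra_simps)
  qed
  moreover have "2 * \<tau> * q * (z $ i - \<tau> * z $ j) = 2 * \<tau> * q * z $ i - 2 * \<tau>\<^sup>2 * q * z $ j"
    by (simp add: algebra_simps power2_eq_square)
  ultimately show ?thesis by (simp only: q_def)
qed

lemma rot_nth:
  assumes "i \<noteq> j"
  defines "q \<equiv> \<lambda>\<tau>. (1 + \<tau>\<^sup>2) powr -1"
  shows "rot i j \<tau> z $ k = (if k = i then z $ i - 2 * \<tau> * q \<tau> * z $ j - 2 * \<tau>\<^sup>2 * q \<tau> * z $ i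
     else if k = j then z $ j + 2 * \<tau> * q \<tau> * z $ i - 2 * \<tau>\<^sup>2 * q \<tau> * z $ j else z $ k)"
  using assms(1) by (auto simp: rot_eq[OF assms(1)] axis_def q_def)

lemma rot_parts:
  fixes z :: "real^'d::finite"
  assumes "i \<noteq> j" "i \<in> Y" "j \<in> Y"
  shows "x_part Y (rot i j \<tau> z) = x_part Y z" "norm (y_part Y (rot i j \<tau> z)) = norm (y_part Y z)"
proof -
  show x: "x_part Y (rot i j \<tau> z) = x_part Y z"
    using assms by (auto simp: vec_eq_iff x_part_def rot_nth[OF assms(1)])
  define q where "q = (1 + \<tau>\<^sup>2) powr -1"
  have pos: "1 + \<tau>\<^sup>2 > 0" by (simp add: add_pos_nonneg)
  have q: "q * (1 + \<tau>\<^sup>2) = 1" using pos by (simp add: q_def powr_minus_divide)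
  have s: "(norm (y_part Y w))\<^sup>2 = (w $ i)\<^sup>2 + (w $ j)\<^sup>2 + (\<Sum>k\<in>Y - {i, j}. (w $ k)\<^sup>2)" for w :: "real^'d"
  proof -
    have "(norm (y_part Y w))\<^sup>2 = (\<Sum>k\<in>UNIV. if k \<in> Y then (w $ k)\<^sup>2 else 0)"
      unfolding power2_norm_eq_inner inner_vec_sum by (rule sum.cong) (auto simp: y_part_def power2_eq_square)
    also have "\<dots> = (\<Sum>k\<in>Y. (w $ k)\<^sup>2)" by (simp add: sum.If_cases)
    also have "\<dots> = (w $ j)\<^sup>2 + (\<Sum>k\<in>Y - {j}. (w $ k)\<^sup>2)" using assms by (intro sum.remove) auto
    also have "(\<Sum>k\<in>Y - {j}. (w $ k)\<^sup>2) = (w $ i)\<^sup>2 + (\<Sum>k\<in>Y - {j} - {i}. (w $ k)\<^sup>2)"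
      using assms by (intro sum.remove) auto
    also have "Y - {j} - {i} = Y - {i, j}" by auto
    finally show ?thesis by simp
  qed
  have e: "(A - 2 * \<tau> * q * B - 2 * \<tau>\<^sup>2 * q * A)\<^sup>2 + (B + 2 * \<tau> * q * A - 2 * \<tau>\<^sup>2 * q * B)\<^sup>2 = A\<^sup>2 + B\<^sup>2" for A B
  proof -
    have "(A - 2 * \<tau> * q * B - 2 * \<tau>\<^sup>2 * q * A)\<^sup>2 + (B + 2 * \<tau> * q * A - 2 * \<tau>\<^sup>2 * q * B)\<^sup>2
      = (A\<^sup>2 + B\<^sup>2) * (1 + 4 * \<tau>\<^sup>2 * q * (q * (1 + \<tau>\<^sup>2) - 1))" by algebra
    then show ?thesis unfolding q by simp
  qed
  have "(norm (y_part Y (rot i j \<tau> z)))\<^sup>2 = (norm (y_part Y z))\<^sup>2"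
    unfolding s using assms e[of "z $ i" "z $ j"]
    by (auto simp: rot_nth[OF assms(1)] q_def intro!: sum.cong)
  then show "norm (y_part Y (rot i j \<tau> z)) = norm (y_part Y z)" by simp
qed

lemma norm_rot:
  assumes "i \<noteq> j" shows "norm (rot i j \<tau> z) = norm z"
proof -
  have "(norm (rot i j \<tau> z))\<^sup>2 = (norm z)\<^sup>2"
    unfolding norm2_split[of "rot i j \<tau> z" UNIV] norm2_split[of z UNIV]
    by (simp only: rot_parts[OF assms UNIV_I UNIV_I])
  then show ?thesis by simp
qed

lemma smooth_vec_compose:
  fixes f :: "real^'d::finite \<Rightarrow> real" and g :: "'a::real_normed_vector \<Rightarrow> real^'d"
  assumes "smooth f" "\<And>k. smooth (\<lambda>x. g x $ k)" shows "smooth (\<lambda>x. f (g x))"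
  by (rule smooth_compose[OF assms(1)]) (auto simp: Basis_vec_def inner_axis assms(2))

text \<open>Differentiating the rotation invariance of \<open>\<integral> g \<phi>\<close> at the identity.\<close>

lemma rotation_identity:
  fixes g \<phi> :: "real^'d::finite \<Rightarrow> real"
  assumes ij: "i \<noteq> j" and g: "integrable lborel g" and supp: "\<And>z. g z \<noteq> 0 \<Longrightarrow> norm z \<le> 1"
    and inv: "\<And>\<tau>. AE z in lborel. g (rot i j \<tau> z) = g z" and \<phi>: "smooth \<phi>"
  shows "(\<integral>z. g z * (z $ i * dird (axis j 1) \<phi> z - z $ j * dird (axis i 1) \<phi> z) \<partial>lborel) = 0"
proof -
  have [measurable]: "g \<in> borel_measurable borel" using g by auto
  have [measurable]: "\<phi> \<in> borel_measurable borel" by (rule smooth_borel[OF \<phi>])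
  let ?k = "\<lambda>p :: real \<times> (real^'d). \<phi> (rot i j (fst p) (snd p))"
  have co: "smooth (\<lambda>p :: real \<times> (real^'d). snd p $ l)" for l
    by (intro smooth_bounded_linear bounded_linear_compose[OF bounded_linear_vec_nth bounded_linear_snd])
  have sq: "smooth (\<lambda>p :: real \<times> (real^'d). (1 + (fst p)\<^sup>2) powr -1)"
    by (intro smooth_powr smooth_add smooth_power smooth_const smooth_bounded_linear bounded_linear_fst)
      (simp add: add_pos_nonneg)
  have k: "smooth ?k"
  proof (rule smooth_vec_compose[OF \<phi>])
    fix l
    have "smooth (\<lambda>p :: real \<times> (real^'d). snd p $ i - 2 * fst p * (1 + (fst p)\<^sup>2) powr -1 * snd p $ j - 2 * (fst p)\<^sup>2 * (1 + (fst p)\<^sup>2) powr -1 * snd p $ i)"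
      "smooth (\<lambda>p :: real \<times> (real^'d). snd p $ j + 2 * fst p * (1 + (fst p)\<^sup>2) powr -1 * snd p $ i - 2 * (fst p)\<^sup>2 * (1 + (fst p)\<^sup>2) powr -1 * snd p $ j)"
      by (intro smooth_add smooth_diff smooth_mult smooth_power smooth_const co sq smooth_bounded_linear bounded_linear_fst)+
    then show "smooth (\<lambda>p :: real \<times> (real^'d). rot i j (fst p) (snd p) $ l)"
      using co[of l] unfolding rot_nth[OF ij] by (cases "l = i"; cases "l = j") (simp_all only: if_True if_False simp_thms)
  qed
  let ?I = "\<lambda>\<tau>. \<integral>z. g z * ?k (\<tau>, z) \<partial>lborel"
  have D: "(?I has_derivative (\<lambda>s. \<integral>z. g z * dird (s, 0) ?k (0, z) \<partial>lborel)) (at 0)"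
    by (rule has_derivative_param_integral[OF k g _ compact_cball[of 0 1], where Z="\<lambda>z. z"]) (use supp in auto)
  have const: "?I \<tau> = (\<integral>z. g z * \<phi> z \<partial>lborel)" for \<tau>
  proof -
    have "?I \<tau> = (\<integral>z. g (rot i j \<tau> z) * \<phi> (rot i j \<tau> z) \<partial>lborel)"
      by (rule integral_cong_AE) (use inv[of \<tau>] in \<open>auto elim!: eventually_mono\<close>)
    also have "\<dots> = (\<integral>z. g z * \<phi> z \<partial>distr lborel borel (rot i j \<tau>))"
      by (rule integral_distr[symmetric]) measurable
    finally show ?thesis by (simp add: distr_rot[OF ij])
  qed
  have "(?I has_derivative (\<lambda>_. 0)) (at 0)" unfolding const by (rule has_derivative_const)
  from has_derivative_unique[OF D this] have 0: "(\<integral>z. g z * dird (1, 0) ?k (0, z) \<partial>lborel) = 0"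
    by meson
  \<comment> \<open>The factor 2 is the derivative of the angle \<open>2 * arctan \<tau>\<close> at
    0.\<close>
  have "dird (1, 0) ?k (0, z) = 2 * (z $ i * dird (axis j 1) \<phi> z - z $ j * dird (axis i 1) \<phi> z)" for z
  proof -
    let ?a = "\<lambda>\<tau>::real. - 2 * \<tau> * (1 + \<tau>\<^sup>2) powr -1 * z $ j - 2 * \<tau>\<^sup>2 * (1 + \<tau>\<^sup>2) powr -1 * z $ i"
    let ?b = "\<lambda>\<tau>::real. 2 * \<tau> * (1 + \<tau>\<^sup>2) powr -1 * z $ i - 2 * \<tau>\<^sup>2 * (1 + \<tau>\<^sup>2) powr -1 * z $ j"
    have da: "(?a has_real_derivative - 2 * z $ j) (at 0)"
      by (auto intro!: derivative_eq_intros)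
    have db: "(?b has_real_derivative 2 * z $ i) (at 0)"
      by (auto intro!: derivative_eq_intros)
    have dr: "((\<lambda>\<tau>. rot i j \<tau> z) has_derivative (\<lambda>s. (s * (- 2 * z $ j)) *\<^sub>R axis i 1 + (s * (2 * z $ i)) *\<^sub>R axis j 1)) (at 0)"
    proof -
      have "(?a has_derivative (\<lambda>s. s * (- 2 * z $ j))) (at 0)"
        by (rule has_derivative_eq_rhs[OF da[unfolded has_field_derivative_def]]) (simp add: fun_eq_iff)
      moreover have "(?b has_derivative (\<lambda>s. s * (2 * z $ i))) (at 0)"
        by (rule has_derivative_eq_rhs[OF db[unfolded has_field_derivative_def]]) (simp add: fun_eq_iff)
      ultimately show ?thesis
        unfolding rot_eq[OF ij]
        by (intro has_derivative_eq_rhs[OF has_derivative_add[OF has_derivative_add[OF has_derivative_const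
              has_derivative_scaleR_left] has_derivative_scaleR_left]]) (auto simp: fun_eq_iff)
    qed
    have r0: "rot i j 0 z = z" by (simp add: rot_eq[OF ij])
    have "((\<lambda>\<tau>. \<phi> (rot i j \<tau> z)) has_derivative (\<lambda>s. dird ((s * (- 2 * z $ j)) *\<^sub>R axis i 1 + (s * (2 * z $ i)) *\<^sub>R axis j 1) \<phi> z)) (at 0)"
      using has_derivative_compose[OF dr smooth_has_derivative[OF \<phi>]] by (simp add: r0)
    from dird_eqI[OF this, of 1]
    have "dird 1 (\<lambda>\<tau>. ?k (\<tau>, z)) 0 = dird ((1 * (- 2 * z $ j)) *\<^sub>R axis i 1 + (1 * (2 * z $ i)) *\<^sub>R axis j 1) \<phi> z"
      by simp
    also have "\<dots> = 2 * (z $ i * dird (axis j 1) \<phi> z - z $ j * dird (axis i 1) \<phi> z)"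
      unfolding linear_add[OF dird_linear[OF \<phi>]] linear_scale[OF dird_linear[OF \<phi>]] by simp
    finally show ?thesis using dird_slice1[OF k, of 1 z 0] by simp
  qed
  then have "(\<integral>z. 2 * (g z * (z $ i * dird (axis j 1) \<phi> z - z $ j * dird (axis i 1) \<phi> z)) \<partial>lborel) = 0"
    using 0 by (simp add: mult.left_commute)
  then show ?thesis by simp
qed

section \<open>Uniqueness from means\<close>

definition mon :: "('d \<Rightarrow> nat) \<Rightarrow> real^'d::finite \<Rightarrow> real" where
  "mon \<alpha> z = (\<Prod>k\<in>UNIV. z $ k ^ \<alpha> k)"

definition up :: "('d \<Rightarrow> nat) \<Rightarrow> 'd \<Rightarrow> 'd \<Rightarrow> nat" where
  "up \<alpha> i = \<alpha>(i := Suc (\<alpha> i))"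

lemma mon_split: "mon \<alpha> z = z $ i ^ \<alpha> i * (\<Prod>k\<in>UNIV - {i}. z $ k ^ \<alpha> k)"
  unfolding mon_def by (rule prod.remove) auto

lemma mon_up: "mon (up \<alpha> i) z = z $ i * mon \<alpha> z"
proof -
  have "(\<Prod>k\<in>UNIV - {i}. z $ k ^ up \<alpha> i k) = (\<Prod>k\<in>UNIV - {i}. z $ k ^ \<alpha> k)"
    by (rule prod.cong) (auto simp: up_def)
  then show ?thesis by (simp add: mon_split[of _ z i] up_def)
qed

lemma smooth_nth: "smooth (\<lambda>z::real^'d::finite. z $ k)"
  by (rule smooth_bounded_linear[OF bounded_linear_vec_nth])

lemma smooth_prod:
  fixes f :: "'i \<Rightarrow> 'a::real_normed_vector \<Rightarrow> real"
  shows "(\<And>i. i \<in> I \<Longrightarrow> smooth (f i)) \<Longrightarrow> smooth (\<lambda>x. \<Prod>i\<in>I. f i x)"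
  by (induction I rule: infinite_finite_induct) auto

lemma smooth_mon: "smooth (mon \<alpha>)"
  unfolding mon_def[abs_def] by (intro smooth_prod smooth_power smooth_nth)

lemma dird_line:
  fixes f :: "'a::euclidean_space \<Rightarrow> real"
  assumes "smooth f" "((\<lambda>t. f (x + t *\<^sub>R v)) has_real_derivative d) (at 0)"
  shows "dird v f x = d"
proof -
  have "((\<lambda>t. x + t *\<^sub>R v) has_derivative (\<lambda>s. s *\<^sub>R v)) (at 0)" by (auto intro!: derivative_eq_intros)
  from has_derivative_compose[OF this smooth_has_derivative[OF assms(1)]]
  have "dird 1 (\<lambda>t. f (x + t *\<^sub>R v)) 0 = dird v f x" using dird_eqI by fastforce
  moreover have "dird 1 (\<lambda>t. f (x + t *\<^sub>R v)) 0 = d"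
    using dird_eqI[OF assms(2)[unfolded has_field_derivative_def], of 1] by simp
  ultimately show ?thesis by simp
qed

text \<open>For \<open>\<alpha> i = 0\<close> the truncated subtraction leaves the exponent 0, but
  the coefficient is 0 as well.\<close>

lemma dird_mon:
  "dird (axis i 1) (mon \<alpha>) z = real (\<alpha> i) * mon (\<alpha>(i := \<alpha> i - 1)) z"
proof (rule dird_line[OF smooth_mon])
  let ?P = "\<Prod>k\<in>UNIV - {i}. z $ k ^ \<alpha> k"
  have "mon \<alpha> (z + t *\<^sub>R axis i 1) = (z $ i + t) ^ \<alpha> i * ?P" for t
  proof -
    have "(\<Prod>k\<in>UNIV - {i}. (z + t *\<^sub>R axis i 1) $ k ^ \<alpha> k) = ?P"
      by (rule prod.cong) (auto simp: axis_def)
    then show ?thesis by (simp add: mon_split[of \<alpha> _ i])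
  qed
  moreover have "mon (\<alpha>(i := \<alpha> i - 1)) z = z $ i ^ (\<alpha> i - 1) * ?P"
  proof -
    have "(\<Prod>k\<in>UNIV - {i}. z $ k ^ (\<alpha>(i := \<alpha> i - 1)) k) = ?P" by (rule prod.cong) auto
    then show ?thesis by (simp add: mon_split[of _ z i])
  qed
  moreover have "((\<lambda>t. (z $ i + t) ^ \<alpha> i * ?P) has_real_derivative real (\<alpha> i) * (z $ i ^ (\<alpha> i - 1) * ?P)) (at 0)"
    by (auto intro!: derivative_eq_intros)
  ultimately show "((\<lambda>t. mon \<alpha> (z + t *\<^sub>R axis i 1)) has_real_derivative real (\<alpha> i) * mon (\<alpha>(i := \<alpha> i - 1)) z) (at 0)"
    by simp
qed

lemma norm2_sum: "(norm (v::real^'d::finite))\<^sup>2 = (\<Sum>k\<in>UNIV. (v $ k)\<^sup>2)"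
  unfolding power2_norm_eq_inner inner_vec_sum by (simp add: power2_eq_square)

lemma smooth_radial:
  fixes F :: "real \<Rightarrow> real" and \<xi> :: "real^'d::finite"
  assumes "smooth F" shows "smooth (\<lambda>z. F ((norm (z - \<xi>))\<^sup>2))"
  unfolding norm2_sum vector_minus_component
  by (intro smooth_compose_real[OF assms] smooth_sum smooth_power smooth_diff smooth_nth smooth_const)

lemma dird_radial:
  fixes F :: "real \<Rightarrow> real" and \<xi> :: "real^'d::finite"
  assumes F: "smooth F"
  shows "dird v (\<lambda>z. F ((norm (z - \<xi>))\<^sup>2)) z = deriv F ((norm (z - \<xi>))\<^sup>2) * (2 * ((z - \<xi>) \<bullet> v))"
proof -
  have "((\<lambda>z. (norm (z - \<xi>))\<^sup>2) has_derivative (\<lambda>v. 2 * ((z - \<xi>) \<bullet> v))) (at z)"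
    unfolding power2_norm_eq_inner by (auto intro!: derivative_eq_intros simp: inner_commute)
  from dird_eqI[OF has_derivative_compose[OF this smooth_DERIV[OF F, unfolded has_field_derivative_def]]]
  show ?thesis by simp
qed

text \<open>The positive and negative parts of \<open>f\<close> are densities of finite measures.
  They agree on closed sets, whose indicators are limits of the continuous functions
  \<open>max 0 (1 - n * infdist z K)\<close>, and closed sets form a generator stable under
  intersection.\<close>

lemma AE_zero_of_continuous_integrals:
  fixes f :: "'a::euclidean_space \<Rightarrow> real"
  assumes f: "integrable lborel f" and z: "\<And>h. continuous_on UNIV h \<Longrightarrow> (\<integral>z. f z * h z \<partial>lborel) = 0"
  shows "AE z in lborel. f z = 0"
proof -
  have [measurable]: "f \<in> borel_measurable borel" using f by auto
  have closed: "(\<integral>z. f z * indicator K z \<partial>lborel) = 0" if K: "closed K" for K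
  proof (cases "K = {}")
    case False
    define h where "h n z = max 0 (1 - real n * infdist z K)" for n z
    have ch: "continuous_on UNIV (h n)" for n unfolding h_def by (intro continuous_intros)
    have [measurable]: "K \<in> sets borel" using K by simp
    have [measurable]: "h n \<in> borel_measurable borel" for n by (rule borel_measurable_continuous_onI[OF ch])
    have "(\<lambda>n. \<integral>z. f z * h n z \<partial>lborel) \<longlonglongrightarrow> (\<integral>z. f z * indicator K z \<partial>lborel)"
    proof (rule integral_dominated_convergence)
      show "integrable lborel (\<lambda>z. \<bar>f z\<bar>)" using f by simp
      show "AE z in lborel. norm (f z * h n z) \<le> \<bar>f z\<bar>" for n
      proof (rule AE_I2)
        fix z
        have "\<bar>h n z\<bar> \<le> 1" by (simp add: h_def infdist_nonneg)
        then show "norm (f z * h n z) \<le> \<bar>f z\<bar>" by (simp add: abs_mult mult_left_le)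
      qed
      show "AE z in lborel. (\<lambda>n. f z * h n z) \<longlonglongrightarrow> f z * indicator K z"
      proof (rule AE_I2)
        fix z
        have "(\<lambda>n. h n z) \<longlonglongrightarrow> indicator K z"
        proof (cases "z \<in> K")
          case True
          then show ?thesis by (simp add: h_def)
        next
          case out: False
          then have d: "infdist z K > 0"
            using in_closed_iff_infdist_zero[OF K False, of z] infdist_nonneg[of z K] by linarith
          obtain N :: nat where N: "1 / infdist z K \<le> real N" using real_arch_simple by blast
          have "h n z = 0" if "n \<ge> N" for n
          proof -
            have "1 \<le> real N * infdist z K" using N d by (simp add: field_simps)
            also have "\<dots> \<le> real n * infdist z K" using that d by (intro mult_right_mono) auto
            finally show ?thesis by (simp add: h_def)
          qed
          then have "eventually (\<lambda>n. h n z = 0) sequentially" using eventually_sequentially by blast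
          then show ?thesis using out by (simp add: tendsto_eventually)
        qed
        then show "(\<lambda>n. f z * h n z) \<longlonglongrightarrow> f z * indicator K z" by (intro tendsto_intros)
      qed
    qed measurable
    then have "(\<lambda>n::nat. 0) \<longlonglongrightarrow> (\<integral>z. f z * indicator K z \<partial>lborel)" by (simp only: z[OF ch])
    then show ?thesis using LIMSEQ_unique[OF _ tendsto_const] by blast
  qed simp
  have em: "emeasure (density lborel (\<lambda>z. ennreal (f z))) K = emeasure (density lborel (\<lambda>z. ennreal (- f z))) K
    \<and> emeasure (density lborel (\<lambda>z. ennreal (f z))) K < \<infinity>" if K: "closed K" for K
  proof -
    have [measurable]: "K \<in> sets borel" using K by simp
    have i: "integrable lborel (\<lambda>z. f z * indicator K z)"
      by (rule Bochner_Integration.integrable_bound[OF f]) (auto simp: indicator_def)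
    have e: "emeasure (density lborel (\<lambda>z. ennreal (s * f z))) K = (\<integral>\<^sup>+z. ennreal (s * (f z * indicator K z)) \<partial>lborel)" for s
      by (subst emeasure_density) (auto intro!: nn_integral_cong simp: indicator_def)
    obtain r q where rq: "0 \<le> r" "0 \<le> q" "(\<integral>\<^sup>+z. ennreal (f z * indicator K z) \<partial>lborel) = ennreal r"
       "(\<integral>\<^sup>+z. ennreal (- (f z * indicator K z)) \<partial>lborel) = ennreal q" "(\<integral>z. f z * indicator K z \<partial>lborel) = r - q"
      by (rule integrableE[OF i]) (rule that)
    then show ?thesis using closed[OF K] e[of 1] e[of "-1"] by simp
  qed
  have "density lborel (\<lambda>z. ennreal (f z)) = density lborel (\<lambda>z. ennreal (- f z))"
  proof (rule measure_eqI_generator_eq[where E="Collect closed" and \<Omega>=UNIV and A="\<lambda>_. UNIV"])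
    show "Int_stable (Collect closed :: 'a set set)" by (auto simp: Int_stable_def)
    show "sets (density lborel (\<lambda>z. ennreal (f z))) = sigma_sets UNIV (Collect closed)"
      by (simp add: borel_eq_closed sets_measure_of_conv)
    show "sets (density lborel (\<lambda>z. ennreal (- f z))) = sigma_sets UNIV (Collect closed)"
      by (simp add: borel_eq_closed sets_measure_of_conv)
    show "emeasure (density lborel (\<lambda>z. ennreal (f z))) X = emeasure (density lborel (\<lambda>z. ennreal (- f z))) X"
      if "X \<in> Collect closed" for X using em[of X] that by simp
    show "emeasure (density lborel (\<lambda>z. ennreal (f z))) UNIV \<noteq> \<infinity>"
      using conjunct2[OF em[OF closed_UNIV]] by (rule less_imp_neq)
  qed auto
  then have "AE z in lborel. ennreal (f z) = ennreal (- f z)"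
    by (intro sigma_finite_measure.density_unique) (auto intro: sigma_finite_lborel)
  then show ?thesis
  proof eventually_elim
    case (elim z)
    then show ?case by (cases "f z \<ge> 0") (auto simp: ennreal_neg ennreal_eq_0_iff)
  qed
qed

lemma AE_zero_of_monomial_integrals:
  fixes f :: "real^'d::finite \<Rightarrow> real"
  assumes f: "integrable lborel f" and supp: "\<And>z. f z \<noteq> 0 \<Longrightarrow> norm z \<le> 1"
    and mon: "\<And>\<alpha>. (\<integral>z. f z * mon \<alpha> z \<partial>lborel) = 0"
  shows "AE z in lborel. f z = 0"
proof (rule AE_zero_of_continuous_integrals[OF f])
  have int: "integrable lborel (\<lambda>z. f z * h z)" if "continuous_on UNIV h" for h
    by (rule integrable_mult_continuous[OF f _ compact_cball[of 0 1] _ that, where Z="\<lambda>z. z"]) (use supp in auto)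
  \<comment> \<open>Asking for all monomials at once makes \<open>N\<close> stable under
    multiplication by a coordinate, hence by any polynomial, so that the product case of the
    induction on \<open>real_polynomial_function\<close> goes through. Stone-Weierstrass does the
    rest.\<close>
  define N where "N = {h. continuous_on UNIV h \<and> (\<forall>\<alpha>. (\<integral>z. f z * (h z * mon \<alpha> z) \<partial>lborel) = 0)}"
  have cm: "continuous_on UNIV (mon \<alpha>)" for \<alpha> :: "'d \<Rightarrow> nat" by (rule smooth_continuous_on[OF smooth_mon])
  have add: "(\<lambda>z. p z + q z) \<in> N" if "p \<in> N" "q \<in> N" for p q
  proof -
    have "(\<integral>z. f z * ((p z + q z) * mon \<alpha> z) \<partial>lborel) = (\<integral>z. f z * (p z * mon \<alpha> z) \<partial>lborel) + (\<integral>z. f z * (q z * mon \<alpha> z) \<partial>lborel)" for \<alpha>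
      using that cm by (subst Bochner_Integration.integral_add[symmetric]) (auto simp: N_def algebra_simps intro!: int continuous_intros)
    then show ?thesis using that by (auto simp: N_def intro!: continuous_intros)
  qed
  have scale: "(\<lambda>z. p z * c) \<in> N" if "p \<in> N" for p c
  proof -
    have "(\<integral>z. f z * (p z * c * mon \<alpha> z) \<partial>lborel) = c * (\<integral>z. f z * (p z * mon \<alpha> z) \<partial>lborel)" for \<alpha>
      by (subst integral_mult_right_zero[symmetric]) (simp add: mult_ac)
    then show ?thesis using that by (auto simp: N_def intro!: continuous_intros)
  qed
  have nth: "(\<lambda>z. p z * z $ i) \<in> N" if "p \<in> N" for p i
  proof -
    have "(\<lambda>z. f z * (p z * z $ i * mon \<alpha> z)) = (\<lambda>z. f z * (p z * mon (up \<alpha> i) z))" for \<alpha>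
      by (simp add: mon_up mult.assoc)
    then have "(\<integral>z. f z * (p z * z $ i * mon \<alpha> z) \<partial>lborel) = 0" for \<alpha>
      using that by (simp add: N_def)
    then show ?thesis using that by (auto simp: N_def intro!: continuous_intros)
  qed
  have sum: "(\<lambda>z. \<Sum>i\<in>I. p i z) \<in> N" if "finite I" "\<And>i. i \<in> I \<Longrightarrow> p i \<in> N" for I :: "'d set" and p
    using that
  proof (induction I rule: finite_induct)
    case empty
    then show ?case by (simp add: N_def)
  next
    case (insert i I)
    then have "(\<lambda>z. p i z + (\<Sum>i\<in>I. p i z)) \<in> N" by (intro add) auto
    then show ?case using insert by simp
  qed
  have poly: "\<forall>p\<in>N. (\<lambda>z. p z * r z) \<in> N" if "real_polynomial_function r" for r
    using that
  proof (induction r rule: real_polynomial_function.induct)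
    case (linear r)
    have "r z = (\<Sum>i\<in>UNIV. z $ i * r (axis i 1))" for z
    proof -
      have "z = (\<Sum>i\<in>UNIV. z $ i *\<^sub>R axis i 1)" by (simp add: vec_eq_iff axis_def if_distrib cong: if_cong)
      then have "r z = r (\<Sum>i\<in>UNIV. z $ i *\<^sub>R axis i 1)" by simp
      also have "\<dots> = (\<Sum>i\<in>UNIV. z $ i * r (axis i 1))"
        using bounded_linear.linear[OF linear] by (simp add: linear_sum linear_scale)
      finally show ?thesis .
    qed
    then have "(\<lambda>z. p z * r z) = (\<lambda>z. \<Sum>i\<in>UNIV. p z * z $ i * r (axis i 1))" for p
      by (metis (no_types, lifting) mult.assoc sum.cong sum_distrib_left)
    then show ?case by (auto intro!: sum scale nth)
  next
    case (const c)
    then show ?case using scale by auto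
  next
    case (add p q)
    then show ?case by (auto simp: distrib_left intro!: \<open>\<And>p q. p \<in> N \<Longrightarrow> q \<in> N \<Longrightarrow> (\<lambda>z. p z + q z) \<in> N\<close>)
  next
    case (mult p q)
    then show ?case by (auto simp: mult.assoc[symmetric])
  qed
  have one: "(\<lambda>z. 1) \<in> N" using mon by (simp add: N_def)
  have P: "(\<integral>z. f z * r z \<partial>lborel) = 0" if "real_polynomial_function r" for r
  proof -
    have "(\<lambda>z. 1 * r z) \<in> N" using poly[OF that] one by (rule bspec)
    then have "(\<integral>z. f z * (1 * r z * mon (\<lambda>_. 0) z) \<partial>lborel) = 0" unfolding N_def by blast
    then show ?thesis by (simp add: mon_def)
  qed
  fix h :: "real^'d \<Rightarrow> real" assume h: "continuous_on UNIV h"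
  have "\<bar>\<integral>z. f z * h z \<partial>lborel\<bar> \<le> e * (\<integral>z. \<bar>f z\<bar> \<partial>lborel)" if e: "e > 0" for e
  proof -
    obtain r where r: "real_polynomial_function r" "\<And>z. z \<in> cball 0 1 \<Longrightarrow> \<bar>h z - r z\<bar> < e"
      by (rule Stone_Weierstrass_real_polynomial_function[OF compact_cball continuous_on_subset[OF h subset_UNIV] e]) (rule that)
    have cr: "continuous_on UNIV r" using r(1) continuous_real_polymonial_function
      by (auto intro: continuous_at_imp_continuous_on)
    have "(\<integral>z. f z * h z \<partial>lborel) = (\<integral>z. f z * h z - f z * r z \<partial>lborel)"
      using int[OF h] int[OF cr] P[OF r(1)] by simp
    also have "\<bar>\<dots>\<bar> \<le> (\<integral>z. e * \<bar>f z\<bar> \<partial>lborel)"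
    proof (rule order_trans[OF integral_abs_bound integral_mono])
      show "integrable lborel (\<lambda>z. \<bar>f z * h z - f z * r z\<bar>)" using int[OF h] int[OF cr] by auto
      show "integrable lborel (\<lambda>z. e * \<bar>f z\<bar>)" using f by auto
      fix z
      show "\<bar>f z * h z - f z * r z\<bar> \<le> e * \<bar>f z\<bar>"
      proof (cases "f z = 0")
        case False
        then have "\<bar>h z - r z\<bar> \<le> e" using r(2)[of z] supp[of z] by auto
        then have "\<bar>f z\<bar> * \<bar>h z - r z\<bar> \<le> \<bar>f z\<bar> * e" by (rule mult_left_mono) simp
        then show ?thesis by (simp add: abs_mult[symmetric] right_diff_distrib mult.commute)
      qed simp
    qed
    finally show ?thesis by simp
  qed
  then show "(\<integral>z. f z * h z \<partial>lborel) = 0" by (rule eq_0_if_le_all_multiples) (auto intro!: integral_nonneg_AE)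
qed

text \<open>All moments of \<open>g F\<close> vanish: a factor \<open>x\<^sub>i\<close> is produced by differentiating in \<open>\<xi>\<^sub>i\<close>, a factor \<open>\<bar>y\<bar>\<^sup>2\<close> by replacing
  \<open>F t\<close> with \<open>t F t\<close>, and the rotations reduce a single factor \<open>y\<^sub>i\<close> to \<open>\<bar>y\<bar>\<^sup>2\<close> times a monomial of lower degree, which
  needs a second direction in \<open>Y\<close>.\<close>

lemma axial_uniqueness:
  fixes Y :: "'d::finite set" and g :: "real^'d \<Rightarrow> real"
  assumes Y: "2 \<le> card Y" and g: "integrable lborel g" and supp: "\<And>z. g z \<noteq> 0 \<Longrightarrow> norm z \<le> 1"
    and inv: "\<And>i j \<tau>. i \<in> Y \<Longrightarrow> j \<in> Y \<Longrightarrow> i \<noteq> j \<Longrightarrow> AE z in lborel. g (rot i j \<tau> z) = g z"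
    and \<epsilon>: "\<epsilon> > 0"
    and means: "\<And>\<xi> F. y_part Y \<xi> = 0 \<Longrightarrow> norm \<xi> < \<epsilon> \<Longrightarrow> profile c F \<Longrightarrow>
      (\<integral>z. g z * F ((norm (z - \<xi>))\<^sup>2) \<partial>lborel) = 0"
  shows "AE z in lborel. (norm z)\<^sup>2 < c \<longrightarrow> g z = 0"
proof -
  have int: "integrable lborel (\<lambda>z. g z * h z)" if "smooth h" for h
    by (rule integrable_mult_continuous[OF g _ compact_cball[of 0 1] _ smooth_continuous_on[OF that], where Z="\<lambda>z. z"])
      (use supp in auto)
  have srad: "smooth (\<lambda>z. mon \<alpha> z * F ((norm (z - \<xi>))\<^sup>2))" if "profile c F" for \<alpha> F \<xi>
    by (intro smooth_mult smooth_mon smooth_radial profile_smooth[OF that])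
  define L where "L F \<xi> \<alpha> = (\<integral>z. g z * (mon \<alpha> z * F ((norm (z - \<xi>))\<^sup>2)) \<partial>lborel)" for F \<xi> \<alpha>
  \<comment> \<open>All centres near 0 and all profiles are quantified together: \<open>Zx\<close>
    differentiates in \<open>\<xi>\<close>, and both \<open>Zx\<close> and \<open>Zy\<close> change
    the profile.\<close>
  define Z where "Z \<alpha> \<longleftrightarrow> (\<forall>\<xi> F. y_part Y \<xi> = 0 \<longrightarrow> norm \<xi> < \<epsilon> \<longrightarrow> profile c F \<longrightarrow> L F \<xi> \<alpha> = 0)" for \<alpha>
  have ZD: "L F \<xi> \<alpha> = 0" if "Z \<alpha>" "y_part Y \<xi> = 0" "norm \<xi> < \<epsilon>" "profile c F" for \<alpha> \<xi> F
    using that unfolding Z_def by blast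
  have Z0: "Z (\<lambda>_. 0)" using means by (simp add: Z_def L_def mon_def)
  have Zx: "Z (up \<alpha> i)" if \<alpha>: "Z \<alpha>" and i: "i \<notin> Y" for \<alpha> i
    unfolding Z_def
  proof (intro allI impI)
    fix \<xi> G assume \<xi>: "y_part Y \<xi> = 0" "norm \<xi> < \<epsilon>" and G: "profile c G"
    \<comment> \<open>Differentiating \<open>F ((norm (z - \<xi>))\<^sup>2)\<close> in \<xi>_i
      produces the derivative of \<open>F\<close> times -2 (z_i - \<xi>_i); starting from an
      antiderivative of \<open>G\<close> leaves \<open>G\<close> itself. As
      \<open>i \<notin> Y\<close>, the shifted centres stay on the axis.\<close>
    obtain F where F: "profile c F" "deriv F = G" using profile_antideriv[OF G] by blast
    note Fs = profile_smooth[OF F(1)]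
    let ?k = "\<lambda>p :: real \<times> (real^'d). mon \<alpha> (snd p) * F ((norm (snd p - (\<xi> + fst p *\<^sub>R axis i 1)))\<^sup>2)"
    have co: "smooth (\<lambda>p :: real \<times> (real^'d). snd p $ l)" for l
      by (intro smooth_bounded_linear bounded_linear_compose[OF bounded_linear_vec_nth bounded_linear_snd])
    have "smooth (\<lambda>p :: real \<times> (real^'d). (snd p - (\<xi> + fst p *\<^sub>R axis i 1)) $ l)" for l
      unfolding vector_minus_component vector_add_component vector_scaleR_component real_scaleR_def
      by (intro smooth_diff smooth_add smooth_mult smooth_const co smooth_bounded_linear bounded_linear_fst)
    then have k: "smooth ?k" unfolding norm2_sum
      by (intro smooth_mult smooth_compose_real[OF Fs] smooth_sum smooth_power smooth_vec_compose[OF smooth_mon] co)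
    have D: "((\<lambda>t. \<integral>z. g z * ?k (t, z) \<partial>lborel) has_derivative (\<lambda>s. \<integral>z. g z * dird (s, 0) ?k (0, z) \<partial>lborel)) (at 0)"
      by (rule has_derivative_param_integral[OF k g _ compact_cball[of 0 1], where Z="\<lambda>z. z"]) (use supp in auto)
    have zero: "(\<integral>z. g z * ?k (t, z) \<partial>lborel) = 0" if t: "\<bar>t\<bar> < \<epsilon> - norm \<xi>" for t
    proof -
      have "y_part Y (\<xi> + t *\<^sub>R axis i 1) = 0"
      proof -
        have "y_part Y (t *\<^sub>R axis i 1) = 0" using i by (auto simp: vec_eq_iff y_part_def axis_def)
        then show ?thesis using \<xi>(1) by (simp add: parts_add)
      qed
      moreover have "norm (\<xi> + t *\<^sub>R axis i 1) < \<epsilon>"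
        using norm_triangle_ineq[of \<xi> "t *\<^sub>R axis i 1"] t by simp
      ultimately show ?thesis using ZD[OF \<alpha> _ _ F(1)] by (simp add: L_def)
    qed
    have "((\<lambda>t. \<integral>z. g z * ?k (t, z) \<partial>lborel) has_derivative (\<lambda>_. 0)) (at 0)"
      by (rule has_derivative_transform_within_open[OF has_derivative_const[of 0], where s="{- (\<epsilon> - norm \<xi>)<..<\<epsilon> - norm \<xi>}"])
        (use zero \<xi>(2) in auto)
    from has_derivative_unique[OF D this] have "(\<integral>z. g z * dird (1, 0) ?k (0, z) \<partial>lborel) = 0" by meson
    moreover have "dird (1, 0) ?k (0, z) = - 2 * (mon (up \<alpha> i) z * G ((norm (z - \<xi>))\<^sup>2) - \<xi> $ i * (mon \<alpha> z * G ((norm (z - \<xi>))\<^sup>2)))" for z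
    proof -
      have "((\<lambda>t. (norm (z - (\<xi> + t *\<^sub>R axis i 1)))\<^sup>2) has_derivative (\<lambda>s. - 2 * ((z - \<xi>) \<bullet> axis i 1) * s)) (at 0)"
        unfolding power2_norm_eq_inner by (auto intro!: derivative_eq_intros simp: inner_commute algebra_simps)
      from dird_eqI[OF has_derivative_mult_right[OF has_derivative_compose[OF this smooth_DERIV[OF Fs, unfolded has_field_derivative_def]]], of 1]
      have "dird 1 (\<lambda>t. ?k (t, z)) 0 = mon \<alpha> z * (G ((norm (z - \<xi>))\<^sup>2) * (- 2 * (z $ i - \<xi> $ i)))"
        by (simp add: F(2) inner_axis)
      moreover have "dird (1, 0) ?k (0, z) = dird 1 (\<lambda>t. ?k (t, z)) 0" by (rule dird_slice1[OF k, symmetric])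
      ultimately show ?thesis by (simp add: mon_up algebra_simps)
    qed
    ultimately have "(\<integral>z. - 2 * (g z * (mon (up \<alpha> i) z * G ((norm (z - \<xi>))\<^sup>2)) - \<xi> $ i * (g z * (mon \<alpha> z * G ((norm (z - \<xi>))\<^sup>2)))) \<partial>lborel) = 0"
      by (simp add: algebra_simps)
    then have "- 2 * (L G \<xi> (up \<alpha> i) - \<xi> $ i * L G \<xi> \<alpha>) = 0"
      unfolding L_def using int[OF srad[OF G, of "up \<alpha> i" \<xi>]] int[OF srad[OF G, of \<alpha> \<xi>]] by simp
    then show "L G \<xi> (up \<alpha> i) = 0" using ZD[OF \<alpha> \<xi> G] by simp
  qed
  \<comment> \<open>The profile \<open>t * F t\<close> inserts the factor |z - \<xi>|^2. Expanding
    it, the contributions of x vanish by \<open>Zx\<close>, and only the factor |y|^2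
    survives.\<close>
  have Zy: "(\<Sum>j\<in>Y. L F \<xi> (up (up \<alpha> j) j)) = 0"
    if \<alpha>: "Z \<alpha>" and \<xi>: "y_part Y \<xi> = 0" "norm \<xi> < \<epsilon>" and F: "profile c F" for \<alpha> \<xi> F
  proof -
    have F': "profile c (\<lambda>t. t * F t)" by (intro profile_mult F smooth_bounded_linear bounded_linear_ident)
    let ?M = "\<lambda>\<beta> z. g z * (mon \<beta> z * F ((norm (z - \<xi>))\<^sup>2))"
    note iM = int[OF srad[OF F]]
    have \<xi>Y: "\<xi> $ j = 0" if "j \<in> Y" for j
      using \<xi>(1) that by (auto simp: vec_eq_iff y_part_def split: if_splits)
    have pt: "g z * (mon \<alpha> z * ((norm (z - \<xi>))\<^sup>2 * F ((norm (z - \<xi>))\<^sup>2)))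
      = (\<Sum>j\<in>Y. ?M (up (up \<alpha> j) j) z) + (\<Sum>i\<in>- Y. ?M (up (up \<alpha> i) i) z - 2 * \<xi> $ i * ?M (up \<alpha> i) z + (\<xi> $ i)\<^sup>2 * ?M \<alpha> z)" for z
    proof -
      have "(norm (z - \<xi>))\<^sup>2 = (\<Sum>k\<in>Y. (z $ k)\<^sup>2) + (\<Sum>k\<in>- Y. (z $ k - \<xi> $ k)\<^sup>2)"
      proof -
        have "(norm (z - \<xi>))\<^sup>2 = (\<Sum>k\<in>Y \<union> - Y. (z $ k - \<xi> $ k)\<^sup>2)" by (simp add: norm2_sum)
        also have "\<dots> = (\<Sum>k\<in>Y. (z $ k - \<xi> $ k)\<^sup>2) + (\<Sum>k\<in>- Y. (z $ k - \<xi> $ k)\<^sup>2)"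
          by (rule sum.union_disjoint) auto
        finally show ?thesis using \<xi>Y by simp
      qed
      then have "g z * (mon \<alpha> z * ((norm (z - \<xi>))\<^sup>2 * F ((norm (z - \<xi>))\<^sup>2)))
        = (\<Sum>k\<in>Y. (z $ k)\<^sup>2 * ?M \<alpha> z) + (\<Sum>k\<in>- Y. (z $ k - \<xi> $ k)\<^sup>2 * ?M \<alpha> z)"
        by (simp add: sum_distrib_right[symmetric] distrib_right[symmetric])
      also have "(\<Sum>k\<in>Y. (z $ k)\<^sup>2 * ?M \<alpha> z) = (\<Sum>j\<in>Y. ?M (up (up \<alpha> j) j) z)"
        by (rule sum.cong) (auto simp: mon_up power2_eq_square)
      also have "(\<Sum>k\<in>- Y. (z $ k - \<xi> $ k)\<^sup>2 * ?M \<alpha> z)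
          = (\<Sum>i\<in>- Y. ?M (up (up \<alpha> i) i) z - 2 * \<xi> $ i * ?M (up \<alpha> i) z + (\<xi> $ i)\<^sup>2 * ?M \<alpha> z)"
        by (rule sum.cong) (auto simp: mon_up power2_eq_square algebra_simps)
      finally show ?thesis .
    qed
    have 0: "L (\<lambda>t. t * F t) \<xi> \<alpha> = 0" by (rule ZD[OF \<alpha> \<xi> F'])
    have x0: "(\<integral>z. ?M (up (up \<alpha> i) i) z - 2 * \<xi> $ i * ?M (up \<alpha> i) z + (\<xi> $ i)\<^sup>2 * ?M \<alpha> z \<partial>lborel) = 0" if "i \<in> - Y" for i
    proof -
      have i: "i \<notin> Y" using that by simp
      have "L F \<xi> (up (up \<alpha> i) i) = 0" "L F \<xi> (up \<alpha> i) = 0" "L F \<xi> \<alpha> = 0"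
        using ZD[OF Zx[OF Zx[OF \<alpha> i] i] \<xi> F] ZD[OF Zx[OF \<alpha> i] \<xi> F] ZD[OF \<alpha> \<xi> F] by auto
      then show ?thesis using iM[of "up (up \<alpha> i) i" \<xi>] iM[of "up \<alpha> i" \<xi>] iM[of \<alpha> \<xi>] by (simp add: L_def)
    qed
    have "L (\<lambda>t. t * F t) \<xi> \<alpha> = (\<integral>z. (\<Sum>j\<in>Y. ?M (up (up \<alpha> j) j) z) \<partial>lborel)
      + (\<integral>z. (\<Sum>i\<in>- Y. ?M (up (up \<alpha> i) i) z - 2 * \<xi> $ i * ?M (up \<alpha> i) z + (\<xi> $ i)\<^sup>2 * ?M \<alpha> z) \<partial>lborel)"
      unfolding L_def pt
      by (rule Bochner_Integration.integral_add)
        (intro Bochner_Integration.integrable_sum Bochner_Integration.integrable_add Bochner_Integration.integrable_diff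
          integrable_mult_right iM)+
    also have "(\<integral>z. (\<Sum>j\<in>Y. ?M (up (up \<alpha> j) j) z) \<partial>lborel) = (\<Sum>j\<in>Y. L F \<xi> (up (up \<alpha> j) j))"
      unfolding L_def by (rule Bochner_Integration.integral_sum) (rule iM)
    also have "(\<integral>z. (\<Sum>i\<in>- Y. ?M (up (up \<alpha> i) i) z - 2 * \<xi> $ i * ?M (up \<alpha> i) z + (\<xi> $ i)\<^sup>2 * ?M \<alpha> z) \<partial>lborel)
       = (\<Sum>i\<in>- Y. \<integral>z. ?M (up (up \<alpha> i) i) z - 2 * \<xi> $ i * ?M (up \<alpha> i) z + (\<xi> $ i)\<^sup>2 * ?M \<alpha> z \<partial>lborel)"
      by (rule Bochner_Integration.integral_sum)
        (intro Bochner_Integration.integrable_add Bochner_Integration.integrable_diff integrable_mult_right iM)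
    also have "\<dots> = 0" using x0 by (rule sum.neutral[OF ballI])
    finally show ?thesis using 0 by simp
  qed
  \<comment> \<open>\<open>rotation_identity\<close> for the monomial \<open>up \<gamma> j\<close>
    times the radial factor. The latter is annihilated by z_i d_j - z_j d_i because \<xi> has no
    components in \<open>Y\<close>, so only the monomial is differentiated.\<close>
  have rotL: "real (Suc (\<gamma> j)) * L F \<xi> (up \<gamma> i) = real (\<gamma> i) * L F \<xi> (up (up (\<gamma>(i := \<gamma> i - 1)) j) j)"
    if ij: "i \<in> Y" "j \<in> Y" "i \<noteq> j" and \<xi>: "y_part Y \<xi> = 0" and F: "profile c F" for i j \<gamma> \<xi> F
  proof -
    let ?\<phi> = "\<lambda>z. mon (up \<gamma> j) z * F ((norm (z - \<xi>))\<^sup>2)"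
    let ?\<delta> = "\<gamma>(i := \<gamma> i - 1)"
    note Fs = profile_smooth[OF F]
    have \<xi>0: "\<xi> $ i = 0" "\<xi> $ j = 0" using \<xi> ij by (auto simp: vec_eq_iff y_part_def split: if_splits)
    have d: "dird (axis k 1) ?\<phi> z = mon (up \<gamma> j) z * (deriv F ((norm (z - \<xi>))\<^sup>2) * (2 * (z $ k - \<xi> $ k)))
      + real (up \<gamma> j k) * mon ((up \<gamma> j)(k := up \<gamma> j k - 1)) z * F ((norm (z - \<xi>))\<^sup>2)" for k z
      by (simp add: dird_mult[OF smooth_mon smooth_radial[OF Fs]] dird_radial[OF Fs] dird_mon inner_axis)
    have u1: "up \<gamma> j i = \<gamma> i" "up \<gamma> j j = Suc (\<gamma> j)" using ij by (auto simp: up_def)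
    have u2: "(up \<gamma> j)(i := \<gamma> i - 1) = up ?\<delta> j" "(up \<gamma> j)(j := \<gamma> j) = \<gamma>"
      using ij by (auto simp: up_def fun_eq_iff)
    have "(\<integral>z. g z * (z $ i * dird (axis j 1) ?\<phi> z - z $ j * dird (axis i 1) ?\<phi> z) \<partial>lborel) = 0"
      by (rule rotation_identity[OF ij(3) g supp inv[OF ij] srad[OF F]])
    moreover have "g z * (z $ i * dird (axis j 1) ?\<phi> z - z $ j * dird (axis i 1) ?\<phi> z)
      = real (Suc (\<gamma> j)) * (g z * (mon (up \<gamma> i) z * F ((norm (z - \<xi>))\<^sup>2)))
       - real (\<gamma> i) * (g z * (mon (up (up ?\<delta> j) j) z * F ((norm (z - \<xi>))\<^sup>2)))" for z
      unfolding d unfolding u1 \<xi>0 diff_Suc_1 unfolding u2 mon_up by (simp add: algebra_simps)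
    ultimately have "real (Suc (\<gamma> j)) * L F \<xi> (up \<gamma> i) - real (\<gamma> i) * L F \<xi> (up (up ?\<delta> j) j) = 0"
      unfolding L_def using int[OF srad[OF F, of "up \<gamma> i" \<xi>]] int[OF srad[OF F, of "up (up ?\<delta> j) j" \<xi>]] by simp
    then show ?thesis by simp
  qed
  have Zall: "Z \<alpha>" for \<alpha>
  proof (induction "sum \<alpha> UNIV" arbitrary: \<alpha> rule: less_induct)
    case less
    show ?case
    proof (cases "\<forall>i. \<alpha> i = 0")
      case True
      then have "\<alpha> = (\<lambda>_. 0)" by auto
      then show ?thesis using Z0 by simp
    next
      case False
      then obtain i where i: "\<alpha> i > 0" by auto
      have dec: "sum (\<beta>(i := \<beta> i - 1)) UNIV < sum \<beta> UNIV" if "\<beta> i > 0" for \<beta> :: "'d \<Rightarrow> nat"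
        by (rule sum_strict_mono_ex1) (use that in auto)
      define \<gamma> where "\<gamma> = \<alpha>(i := \<alpha> i - 1)"
      have \<alpha>\<gamma>: "\<alpha> = up \<gamma> i" using i by (auto simp: \<gamma>_def up_def)
      have Z\<gamma>: "Z \<gamma>" by (rule less) (unfold \<gamma>_def, rule dec, rule i)
      show ?thesis
      proof (cases "i \<in> Y")
        case False
        show ?thesis unfolding \<alpha>\<gamma> by (rule Zx[OF Z\<gamma> False])
      next
        case iY: True
        show ?thesis unfolding Z_def
        proof (intro allI impI)
          fix \<xi> F assume \<xi>: "y_part Y \<xi> = 0" "norm \<xi> < \<epsilon>" and F: "profile c F"
          define \<delta> where "\<delta> = \<gamma>(i := \<gamma> i - 1)"
          \<comment> \<open>This is where \<open>2 \<le> card Y\<close> enters. If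
            \<open>\<gamma> i = 0\<close>, the relation \<open>r\<close> for a single such
            \<open>j\<close> already gives the claim.\<close>
          have "Y \<noteq> {i}" using Y by auto
          then obtain j where j: "j \<in> Y - {i}" using iY by auto
          have r: "real (Suc (\<gamma> j)) * L F \<xi> \<alpha> = real (\<gamma> i) * L F \<xi> (up (up \<delta> j) j)" if "j \<in> Y - {i}" for j
            using rotL[of i j \<xi> F \<gamma>] that iY \<xi>(1) F unfolding \<alpha>\<gamma> \<delta>_def by auto
          show "L F \<xi> \<alpha> = 0"
          proof (cases "\<gamma> i = 0")
            case True
            then show ?thesis using r[OF j] by simp
          next
            case False
            have "Z \<delta>"
            proof (rule less)
              have "sum \<delta> UNIV < sum \<gamma> UNIV" unfolding \<delta>_def by (rule dec) (use False in simp)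
              also have "sum \<gamma> UNIV < sum \<alpha> UNIV" unfolding \<gamma>_def by (rule dec, rule i)
              finally show "sum \<delta> UNIV < sum \<alpha> UNIV" .
            qed
            from Zy[OF this \<xi> F] have "L F \<xi> (up (up \<delta> i) i) + (\<Sum>j\<in>Y - {i}. L F \<xi> (up (up \<delta> j) j)) = 0"
              using iY by (subst (asm) sum.remove) auto
            moreover have "up (up \<delta> i) i = \<alpha>" using False unfolding \<alpha>\<gamma> \<delta>_def by (auto simp: up_def)
            ultimately have s: "(\<Sum>j\<in>Y - {i}. L F \<xi> (up (up \<delta> j) j)) = - L F \<xi> \<alpha>" by simp
            \<comment> \<open>Summing \<open>r\<close> over all \<open>j\<close> and inserting
              \<open>s\<close> expresses a nonnegative multiple of \<open>L F \<xi> \<alpha>\<close>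
              as \<open>- real (\<gamma> i)\<close> times the same quantity; as
              \<open>\<gamma> i > 0\<close>, it must vanish.\<close>
            have "(\<Sum>j\<in>Y - {i}. real (Suc (\<gamma> j))) * L F \<xi> \<alpha> = (\<Sum>j\<in>Y - {i}. real (\<gamma> i) * L F \<xi> (up (up \<delta> j) j))"
              unfolding sum_distrib_right by (rule sum.cong[OF refl]) (rule r)
            also have "\<dots> = - real (\<gamma> i) * L F \<xi> \<alpha>" unfolding sum_distrib_left[symmetric] s by simp
            finally have "((\<Sum>j\<in>Y - {i}. real (Suc (\<gamma> j))) + real (\<gamma> i)) * L F \<xi> \<alpha> = 0" by (simp add: distrib_right)
            moreover have "(\<Sum>j\<in>Y - {i}. real (Suc (\<gamma> j))) \<ge> 0" by (intro sum_nonneg) auto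
            ultimately show ?thesis using False by (auto simp: add_nonneg_eq_0_iff)
          qed
        qed
      qed
    qed
  qed
  obtain F where F: "profile c F" "\<And>t. F t \<ge> 0" "\<And>t. t < c \<Longrightarrow> F t > 0" using profile_bump[of c] by blast
  have "AE z in lborel. g z * F ((norm (z - 0))\<^sup>2) = 0"
  proof (rule AE_zero_of_monomial_integrals)
    show "integrable lborel (\<lambda>z. g z * F ((norm (z - 0))\<^sup>2))" by (rule int[OF smooth_radial[OF profile_smooth[OF F(1)]]])
    show "norm z \<le> 1" if "g z * F ((norm (z - 0))\<^sup>2) \<noteq> 0" for z using that supp by auto
    show "(\<integral>z. g z * F ((norm (z - 0))\<^sup>2) * mon \<alpha> z \<partial>lborel) = 0" for \<alpha>
      using ZD[OF Zall[of \<alpha>] parts_0(1) _ F(1)] \<epsilon> by (simp add: L_def mult_ac)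
  qed
  then show ?thesis
  proof eventually_elim
    case (elim z)
    then show ?case using F(3)[of "(norm z)\<^sup>2"] by auto
  qed
qed

section \<open>Conclusion\<close>

lemma AE_lebesgue_on_ball:
  "(AE z in lebesgue_on (ball 0 1). P z) \<longleftrightarrow> (AE z::'a::euclidean_space in lborel. norm z < 1 \<longrightarrow> P z)"
proof -
  have "ball 0 1 \<inter> space lebesgue \<in> sets (lebesgue :: 'a measure)" by simp
  then show ?thesis by (subst AE_restrict_space_iff) (auto simp: AE_completion_iff)
qed

lemma smooth_representative_ball:
  fixes Y :: "'d::finite set" and u :: "real^'d \<Rightarrow> real"
  assumes Y: "2 \<le> card Y" and a: "real (card Y) + a > 0"
    and sym: "axially_symmetric Y u" and u: "weak_solution Y a u" and R: "0 < R" "R < 1"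
  shows "\<exists>v. smooth v \<and> (AE z in lborel. norm z < R \<longrightarrow> u z = v z)"
proof -
  have Y0: "Y \<noteq> {}" using Y by auto
  let ?\<mu> = "lebesgue_on (ball (0::real^'d) 1)"
  obtain v \<epsilon> where v: "smooth v" and \<epsilon>: "\<epsilon> > 0"
    and vs: "\<And>w w'. x_part Y w = x_part Y w' \<Longrightarrow> norm (y_part Y w) = norm (y_part Y w') \<Longrightarrow> v w = v w'"
    and int: "integrable ?\<mu> (\<lambda>z. weight Y a z * (u z - v z))"
    and mean: "\<And>\<xi> F. y_part Y \<xi> = 0 \<Longrightarrow> norm \<xi> < \<epsilon> \<Longrightarrow> profile (R\<^sup>2) F \<Longrightarrow>
      (\<integral>z. weight Y a z * (u z - v z) * F ((norm (z - \<xi>))\<^sup>2) \<partial>?\<mu>) = 0"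
    using smooth_matching_means[OF Y0 a very_weak_on_weak_solution[OF Y0 a u] R] by blast
  define f where "f z = indicator (ball 0 1) z * (weight Y a z * (u z - v z))" for z
  have B: "ball 0 1 \<inter> space lebesgue \<in> sets (lebesgue :: (real^'d) measure)" by simp
  have fi: "integrable lebesgue f"
    using int unfolding integrable_restrict_space[OF B] f_def by simp
  \<comment> \<open>A Borel representative is taken because the rotations are handled as measurable
    maps on \<open>borel\<close>, with \<open>lborel\<close> as invariant measure.\<close>
  then obtain g0 where g0 [measurable]: "g0 \<in> borel_measurable lborel" and fg0: "AE z in lborel. f z = g0 z"
    using completion_ex_borel_measurable_real[of f lborel] by auto
  define g where "g z = indicator (ball 0 1) z * g0 z" for z
  have [measurable]: "ball (0::real^'d) 1 \<in> sets borel" by simp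
  have gm [measurable]: "g \<in> borel_measurable borel" unfolding g_def using g0 by simp
  have fg: "AE z in lborel. f z = g z"
    using fg0 by eventually_elim (auto simp: f_def g_def indicator_def)
  then have fgl: "AE z in lebesgue. f z = g z" by (rule AE_completion)
  have gl: "g \<in> borel_measurable lebesgue" by (rule measurable_completion) simp
  have gi: "integrable lborel g"
    using integrable_cong_AE[of g lebesgue f] fi fgl gl integrable_completion[of g lborel]
    by (auto simp: eq_commute elim!: eventually_mono)
  have supp: "norm z \<le> 1" if "g z \<noteq> 0" for z using that by (auto simp: g_def indicator_def split: if_splits)
  from sym obtain w where "AE z in ?\<mu>. u z = w (x_part Y z) (norm (y_part Y z))"
    unfolding axially_symmetric_def by blast
  then have w: "AE z in lborel. norm z < 1 \<longrightarrow> u z = w (x_part Y z) (norm (y_part Y z))"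
    unfolding AE_lebesgue_on_ball .
  \<comment> \<open>\<open>\<Gamma>\<close> is invariant under rotations at every point, but may
    fail to be measurable, as \<open>w\<close> is arbitrary. The invariance is therefore carried to
    \<open>g\<close> through null sets.\<close>
  define \<Gamma> where "\<Gamma> z = indicator (ball 0 1) z * (weight Y a z * (w (x_part Y z) (norm (y_part Y z)) - v z))" for z
  have g\<Gamma>: "AE z in lborel. g z = \<Gamma> z"
    using w fg by eventually_elim (auto simp: f_def \<Gamma>_def indicator_def)
  have inv: "AE z in lborel. g (rot i j \<tau> z) = g z" if ij: "i \<in> Y" "j \<in> Y" "i \<noteq> j" for i j \<tau>
  proof -
    have "AE z in distr lborel borel (rot i j \<tau>). g z = \<Gamma> z" using g\<Gamma> unfolding distr_rot[OF ij(3)] .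
    then have "AE z in lborel. g (rot i j \<tau> z) = \<Gamma> (rot i j \<tau> z)" by (rule AE_distrD[rotated]) simp
    with g\<Gamma> show ?thesis
    proof eventually_elim
      case (elim z)
      note p = rot_parts[OF ij(3,1,2), of \<tau> z]
      have "\<Gamma> (rot i j \<tau> z) = \<Gamma> z"
        using vs[of "rot i j \<tau> z" z, OF p] by (simp add: \<Gamma>_def p weight_def norm_rot[OF ij(3)] indicator_def)
      with elim show ?case by simp
    qed
  qed
  have means: "(\<integral>z. g z * F ((norm (z - \<xi>))\<^sup>2) \<partial>lborel) = 0"
    if \<xi>: "y_part Y \<xi> = 0" "norm \<xi> < \<epsilon>" and F: "profile (R\<^sup>2) F" for \<xi> F
  proof -
    have Fm [measurable]: "(\<lambda>z. F ((norm (z - \<xi>))\<^sup>2)) \<in> borel_measurable borel"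
      by (rule smooth_borel[OF smooth_radial[OF profile_smooth[OF F]]])
    have m1: "(\<lambda>z. g z * F ((norm (z - \<xi>))\<^sup>2)) \<in> borel_measurable lborel" by simp
    have m2: "(\<lambda>z. F ((norm (z - \<xi>))\<^sup>2)) \<in> borel_measurable lebesgue" by (rule measurable_completion) simp
    have "(\<integral>z. g z * F ((norm (z - \<xi>))\<^sup>2) \<partial>lborel) = (\<integral>z. g z * F ((norm (z - \<xi>))\<^sup>2) \<partial>lebesgue)"
      by (rule integral_completion[OF m1, symmetric])
    also have "\<dots> = (\<integral>z. f z * F ((norm (z - \<xi>))\<^sup>2) \<partial>lebesgue)"
    proof (rule integral_cong_AE)
      show "(\<lambda>z. g z * F ((norm (z - \<xi>))\<^sup>2)) \<in> borel_measurable lebesgue" using gl m2 by simp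
      show "(\<lambda>z. f z * F ((norm (z - \<xi>))\<^sup>2)) \<in> borel_measurable lebesgue" using fi m2 by simp
      show "AE z in lebesgue. g z * F ((norm (z - \<xi>))\<^sup>2) = f z * F ((norm (z - \<xi>))\<^sup>2)"
        using fgl by eventually_elim simp
    qed
    also have "\<dots> = (\<integral>z. weight Y a z * (u z - v z) * F ((norm (z - \<xi>))\<^sup>2) \<partial>?\<mu>)"
      unfolding integral_restrict_space[OF B] f_def by (simp add: mult.assoc)
    finally show ?thesis using mean[OF \<xi> F] by simp
  qed
  have "AE z in lborel. (norm z)\<^sup>2 < R\<^sup>2 \<longrightarrow> g z = 0"
    by (rule axial_uniqueness[OF Y gi supp inv \<epsilon> means])
  then have "AE z in lborel. norm z < R \<longrightarrow> u z = v z"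
    using fg AE_y_part_nonzero[OF Y0]
  proof eventually_elim
    case (elim z)
    show ?case
    proof
      assume z: "norm z < R"
      then have "(norm z)\<^sup>2 < R\<^sup>2" by (intro power_strict_mono) auto
      then have "f z = 0" using elim by simp
      moreover have "norm z < 1" using z R by simp
      moreover have "weight Y a z > 0" using elim(3) by (simp add: weight_def)
      ultimately show "u z = v z" by (simp add: f_def)
    qed
  qed
  with v show ?thesis by blast
qed

lemma continuous_AE_eq_ball:
  fixes f g :: "'a::euclidean_space \<Rightarrow> real"
  assumes f: "continuous_on UNIV f" and g: "continuous_on UNIV g" and eq: "AE z in lborel. norm z < r \<longrightarrow> f z = g z"
    and z: "norm z < r"
  shows "f z = g z"
proof (rule ccontr)
  assume ne: "f z \<noteq> g z"
  let ?S = "ball 0 r \<inter> {z. f z \<noteq> g z}"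
  have S: "open ?S" by (intro open_Int open_ball open_Collect_neq f g)
  have "AE z in lborel. z \<notin> ?S" using eq by eventually_elim auto
  then have "?S \<in> null_sets lborel" using S by (subst AE_iff_null_sets) auto
  then have "negligible ?S" by (simp add: negligible_iff_null_sets null_sets_completionI)
  moreover have "?S \<noteq> {}" using ne z by auto
  ultimately show False using open_not_negligible[OF S] by blast
qed

theorem theorem2p5:
  fixes Y :: "'d::finite set" and n :: nat and a :: real and u :: "real^'d \<Rightarrow> real"
  assumes "card Y = n" and "2 \<le> n" and "n \<le> CARD('d)"
    and "a + real n > 0"
    and "u \<in> H1_weighted Y a"
    and "axially_symmetric Y u"
    and "weak_solution Y a u"
  shows "\<exists>v :: real^'d \<Rightarrow> real. smooth_on (ball 0 1) v \<and>
           (AE z in lebesgue_on (ball 0 1). u z = v z)"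
proof -
  \<comment> \<open>Radii increasing to 1; the shift by 2 makes \<open>R 0\<close> positive.\<close>
  define R where "R k = 1 - inverse (real (k + 2))" for k :: nat
  have R: "0 < R k" "R k < 1" for k by (auto simp: R_def field_simps)
  have Rk: "\<exists>k. r < R k" if r: "r < 1" for r
  proof -
    obtain k where "inverse (real (Suc k)) < 1 - r" using reals_Archimedean[of "1 - r"] r by auto
    moreover have "inverse (real (k + 2)) \<le> inverse (real (Suc k))" by (simp add: field_simps)
    ultimately have "r < R k" unfolding R_def by linarith
    then show ?thesis by blast
  qed
  have "\<exists>v. smooth v \<and> (AE z in lborel. norm z < R k \<longrightarrow> u z = v z)" for k
    by (rule smooth_representative_ball[where Y=Y and a=a]) (use assms R in auto)
  then obtain V where V: "\<And>k. smooth (V k)" "\<And>k. AE z in lborel. norm z < R k \<longrightarrow> u z = V k z"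
    by metis
  \<comment> \<open>Any index with \<open>norm z < R k\<close> gives the same value, by
    \<open>V_eq\<close>; the least one merely fixes a choice. Near a given point \<open>v\<close>
    thus coincides with one globally smooth \<open>V j\<close>.\<close>
  define K where "K z = (LEAST k. norm z < R k)" for z :: "real^'d"
  have K: "norm z < R (K z)" if "norm z < 1" for z
    unfolding K_def using Rk[OF that] by (metis LeastI)
  define v where "v z = V (K z) z" for z
  have mono: "R j \<le> R k" if "j \<le> k" for j k using that by (simp add: R_def field_simps)
  have V_eq: "V j z = V k z" if "norm z < R j" "norm z < R k" for j k z
  proof (rule continuous_AE_eq_ball[of "V j" "V k" "min (R j) (R k)"])
    show "AE z in lborel. norm z < min (R j) (R k) \<longrightarrow> V j z = V k z"
      using V(2)[of j] V(2)[of k] by eventually_elim auto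
  qed (use V(1) that in \<open>auto intro: smooth_continuous_on\<close>)
  have "smooth_on (ball 0 1) v"
    unfolding smooth_on_def
  proof
    fix k
    show "Ck_on k (ball 0 1) v"
    proof (rule Ck_on_local)
      fix x :: "real^'d" assume "x \<in> ball 0 1"
      then obtain j where j: "norm x < R j" using Rk by auto
      have "v y = V j y" if "y \<in> ball 0 (R j)" for y
        using V_eq[of y "K y" j] K[of y] that R(2)[of j] by (auto simp: v_def)
      then show "\<exists>T g. open T \<and> x \<in> T \<and> Ck_on k UNIV g \<and> (\<forall>y\<in>T. v y = g y)"
        using j V(1)[of j] by (intro exI[of _ "ball 0 (R j)"] exI[of _ "V j"]) (auto simp: smooth_Ck)
    qed simp
  qed
  moreover have "AE z in lebesgue_on (ball 0 1). u z = v z"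
    unfolding AE_lebesgue_on_ball
  proof -
    have "AE z in lborel. \<forall>k. norm z < R k \<longrightarrow> u z = V k z"
      using V(2) by (simp add: AE_all_countable)
    then show "AE z in lborel. norm z < 1 \<longrightarrow> u z = v z"
      by eventually_elim (auto simp: v_def K)
  qed
  ultimately show ?thesis by blast
qed

end
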